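(* Let $\Gamma$ be an infinite row-finite directed graph, $F:\Gamma_{Ar}\to\mathbb R$ a potential and $\beta\in\mathbb R$, and assume that there is a vertex $v_0\in\Gamma_V$ such that $$0<\sum_{n=0}^\infty A(\beta)^n_{v_0,v}<\infty$$ for all $v\in\Gamma_V$. There are affine homeomorphisms between the following sets: a) the $v_0$-normalized $e^{\beta F}$-conformal measures on $P(\Gamma)$; b) the set $\Delta_{\beta F}$; c) the $v_0$-normalized $e^{F_\beta}$-conformal measures on $P(\mathrm{Br}(\Gamma))$.
   Context: A countable directed graph $\Gamma$ consists of countable sets $\Gamma_V$ (vertices) and $\Gamma_{Ar}$ (arrows) with source and range maps $s,r:\Gamma_{Ar}\to\Gamma_V$ (multiple arrows and loops allowed); it is row-finite if $\#s^{-1}(v)<\infty$ for all $v$. $P(\Gamma)$ is the set of infinite paths $p=(p_i)_{i\ge1}\in(\Gamma_{Ar})^{\mathbb N}$, $r(p_i)=s(p_{i+1})$, with the topology inherited from the product of discrete spaces. $P_f(\Gamma)$ is the set of finite paths $\mu=a_1\cdots a_n$ (vertices are paths of length $0$), $s(\mu)=s(a_1)$, $r(\mu)=r(a_n)$; $Z(\mu)=\{x\in P(\Gamma):x_i=a_i,\ 1\le i\le n\}$, and $Z(v)=\{p:s(p_1)=v\}$. The shift is $\sigma(p)_i=p_{i+1}$. $F$ is extended to finite paths by $F(a_1\cdots a_n)=\sum_iF(a_i)$, $F(v)=0$. $A(\beta)_{v,w}=\sum_{a\in s^{-1}(v)\cap r^{-1}(w)}e^{-\beta F(a)}$, with matrix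 powers $A(\beta)^n$, $A(\beta)^0$ the identity. For any digraph $\Lambda$ and function $G:\Lambda_{Ar}\to\mathbb R$, an $e^{G}$-conformal measure on $P(\Lambda)$ is a non-zero Borel measure $m$ with $m(Z(v))<\infty$ for all vertices $v$ and $m(\sigma(B\cap Z(a)))=e^{G(a)}m(B\cap Z(a))$ for all arrows $a$ and Borel sets $B$. It is $v_0$-normalized if $m(Z(v_0))=1$. Sets of conformal measures are given the weakest topology making all maps $m\mapsto m(Z(\mu))$, $\mu$ a finite path, continuous. $\mathrm{Wan}(\Gamma)$ is the set of $p\in P(\Gamma)$ such that for each finite $H\subseteq\Gamma_V$ there is $N$ with $s(p_i)\notin H$ for all $i\ge N$. For $H\subseteq\Gamma_V$ let $\mathrm{Int}\,H=\{v\in H:r(s^{-1}(v))\subseteq H\}$ and write $H\sqsubset H'$ if $H\subseteq\mathrm{Int}\,H'$. Fix a sequence $\{v_0\}\sqsubset D_1\sqsubset D_2\sqsubset\cdots$ of finite subsets of $\Gamma_V$ with $\bigcup_nD_n=\Gamma_V$, and set $D_0=\{v_0\}$. For $D\subseteq\Gamma_V$ and $w\in D$ let $\Omega_D(w)=\{y\in\mathrm{Wan}(\Gamma):s(y_1)=w,\ s(y_i)\notin D\ \forall i\ge2\}$ and $\partial D=\{w\in D:\Omega_D(w)\ne\emptyset\}$. For $v\in D$, $w\notin D$, let $L_D(v,w)$ be the set of finite paths $a_1\cdots a_n$ from $v$ to $w$ with $r(a_i)\notin D$ for all $i$. $\mathrm{Br}(\Gamma)$ is the Bratteli diagram (viewed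 as a digraph) whose $n$'th level of vertices, $n=0,1,2,\dots$, is $\partial D_n$, with exactly one arrow from $v\in\partial D_n$ to $w\in\partial D_{n+1}$ when $L_{D_n}(v,w)\neq\emptyset$, and no other arrows. Its top vertex is $v_0$. For an arrow $a$ of $\mathrm{Br}(\Gamma)$ from $v\in\partial D_k$ to $w\in\partial D_{k+1}$ put $F_\beta(a)=-\log\big(\sum_{\mu\in L_{D_k}(v,w)}e^{-\beta F(\mu)}\big)$. For $n\ge0$ let $M(n):\partial D_n\times\partial D_{n+1}\to[0,\infty)$ be the matrix $M(n)_{v,w}=\sum_{\mu\in L_{D_n}(v,w)}e^{-\beta F(\mu)}$. $\Delta_{\beta F}$ is the set of sequences $(\psi^k)_{k=1}^\infty\in\prod_{k=1}^\infty[0,\infty)^{\partial D_k}$ (with the product topology) such that $M(0)\psi^1=\big(\sum_{k=0}^\infty A(\beta)^k_{v_0,v_0}\big)^{-1}$ and $M(n)\psi^{n+1}=\psi^n$ for all $n\ge1$. *)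

theory Defs
  imports "HOL-Analysis.Analysis" "Graph_Theory.Digraph" "Graph_Theory.Arc_Walk"
begin

text \<open>
  Directed graphs are the multigraphs \<^typ>\<open>('v, 'a) pre_digraph\<close>; \<^const>\<open>tail\<close> is the source
  map and \<^const>\<open>head\<close> the range map. A finite path of length \<open>n \<ge> 0\<close> from \<open>u\<close> to \<open>v\<close> is an arc
  walk \<^term>\<open>pre_digraph.awalk G u p v\<close>; it is the pair \<open>(u, p)\<close> that determines the path, since for
  \<open>p = []\<close> it is the vertex \<open>u\<close>. Infinite paths are indexed from \<open>0\<close>.
\<close>

definition row_finite :: "('v, 'a) pre_digraph \<Rightarrow> bool" where
  "row_finite G \<longleftrightarrow> (\<forall>v\<in>verts G. finite (out_arcs G v))"

definition inf_paths :: "('v, 'a) pre_digraph \<Rightarrow> (nat \<Rightarrow> 'a) set" where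
  "inf_paths G = {p. (\<forall>i. p i \<in> arcs G) \<and> (\<forall>i. head G (p i) = tail G (p (Suc i)))}"

definition path_topology :: "('v, 'a) pre_digraph \<Rightarrow> (nat \<Rightarrow> 'a) topology" where
  "path_topology G =
     subtopology (product_topology (\<lambda>_. discrete_topology (arcs G)) UNIV) (inf_paths G)"

definition path_borel :: "('v, 'a) pre_digraph \<Rightarrow> (nat \<Rightarrow> 'a) measure" where
  "path_borel G = sigma (inf_paths G) {U. openin (path_topology G) U}"

text \<open>
  The condition on the source only matters for \<open>p = []\<close>, so \<open>cylinder G v []\<close> is \<open>Z(v)\<close>, and \<open>Z(a)\<close> for
  an arrow \<open>a\<close> is \<open>cylinder G (tail G a) [a]\<close>.
\<close>

definition cylinder :: "('v, 'a) pre_digraph \<Rightarrow> 'v \<Rightarrow> 'a list \<Rightarrow> (nat \<Rightarrow> 'a) set" where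
  "cylinder G u p = {x \<in> inf_paths G. tail G (x 0) = u \<and> (\<forall>i<length p. x i = p ! i)}"

definition shift :: "(nat \<Rightarrow> 'a) \<Rightarrow> nat \<Rightarrow> 'a" where
  "shift p = (\<lambda>i. p (Suc i))"


subsection \<open>Conformal measures\<close>

definition conformal_measure ::
    "('v, 'a) pre_digraph \<Rightarrow> ('a \<Rightarrow> real) \<Rightarrow> (nat \<Rightarrow> 'a) measure \<Rightarrow> bool" where
  "conformal_measure G F m \<longleftrightarrow>
     sets m = sets (path_borel G) \<and>
     emeasure m (inf_paths G) \<noteq> 0 \<and>
     (\<forall>v\<in>verts G. emeasure m (cylinder G v []) < \<infinity>) \<and>
     (\<forall>a\<in>arcs G. \<forall>B\<in>sets (path_borel G).
        emeasure m (shift ` (B \<inter> cylinder G (tail G a) [a])) =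
          ennreal (exp (F a)) * emeasure m (B \<inter> cylinder G (tail G a) [a]))"

definition normalized_conformal ::
    "('v, 'a) pre_digraph \<Rightarrow> ('a \<Rightarrow> real) \<Rightarrow> 'v \<Rightarrow> (nat \<Rightarrow> 'a) measure set" where
  "normalized_conformal G F v0 =
     {m. conformal_measure G F m \<and> emeasure m (cylinder G v0 []) = 1}"

text \<open>
  The weakest topology on a set \<open>S\<close> of measures that makes all evaluations on cylinders continuous.
  The generator \<open>S\<close> itself is redundant as soon as \<open>G\<close> has a vertex.
\<close>

definition cylinder_topology ::
    "('v, 'a) pre_digraph \<Rightarrow> (nat \<Rightarrow> 'a) measure set \<Rightarrow> (nat \<Rightarrow> 'a) measure topology" where
  "cylinder_topology G S = topology_generated_by
     (insert S {{m \<in> S. measure m (cylinder G u p) \<in> U} | u p U.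
                  (\<exists>v. pre_digraph.awalk G u p v) \<and> open U})"

definition mix_measure :: "real \<Rightarrow> 'x measure \<Rightarrow> 'x measure \<Rightarrow> 'x measure" where
  "mix_measure t m m' = measure_of (space m) (sets m)
     (\<lambda>B. ennreal t * emeasure m B + ennreal (1 - t) * emeasure m' B)"

lemma sets_mix_measure [simp]: "sets (mix_measure t m m') = sets m"
  and space_mix_measure [simp]: "space (mix_measure t m m') = space m"
  by (simp_all add: mix_measure_def)

lemma emeasure_mix_measure:
  assumes "sets m' = sets m" and B: "B \<in> sets m"
  shows "emeasure (mix_measure t m m') B =
           ennreal t * emeasure m B + ennreal (1 - t) * emeasure m' B"
proof (rule emeasure_measure_of[OF mix_measure_def])
  show "countably_additive (sets (mix_measure t m m'))
          (\<lambda>B. ennreal t * emeasure m B + ennreal (1 - t) * emeasure m' B)"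
  proof (rule countably_additiveI)
    fix A :: "nat \<Rightarrow> 'a set"
    assume A: "range A \<subseteq> sets (mix_measure t m m')" "disjoint_family A"
    have "(\<Sum>i. ennreal t * emeasure m (A i) + ennreal (1 - t) * emeasure m' (A i)) =
        ennreal t * (\<Sum>i. emeasure m (A i)) + ennreal (1 - t) * (\<Sum>i. emeasure m' (A i))"
      by (simp add: suminf_add[symmetric])
    then show "(\<Sum>i. ennreal t * emeasure m (A i) + ennreal (1 - t) * emeasure m' (A i)) =
        ennreal t * emeasure m (\<Union> (range A)) + ennreal (1 - t) * emeasure m' (\<Union> (range A))"
      using A assms(1) by (simp add: suminf_emeasure)
  qed
qed (use B in \<open>auto simp: positive_def dest: sets.sets_into_space\<close>)


subsection \<open>The matrices \<open>A(\<beta>)\<close> and their powers\<close>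

definition weight_matrix ::
    "('v, 'a) pre_digraph \<Rightarrow> ('a \<Rightarrow> real) \<Rightarrow> real \<Rightarrow> 'v \<Rightarrow> 'v \<Rightarrow> real" where
  "weight_matrix G F \<beta> v w = (\<Sum>a \<in> out_arcs G v \<inter> in_arcs G w. exp (- \<beta> * F a))"

text \<open>
  When the graph is row-finite, only finitely many terms of the sum over all vertices are non-zero.
\<close>

primrec weight_matrix_power ::
    "('v, 'a) pre_digraph \<Rightarrow> ('a \<Rightarrow> real) \<Rightarrow> real \<Rightarrow> nat \<Rightarrow> 'v \<Rightarrow> 'v \<Rightarrow> real" where
  "weight_matrix_power G F \<beta> 0 v w = (if v = w then 1 else 0)"
| "weight_matrix_power G F \<beta> (Suc n) v w =
     (\<Sum>\<^sub>\<infinity>u\<in>verts G. weight_matrix G F \<beta> v u * weight_matrix_power G F \<beta> n u w)"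


subsection \<open>Exhaustions and the Bratteli diagram\<close>

definition wandering :: "('v, 'a) pre_digraph \<Rightarrow> (nat \<Rightarrow> 'a) set" where
  "wandering G = {p \<in> inf_paths G.
     \<forall>H. finite H \<and> H \<subseteq> verts G \<longrightarrow> (\<exists>N. \<forall>i\<ge>N. tail G (p i) \<notin> H)}"

definition vertex_interior :: "('v, 'a) pre_digraph \<Rightarrow> 'v set \<Rightarrow> 'v set" where
  "vertex_interior G H = {v \<in> H. head G ` out_arcs G v \<subseteq> H}"

definition exhaustion :: "('v, 'a) pre_digraph \<Rightarrow> 'v \<Rightarrow> (nat \<Rightarrow> 'v set) \<Rightarrow> bool" where
  "exhaustion G v0 D \<longleftrightarrow>
     D 0 = {v0} \<and>
     (\<forall>n. finite (D n) \<and> D n \<subseteq> verts G \<and> D n \<subseteq> vertex_interior G (D (Suc n))) \<and>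
     (\<Union>n. D n) = verts G"

definition exit_paths :: "('v, 'a) pre_digraph \<Rightarrow> 'v set \<Rightarrow> 'v \<Rightarrow> (nat \<Rightarrow> 'a) set" where
  "exit_paths G D w = {y \<in> wandering G. tail G (y 0) = w \<and> (\<forall>i\<ge>1. tail G (y i) \<notin> D)}"

definition vertex_boundary :: "('v, 'a) pre_digraph \<Rightarrow> 'v set \<Rightarrow> 'v set" where
  "vertex_boundary G D = {w \<in> D. exit_paths G D w \<noteq> {}}"

text \<open>Only used for \<open>v \<in> D\<close> and \<open>w \<notin> D\<close>, so that the walks have positive length.\<close>

definition leaving_walks :: "('v, 'a) pre_digraph \<Rightarrow> 'v set \<Rightarrow> 'v \<Rightarrow> 'v \<Rightarrow> 'a list set" where
  "leaving_walks G D v w = {p. pre_digraph.awalk G v p w \<and> (\<forall>a\<in>set p. head G a \<notin> D)}"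

text \<open>
  The entries \<open>M(n)\<^bsub>v,w\<^esub>\<close>. For \<open>v\<close> reachable from \<open>v\<^sub>0\<close> the family is dominated by
  \<open>\<Sum>k. A(\<beta>)\<^sup>k\<^bsub>v,w\<^esub>\<close>, hence summable whenever the sums \<open>\<Sum>k. A(\<beta>)\<^sup>k\<^bsub>v\<^sub>0,w\<^esub>\<close> are finite.
\<close>

definition transfer_matrix ::
    "('v, 'a) pre_digraph \<Rightarrow> ('a \<Rightarrow> real) \<Rightarrow> real \<Rightarrow> (nat \<Rightarrow> 'v set) \<Rightarrow> nat \<Rightarrow> 'v \<Rightarrow> 'v \<Rightarrow> real" where
  "transfer_matrix G F \<beta> D n v w =
     (\<Sum>\<^sub>\<infinity>\<mu>\<in>leaving_walks G (D n) v w. exp (- \<beta> * sum_list (map F \<mu>)))"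

text \<open>
  Vertices of the Bratteli diagram are tagged with their level; the arrow from \<open>(n, v)\<close> to
  \<open>(Suc n, w)\<close> is \<open>(n, v, w)\<close>.
\<close>

definition bratteli ::
    "('v, 'a) pre_digraph \<Rightarrow> (nat \<Rightarrow> 'v set) \<Rightarrow> (nat \<times> 'v, nat \<times> 'v \<times> 'v) pre_digraph" where
  "bratteli G D =
     \<lparr>verts = (SIGMA n:UNIV. vertex_boundary G (D n)),
      arcs = {(n, v, w). v \<in> vertex_boundary G (D n) \<and> w \<in> vertex_boundary G (D (Suc n)) \<and>
                         leaving_walks G (D n) v w \<noteq> {}},
      tail = (\<lambda>(n, v, w). (n, v)),
      head = (\<lambda>(n, v, w). (Suc n, w))\<rparr>"

definition bratteli_potential ::
    "('v, 'a) pre_digraph \<Rightarrow> ('a \<Rightarrow> real) \<Rightarrow> real \<Rightarrow> (nat \<Rightarrow> 'v set) \<Rightarrow> nat \<times> 'v \<times> 'v \<Rightarrow> real" where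
  "bratteli_potential G F \<beta> D = (\<lambda>(n, v, w). - ln (transfer_matrix G F \<beta> D n v w))"


subsection \<open>The set \<open>\<Delta>\<^bsub>\<beta>F\<^esub>\<close>\<close>

definition boundary_sequence_topology ::
    "('v, 'a) pre_digraph \<Rightarrow> (nat \<Rightarrow> 'v set) \<Rightarrow> (nat \<Rightarrow> 'v \<Rightarrow> real) topology" where
  "boundary_sequence_topology G D =
     product_topology
       (\<lambda>k. product_topology (\<lambda>_. top_of_set {0..}) (vertex_boundary G (D k))) {1..}"

definition Delta ::
    "('v, 'a) pre_digraph \<Rightarrow> ('a \<Rightarrow> real) \<Rightarrow> real \<Rightarrow> 'v \<Rightarrow> (nat \<Rightarrow> 'v set) \<Rightarrow> (nat \<Rightarrow> 'v \<Rightarrow> real) set" where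
  "Delta G F \<beta> v0 D =
     {\<psi> \<in> topspace (boundary_sequence_topology G D).
        (\<Sum>w\<in>vertex_boundary G (D 1). transfer_matrix G F \<beta> D 0 v0 w * \<psi> 1 w) =
          inverse (\<Sum>k. weight_matrix_power G F \<beta> k v0 v0) \<and>
        (\<forall>n\<ge>1. \<forall>v\<in>vertex_boundary G (D n).
           (\<Sum>w\<in>vertex_boundary G (D (Suc n)). transfer_matrix G F \<beta> D n v w * \<psi> (Suc n) w) = \<psi> n v)}"

text \<open>
  Elements of the product are extensional, i.e. \<^const>\<open>undefined\<close> off the index sets. Pointwise
  combinations respect this, as \<open>t * c + (1 - t) * c = c\<close>.
\<close>

definition mix_sequence ::
    "real \<Rightarrow> (nat \<Rightarrow> 'v \<Rightarrow> real) \<Rightarrow> (nat \<Rightarrow> 'v \<Rightarrow> real) \<Rightarrow> nat \<Rightarrow> 'v \<Rightarrow> real" where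
  "mix_sequence t \<psi> \<phi> = (\<lambda>k v. t * \<psi> k v + (1 - t) * \<phi> k v)"


subsection \<open>Affine homeomorphisms\<close>

text \<open>
  \<open>mixX t x y\<close> stands for the convex combination \<open>t x + (1 - t) y\<close>.
\<close>

definition affinely_homeomorphic ::
    "'x topology \<Rightarrow> (real \<Rightarrow> 'x \<Rightarrow> 'x \<Rightarrow> 'x) \<Rightarrow> 'y topology \<Rightarrow> (real \<Rightarrow> 'y \<Rightarrow> 'y \<Rightarrow> 'y) \<Rightarrow> bool" where
  "affinely_homeomorphic X mixX Y mixY \<longleftrightarrow>
     (\<exists>f. homeomorphic_map X Y f \<and>
          (\<forall>x\<in>topspace X. \<forall>y\<in>topspace X. \<forall>t\<in>{0..1}.
             f (mixX t x y) = mixY t (f x) (f y)))"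

end

theory Submission
  imports Defs
begin

text \<open>
All three sets are compared with sets of normalized non-negative harmonic functions, topologized
pointwise on vertices.

A conformal measure \<open>m\<close> is determined by the function \<open>h v = m(Z(v))\<close>: conformality forces
\<open>m(Z(\<mu>)) = e\<^bsup>-F(\<mu>)\<^esup> h(r(\<mu>))\<close>, and cutting \<open>Z(v)\<close> according to the first arrow shows that \<open>h\<close> is
harmonic, \<open>h v = \<Sum>a. e\<^bsup>-F(a)\<^esup> h(r(a))\<close>. Conversely every normalized non-negative harmonic function comes
from a conformal measure. The interval \<open>[0, h v)\<close> is cut into pieces of length \<open>e\<^bsup>-F(a)\<^esup> h(r(a))\<close>, one for
each arrow \<open>a\<close> out of \<open>v\<close>; a point of a piece selects that arrow and is then rescaled to a point
of \<open>[0, h(r(a)))\<close>. Iterating this turns a point of \<open>[0, h v)\<close> into an infinite path, and the image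
of Lebesgue measure is conformal because the rescaling along \<open>a\<close> is affine with slope \<open>e\<^bsup>F(a)\<^esup>\<close>.
The resulting bijection \<open>conformal_homeomorphic_harmonic\<close> is an affine homeomorphism, and it
holds for \<open>\<Gamma>\<close> and for its Bratteli diagram alike.

On the diagram a harmonic function is, by the very choice of the potential, a sequence solving
the equations \<open>M(n) \<psi>\<^bsup>n+1\<^esup> = \<psi>\<^bsup>n\<^esup>\<close>; only the normalization differs, by the factor
\<open>\<Sum>k. A(\<beta>)\<^sup>k\<^bsub>v0,v0\<^esub>\<close>. This gives the comparison of \<open>\<Delta>\<^bsub>\<beta>F\<^esub>\<close> with the diagram
(\<open>Del_homeomorphic_harmonic_Br\<close>).

On \<open>\<Gamma>\<close> let \<open>g(v,w)\<close> be the total weight of all walks from \<open>v\<close> to \<open>w\<close>, that is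
\<open>\<Sum>k. A(\<beta>)\<^sup>k\<^bsub>v,w\<^esub>\<close>; the values \<open>g(v0,w)\<close> are finite by hypothesis, and all
others because every vertex can be reached from \<open>v0\<close>. By the Borel-Cantelli lemma almost every path visits every vertex finitely often, so it is wandering, and a path that
starts in \<open>D\<^sub>n\<close> has a last visit to \<open>D\<^sub>n\<close>. Splitting it there gives
\<open>h v = \<Sum>w. g(v,w) \<psi>\<^sup>n\<^bsub>w\<^esub>\<close> for \<open>v\<close> in \<open>D\<^sub>n\<close>, where \<open>\<psi>\<^sup>n\<^bsub>w\<^esub>\<close> is the mass of the paths from \<open>w\<close> that never
return to \<open>D\<^sub>n\<close> (\<open>measure_cylinder_last_visit\<close>). Splitting walks at their last visit to \<open>D\<^sub>n\<close>
gives \<open>g(v,w) = \<Sum>u. g(v,u) M(n)\<^bsub>u,w\<^esub>\<close> for \<open>w\<close> in \<open>\<partial>D\<^bsub>n+1\<^esub>\<close>, so that the equations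
\<open>M(n) \<psi>\<^bsup>n+1\<^esup> = \<psi>\<^bsup>n\<^esup>\<close> say exactly that the functions \<open>\<Sum>w. g(\<cdot>,w) \<psi>\<^sup>n\<^bsub>w\<^esub>\<close> extend one another. Their
union is harmonic.

Bijectivity and continuity both come from the fact that \<open>g\<close>, restricted to the finite set \<open>D\<^sub>n\<close>, is
an invertible matrix. Splitting walks at their first return to \<open>D\<^sub>n\<close> shows that its inverse is
\<open>1 - R\<close>, where \<open>R\<close> collects the weights of the first-return walks (\<open>no_return_matrix_green\<close>). So
\<open>\<psi>\<^sup>n\<close> is a finite linear expression in the values of \<open>h\<close> on \<open>D\<^sub>n\<close> and conversely. What the measure
adds to this linear algebra is that \<open>\<psi>\<^sup>n\<close> is non-negative and lives on \<open>\<partial>D\<^sub>n\<close>.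
\<close>

section \<open>The space of infinite paths\<close>

text \<open>
The hypotheses on a digraph that are shared by \<open>\<Gamma>\<close> and its Bratteli diagram, so that the
correspondence between measures and harmonic functions can be used for both.
\<close>

locale path_space = wf_digraph G for G :: "('v, 'a) pre_digraph" +
  assumes countable_verts: "countable (verts G)"
    and countable_arcs: "countable (arcs G)"
    and row_finite: "row_finite G"
begin

lemma finite_out_arcs: "v \<in> verts G \<Longrightarrow> finite (out_arcs G v)"
  using row_finite by (simp add: row_finite_def)

definition cylinders :: "(nat \<Rightarrow> 'a) set set" where
  "cylinders = {cylinder G u p | u p. \<exists>v. awalk u p v}"

lemma topspace_path_topology [simp]: "topspace (path_topology G) = inf_paths G"
  by (auto simp: path_topology_def inf_paths_def)

lemma space_path_borel [simp]: "space (path_borel G) = inf_paths G"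
  unfolding path_borel_def
  by (rule space_measure_of) (use openin_subset in force)

lemma sets_path_borel_open:
  "sets (path_borel G) = sigma_sets (inf_paths G) {U. openin (path_topology G) U}"
  unfolding path_borel_def
  by (rule sets_measure_of) (use openin_subset in force)

lemma openin_path_borel: "openin (path_topology G) U \<Longrightarrow> U \<in> sets (path_borel G)"
  by (simp add: sets_path_borel_open sigma_sets.Basic)

lemma openin_coordinate: "openin (path_topology G) {x \<in> inf_paths G. x i \<in> A}"
proof -
  have "continuous_map (path_topology G) (discrete_topology (arcs G)) (\<lambda>x. x i)"
    unfolding path_topology_def
    by (intro continuous_map_from_subtopology continuous_map_product_projection) auto
  from openin_continuous_map_preimage[OF this, of "A \<inter> arcs G"]
  have "openin (path_topology G) {x \<in> inf_paths G. x i \<in> A \<inter> arcs G}"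
    by simp
  moreover have "{x \<in> inf_paths G. x i \<in> A \<inter> arcs G} = {x \<in> inf_paths G. x i \<in> A}"
    by (auto simp: inf_paths_def)
  ultimately show ?thesis by simp
qed

lemma measurable_coordinate [measurable]: "(\<lambda>x. x i) \<in> path_borel G \<rightarrow>\<^sub>M count_space (arcs G)"
proof (rule measurableI)
  fix A
  have "(\<lambda>x. x i) -` A \<inter> space (path_borel G) = {x \<in> inf_paths G. x i \<in> A}"
    by auto
  then show "(\<lambda>x. x i) -` A \<inter> space (path_borel G) \<in> sets (path_borel G)"
    using openin_path_borel[OF openin_coordinate] by simp
qed (auto simp: inf_paths_def)

lemma pred_coordinate [measurable]: "Measurable.pred (path_borel G) (\<lambda>x. P (x i))"
  using measurable_compose[OF measurable_coordinate[of i], of P "count_space UNIV"] by simp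

lemma sets_cylinder [measurable]: "cylinder G u p \<in> sets (path_borel G)"
proof -
  have "cylinder G u p =
      {x \<in> space (path_borel G). tail G (x 0) = u \<and> (\<forall>i\<in>{..<length p}. x i = p ! i)}"
    by (auto simp: cylinder_def)
  also have "\<dots> \<in> sets (path_borel G)"
    by measurable
  finally show ?thesis .
qed

lemma inf_path_arc: "x \<in> inf_paths G \<Longrightarrow> x i \<in> arcs G"
  by (auto simp: inf_paths_def)

lemma inf_path_head: "x \<in> inf_paths G \<Longrightarrow> head G (x i) = tail G (x (Suc i))"
  by (auto simp: inf_paths_def)

lemma inf_path_tail: "x \<in> inf_paths G \<Longrightarrow> tail G (x i) \<in> verts G"
  using inf_path_arc by auto

lemma awalk_initial_segment:
  assumes "x \<in> inf_paths G"
  shows "awalk (tail G (x 0)) (map x [0..<n]) (tail G (x n))"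
proof (induction n)
  case 0
  then show ?case
    using inf_path_tail[OF assms] by (simp add: awalk_Nil_iff)
next
  case (Suc n)
  have "awalk (tail G (x n)) [x n] (tail G (x (Suc n)))"
    using assms inf_path_arc inf_path_head arc_implies_awalk by metis
  with Suc show ?case
    by (simp add: awalk_appendI)
qed

lemma in_cylinder_initial_segment:
  "x \<in> inf_paths G \<Longrightarrow> x \<in> cylinder G (tail G (x 0)) (map x [0..<n])"
  by (auto simp: cylinder_def)

text \<open>
For \<open>p = []\<close> this uses that the source \<open>u\<close> is part of a cylinder.
\<close>

lemma cylinder_end:
  assumes "x \<in> cylinder G u p" "awalk u p v"
  shows "tail G (x (length p)) = v"
proof -
  have "x \<in> inf_paths G" "tail G (x 0) = u" and eq: "\<forall>i<length p. x i = p ! i"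
    using assms(1) by (auto simp: cylinder_def)
  moreover have "map x [0..<length p] = p"
    using eq by (auto intro: nth_equalityI)
  ultimately have "awalk u p (tail G (x (length p)))"
    using awalk_initial_segment by metis
  with assms(2) show ?thesis
    by (auto dest: awalk_ends_eqD)
qed

lemma openin_contains_cylinder:
  assumes U: "openin (path_topology G) U" and x: "x \<in> U"
  shows "\<exists>n. cylinder G (tail G (x 0)) (map x [0..<n]) \<subseteq> U"
proof -
  obtain T where T: "openin (product_topology (\<lambda>_. discrete_topology (arcs G)) UNIV) T"
    and U_eq: "U = T \<inter> inf_paths G"
    using U unfolding path_topology_def openin_subtopology by auto
  obtain X where X: "finite {i. X i \<noteq> arcs G}" "x \<in> Pi\<^sub>E UNIV X" "Pi\<^sub>E UNIV X \<subseteq> T"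
    using T x U_eq unfolding openin_product_topology_alt by fastforce
  obtain n where n: "\<forall>i. X i \<noteq> arcs G \<longrightarrow> i < n"
    using X(1) by (metis (mono_tags, lifting) finite_nat_iff_bounded lessThan_iff mem_Collect_eq subset_iff)
  have "cylinder G (tail G (x 0)) (map x [0..<n]) \<subseteq> U"
  proof
    fix y assume y: "y \<in> cylinder G (tail G (x 0)) (map x [0..<n])"
    then have y_inf: "y \<in> inf_paths G" and eq: "\<forall>i<n. y i = x i"
      by (auto simp: cylinder_def)
    have "y i \<in> X i" for i
      using n eq X(2) inf_path_arc[OF y_inf, of i] by (cases "i < n") auto
    then show "y \<in> U"
      using X(3) y_inf U_eq by auto
  qed
  then show ?thesis ..
qed

lemma countable_cylinders: "countable cylinders"
proof -
  have "cylinders \<subseteq> (\<lambda>(u, p). cylinder G u p) ` (verts G \<times> lists (arcs G))"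
    unfolding cylinders_def by (fastforce simp: awalk_def)
  then show ?thesis
    by (rule countable_subset) (use countable_verts countable_arcs in auto)
qed

text \<open>
Cylinders form a base of the topology, and there are only countably many of them, so every open
set is a countable union of cylinders.
\<close>

lemma sets_path_borel_cylinders:
  "sets (path_borel G) = sigma_sets (inf_paths G) cylinders"
proof
  show "sigma_sets (inf_paths G) cylinders \<subseteq> sets (path_borel G)"
    using sets.sigma_sets_subset[of cylinders "path_borel G"] sets_cylinder
    unfolding cylinders_def by fastforce
  have "U \<in> sigma_sets (inf_paths G) cylinders" if U: "openin (path_topology G) U" for U
  proof -
    have "U \<subseteq> \<Union>{C \<in> cylinders. C \<subseteq> U}"
    proof
      fix x assume "x \<in> U"
      moreover from this have x: "x \<in> inf_paths G"
        using openin_subset[OF U] by auto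
      ultimately obtain n where "cylinder G (tail G (x 0)) (map x [0..<n]) \<subseteq> U"
        using openin_contains_cylinder[OF U] by blast
      then show "x \<in> \<Union>{C \<in> cylinders. C \<subseteq> U}"
        using in_cylinder_initial_segment[OF x, of n] awalk_initial_segment[OF x, of n]
        by (auto simp: cylinders_def)
    qed
    then have "U = \<Union>{C \<in> cylinders. C \<subseteq> U}"
      by auto
    also have "\<dots> \<in> sigma_sets (inf_paths G) cylinders"
      by (rule sigma_sets_UNION) (auto intro: countable_subset[OF _ countable_cylinders] sigma_sets.Basic)
    finally show ?thesis .
  qed
  then show "sets (path_borel G) \<subseteq> sigma_sets (inf_paths G) cylinders"
    unfolding sets_path_borel_open by (intro sigma_sets_mono) auto
qed

lemma cylinder_Int_cylinder:
  assumes "length p \<le> length q"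
  shows "cylinder G u p \<inter> cylinder G w q = (if u = w \<and> take (length p) q = p then cylinder G w q else {})"
proof -
  have "take (length p) q = p \<longleftrightarrow> (\<forall>i<length p. q ! i = p ! i)"
    using assms by (auto simp: list_eq_iff_nth_eq)
  then show ?thesis
    using assms by (auto simp: cylinder_def)
qed

text \<open>
Two cylinders are nested or disjoint; the empty set has to be added for the second case.
\<close>

lemma Int_stable_cylinders: "Int_stable (insert {} cylinders)"
proof -
  have *: "cylinder G u p \<inter> cylinder G w q \<in> insert {} cylinders"
    if "length p \<le> length q" "awalk u p a" "awalk w q b" for u p w q a b
    using cylinder_Int_cylinder[OF that(1), of u w] that by (auto simp: cylinders_def)
  show ?thesis
  proof (rule Int_stableI)
    fix a b assume "a \<in> insert {} cylinders" "b \<in> insert {} cylinders"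
    then show "a \<inter> b \<in> insert {} cylinders"
      using * le_cases unfolding cylinders_def
      by (smt (verit) Int_commute Int_empty_left insert_iff mem_Collect_eq)
  qed
qed

lemma measure_eqI_cylinders:
  assumes sets: "sets m = sets (path_borel G)" "sets m' = sets (path_borel G)"
    and eq: "\<And>u p v. awalk u p v \<Longrightarrow> emeasure m (cylinder G u p) = emeasure m' (cylinder G u p)"
    and fin: "\<And>v. v \<in> verts G \<Longrightarrow> emeasure m (cylinder G v []) < \<infinity>"
  shows "m = m'"
proof (rule measure_eqI_generator_eq_countable[OF Int_stable_cylinders, where \<Omega> = "inf_paths G"])
  show "insert {} cylinders \<subseteq> Pow (inf_paths G)"
    by (auto simp: cylinders_def cylinder_def)
  show "emeasure m X = emeasure m' X" if "X \<in> insert {} cylinders" for X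
    using that eq by (auto simp: cylinders_def)
  have "sigma_sets (inf_paths G) (insert {} cylinders) = sets (path_borel G)"
    unfolding sets_path_borel_cylinders
    by (rule sigma_sets_eqI) (auto intro: sigma_sets.Basic sigma_sets.Empty)
  then show "sets m = sigma_sets (inf_paths G) (insert {} cylinders)"
    "sets m' = sigma_sets (inf_paths G) (insert {} cylinders)"
    using sets by auto
  let ?A = "(\<lambda>v. cylinder G v []) ` verts G"
  show "?A \<subseteq> insert {} cylinders"
    unfolding cylinders_def using awalk_Nil_iff by blast
  show "\<Union> ?A = inf_paths G"
    using inf_path_tail by (auto simp: cylinder_def)
  show "countable ?A"
    using countable_verts by simp
  show "emeasure m a \<noteq> \<infinity>" if "a \<in> ?A" for a
    using that fin by fastforce
qed

lemma measurable_into_path_borel: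
  assumes "\<And>x. x \<in> space N \<Longrightarrow> f x \<in> inf_paths G"
    and "\<And>u p v. awalk u p v \<Longrightarrow> {x \<in> space N. f x \<in> cylinder G u p} \<in> sets N"
  shows "f \<in> N \<rightarrow>\<^sub>M path_borel G"
proof (rule measurable_sigma_sets[OF sets_path_borel_cylinders])
  show "cylinders \<subseteq> Pow (inf_paths G)"
    by (auto simp: cylinders_def cylinder_def)
  show "f \<in> space N \<rightarrow> inf_paths G"
    using assms(1) by auto
  show "f -` A \<inter> space N \<in> sets N" if "A \<in> cylinders" for A
  proof -
    from that obtain u p v where "A = cylinder G u p" "awalk u p v"
      unfolding cylinders_def by blast
    moreover have "f -` cylinder G u p \<inter> space N = {x \<in> space N. f x \<in> cylinder G u p}"
      by auto
    ultimately show ?thesis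
      using assms(2) by simp
  qed
qed

lemma measurable_drop [measurable]: "(\<lambda>x i. x (n + i)) \<in> path_borel G \<rightarrow>\<^sub>M path_borel G"
proof (rule measurable_into_path_borel)
  show "(\<lambda>i. x (n + i)) \<in> inf_paths G" if "x \<in> space (path_borel G)" for x
    using that by (auto simp: inf_paths_def)
  show "{x \<in> space (path_borel G). (\<lambda>i. x (n + i)) \<in> cylinder G u p} \<in> sets (path_borel G)" for u p
  proof -
    have "{x \<in> space (path_borel G). (\<lambda>i. x (n + i)) \<in> cylinder G u p} =
       {x \<in> space (path_borel G). tail G (x n) = u \<and> (\<forall>i\<in>{..<length p}. x (n + i) = p ! i)}"
      by (auto simp: cylinder_def inf_paths_def)
    also have "\<dots> \<in> sets (path_borel G)"
      by measurable
    finally show ?thesis .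
  qed
qed

end

section \<open>Conformal measures and harmonic functions\<close>

locale potential = path_space G for G :: "('v, 'a) pre_digraph" +
  fixes F :: "'a \<Rightarrow> real"
begin

text \<open>
For \<open>\<Gamma>\<close> the potential \<open>F\<close> is instantiated with \<open>\<beta> F\<close>, so that walk weights are \<open>e\<^bsup>-\<beta>F(\<mu>)\<^esup>\<close>.
\<close>

definition walk_weight :: "'a list \<Rightarrow> real" where
  "walk_weight p = exp (- sum_list (map F p))"

lemma walk_weight_pos [simp]: "0 < walk_weight p"
  by (simp add: walk_weight_def)

lemma walk_weight_Nil [simp]: "walk_weight [] = 1"
  by (simp add: walk_weight_def)

lemma walk_weight_Cons: "walk_weight (a # p) = exp (- F a) * walk_weight p"
  by (simp add: walk_weight_def flip: exp_add)

lemma walk_weight_append: "walk_weight (p @ q) = walk_weight p * walk_weight q"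
  by (simp add: walk_weight_def flip: exp_add)

definition harmonic :: "('v \<Rightarrow> real) \<Rightarrow> bool" where
  "harmonic h \<longleftrightarrow>
     (\<forall>v\<in>verts G. 0 \<le> h v \<and> h v = (\<Sum>a\<in>out_arcs G v. exp (- F a) * h (head G a)))"

text \<open>
The set \<open>\<mu>B\<close>. It is written with coordinates of the concatenated path, in which form
measurability is immediate; that the end of \<open>\<mu>\<close> is the source of the remaining path is implied by
\<open>x \<in> inf_paths G\<close>.
\<close>

definition prepend :: "'a list \<Rightarrow> (nat \<Rightarrow> 'a) set \<Rightarrow> (nat \<Rightarrow> 'a) set" where
  "prepend p B =
     {x \<in> inf_paths G. (\<forall>i<length p. x i = p ! i) \<and> (\<lambda>i. x (length p + i)) \<in> B}"

lemma inf_paths_case_nat: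
  "case_nat a y \<in> inf_paths G \<longleftrightarrow> a \<in> arcs G \<and> y \<in> inf_paths G \<and> tail G (y 0) = head G a"
proof
  assume x: "case_nat a y \<in> inf_paths G"
  have "y i \<in> arcs G" "head G (y i) = tail G (y (Suc i))" for i
    using inf_path_arc[OF x, of "Suc i"] inf_path_head[OF x, of "Suc i"] by auto
  then show "a \<in> arcs G \<and> y \<in> inf_paths G \<and> tail G (y 0) = head G a"
    using inf_path_arc[OF x, of 0] inf_path_head[OF x, of 0] by (auto simp: inf_paths_def)
qed (auto simp: inf_paths_def split: nat.split)

lemma case_nat_shift: "case_nat (x 0) (shift x) = x"
  by (auto simp: shift_def split: nat.split)

lemma shift_case_nat [simp]: "shift (case_nat a y) = y"
  by (simp add: shift_def)

lemma shift_inf_paths: "x \<in> inf_paths G \<Longrightarrow> shift x \<in> inf_paths G"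
  by (auto simp: inf_paths_def shift_def)

lemma prepend_Nil [simp]: "B \<subseteq> inf_paths G \<Longrightarrow> prepend [] B = B"
  by (auto simp: prepend_def)

lemma sets_prepend [measurable]:
  assumes [measurable]: "B \<in> sets (path_borel G)"
  shows "prepend p B \<in> sets (path_borel G)"
proof -
  have "prepend p B = {x \<in> space (path_borel G).
      (\<forall>i\<in>{..<length p}. x i = p ! i) \<and> (\<lambda>i. x (length p + i)) \<in> B}"
    by (auto simp: prepend_def)
  also have "\<dots> \<in> sets (path_borel G)"
    by measurable
  finally show ?thesis .
qed

text \<open>
Removing the first arrow maps \<open>Z(a)\<close>-subsets of the form \<open>a\<mu>B\<close> onto \<open>\<mu>B\<close>; this is what
conformality is applied to, one arrow at a time.
\<close>

lemma shift_image_prepend: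
  assumes a: "a \<in> arcs G" and p: "awalk (head G a) p v" and B: "B \<subseteq> cylinder G v []"
  shows "shift ` prepend (a # p) B = prepend p B"
    and "prepend (a # p) B \<subseteq> cylinder G (tail G a) [a]"
proof -
  show "prepend (a # p) B \<subseteq> cylinder G (tail G a) [a]"
    by (fastforce simp: prepend_def cylinder_def)
  show "shift ` prepend (a # p) B = prepend p B"
  proof (intro equalityI subsetI)
    fix y assume "y \<in> shift ` prepend (a # p) B"
    then obtain x where "x \<in> prepend (a # p) B" "y = shift x"
      by auto
    then show "y \<in> prepend p B"
      using shift_inf_paths by (fastforce simp: prepend_def shift_def)
  next
    fix y assume y: "y \<in> prepend p B"
    have "tail G (y 0) = head G a"
    proof (cases p)
      case Nil
      then show ?thesis
        using y B p by (auto simp: prepend_def cylinder_def awalk_Nil_iff)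
    next
      case (Cons b q)
      then show ?thesis
        using y p by (auto simp: prepend_def awalk_Cons_iff)
    qed
    then have "case_nat a y \<in> prepend (a # p) B"
      using y a by (auto simp: prepend_def inf_paths_case_nat nth_Cons split: nat.split)
    then show "y \<in> shift ` prepend (a # p) B"
      by (metis image_eqI shift_case_nat)
  qed
qed

lemma cylinder_eq_prepend: "awalk u p v \<Longrightarrow> cylinder G u p = prepend p (cylinder G v [])"
proof (intro equalityI subsetI)
  fix x assume p: "awalk u p v" and x: "x \<in> cylinder G u p"
  then have "tail G (x (length p)) = v"
    by (auto dest: cylinder_end)
  then show "x \<in> prepend p (cylinder G v [])"
    using x by (auto simp: prepend_def cylinder_def inf_paths_def)
next
  fix x assume p: "awalk u p v" and x: "x \<in> prepend p (cylinder G v [])"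
  have "tail G (x 0) = u"
    using x p by (cases p) (auto simp: prepend_def cylinder_def awalk_Nil_iff awalk_Cons_iff)
  then show "x \<in> cylinder G u p"
    using x by (auto simp: prepend_def cylinder_def)
qed

lemma cylinder_subset: "cylinder G u p \<subseteq> cylinder G u []"
  by (auto simp: cylinder_def)

subsection \<open>From conformal measures to harmonic functions\<close>

context
  fixes m :: "(nat \<Rightarrow> 'a) measure"
  assumes conf: "conformal_measure G F m"
begin

lemma sets_conformal: "sets m = sets (path_borel G)"
  using conf by (simp add: conformal_measure_def)

text \<open>
Conformality iterated along a walk. Besides cylinders it is needed for sets of paths that avoid a
finite set after the walk.
\<close>

lemma emeasure_prepend:
  assumes "awalk u p v" and B: "B \<in> sets (path_borel G)" "B \<subseteq> cylinder G v []"
  shows "emeasure m (prepend p B) = ennreal (walk_weight p) * emeasure m B"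
  using assms(1)
proof (induction p arbitrary: u)
  case Nil
  have "B \<subseteq> inf_paths G"
    using B(2) by (auto simp: cylinder_def)
  then show ?case
    by simp
next
  case (Cons a p)
  then have a: "a \<in> arcs G" and p: "awalk (head G a) p v"
    by (auto simp: awalk_Cons_iff)
  have "emeasure m (shift ` (prepend (a # p) B \<inter> cylinder G (tail G a) [a])) =
      ennreal (exp (F a)) * emeasure m (prepend (a # p) B \<inter> cylinder G (tail G a) [a])"
    using conf a B by (simp add: conformal_measure_def)
  moreover have "prepend (a # p) B \<inter> cylinder G (tail G a) [a] = prepend (a # p) B"
    using shift_image_prepend(2)[OF a p B(2)] by auto
  ultimately have *: "emeasure m (prepend p B) = ennreal (exp (F a)) * emeasure m (prepend (a # p) B)"
    using shift_image_prepend(1)[OF a p B(2)] by simp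
  have exp_inverse: "ennreal (exp (- F a)) * ennreal (exp (F a)) = 1"
    by (subst ennreal_mult[symmetric]) (auto simp flip: exp_add)
  have "emeasure m (prepend (a # p) B) =
      ennreal (exp (- F a)) * (ennreal (exp (F a)) * emeasure m (prepend (a # p) B))"
    by (simp only: exp_inverse mult.assoc[symmetric] mult_1)
  also have "\<dots> = ennreal (exp (- F a)) * emeasure m (prepend p B)"
    using * by simp
  also have "\<dots> = ennreal (walk_weight (a # p)) * emeasure m B"
    by (simp add: Cons.IH[OF p] walk_weight_Cons ennreal_mult' mult.assoc)
  finally show ?case .
qed

lemma emeasure_cylinder:
  "awalk u p v \<Longrightarrow> emeasure m (cylinder G u p) = ennreal (walk_weight p) * emeasure m (cylinder G v [])"
  using emeasure_prepend[of u p v "cylinder G v []"] cylinder_eq_prepend sets_cylinder by simp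

lemma emeasure_cylinder_Nil:
  assumes "v \<in> verts G"
  shows "emeasure m (cylinder G v []) = ennreal (measure m (cylinder G v []))"
  using conf assms by (intro emeasure_eq_ennreal_measure) (auto simp: conformal_measure_def)

lemma measure_cylinder:
  assumes "awalk u p v"
  shows "measure m (cylinder G u p) = walk_weight p * measure m (cylinder G v [])"
  using emeasure_cylinder[OF assms] by (simp add: measure_def enn2real_mult less_imp_le)

text \<open>
\<open>Z(v)\<close> is the disjoint union of the finitely many sets \<open>Z(a)\<close> with \<open>a\<close> an arrow out of \<open>v\<close>.
\<close>

lemma harmonic_measure_cylinder: "harmonic (\<lambda>v. measure m (cylinder G v []))"
  unfolding harmonic_def
proof (intro ballI conjI)
  fix v assume v: "v \<in> verts G"
  have "cylinder G v [] = (\<Union>a\<in>out_arcs G v. cylinder G v [a])"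
    using inf_path_arc by (force simp: cylinder_def out_arcs_def)
  then have "measure m (cylinder G v []) = measure m (\<Union>a\<in>out_arcs G v. cylinder G v [a])"
    by simp
  also have "\<dots> = (\<Sum>a\<in>out_arcs G v. measure m (cylinder G v [a]))"
  proof (rule measure_finite_Union)
    show "emeasure m (cylinder G v [a]) \<noteq> \<infinity>" if "a \<in> out_arcs G v" for a
    proof -
      have "emeasure m (cylinder G v [a]) \<le> emeasure m (cylinder G v [])"
        by (rule emeasure_mono[OF cylinder_subset]) (simp add: sets_conformal sets_cylinder)
      then show ?thesis
        using emeasure_cylinder_Nil[OF v] by (auto simp: top_unique)
    qed
    show "disjoint_family_on (\<lambda>a. cylinder G v [a]) (out_arcs G v)"
      by (auto simp: disjoint_family_on_def cylinder_def)
    show "(\<lambda>a. cylinder G v [a]) ` out_arcs G v \<subseteq> sets m"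
      using sets_cylinder by (auto simp: sets_conformal)
  qed (use v finite_out_arcs in auto)
  also have "\<dots> = (\<Sum>a\<in>out_arcs G v. exp (- F a) * measure m (cylinder G (head G a) []))"
  proof (rule sum.cong[OF refl])
    fix a assume "a \<in> out_arcs G v"
    then have "awalk v [a] (head G a)"
      using arc_implies_awalk[of a] by auto
    from measure_cylinder[OF this]
    show "measure m (cylinder G v [a]) = exp (- F a) * measure m (cylinder G (head G a) [])"
      by (simp add: walk_weight_Cons)
  qed
  finally show "measure m (cylinder G v []) =
      (\<Sum>a\<in>out_arcs G v. exp (- F a) * measure m (cylinder G (head G a) []))" .
qed auto

end

lemma conformal_measure_eqI:
  assumes "conformal_measure G F m" "conformal_measure G F m'"
    and "\<And>v. v \<in> verts G \<Longrightarrow> measure m (cylinder G v []) = measure m' (cylinder G v [])"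
  shows "m = m'"
proof (rule measure_eqI_cylinders)
  fix u p v assume p: "awalk u p v"
  then have "v \<in> verts G"
    by blast
  then show "emeasure m (cylinder G u p) = emeasure m' (cylinder G u p)"
    using assms p by (simp add: emeasure_cylinder emeasure_cylinder_Nil)
qed (use assms in \<open>auto simp: sets_conformal emeasure_cylinder_Nil\<close>)

end

subsection \<open>From harmonic functions to conformal measures\<close>

text \<open>
Consecutive half-open intervals of prescribed lengths partition \<open>[0, \<Sum> len)\<close>. The order in which
they are placed is given by an injective index. Intervals of length zero are empty and are never
chosen.
\<close>

lemma ex1_interval_of_partition:
  fixes len :: "'b \<Rightarrow> real" and idx :: "'b \<Rightarrow> nat"
  assumes S: "finite S" and inj: "inj_on idx S" and len: "\<And>a. a \<in> S \<Longrightarrow> 0 \<le> len a"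
    and x: "0 \<le> x" "x < sum len S"
  defines "off a \<equiv> sum len {b \<in> S. idx b < idx a}"
  shows "\<exists>!a. a \<in> S \<and> off a \<le> x \<and> x < off a + len a"
proof -
  have off_add: "off a + len a = sum len {b \<in> S. idx b \<le> idx a}" if "a \<in> S" for a
  proof -
    have "{b \<in> S. idx b \<le> idx a} = insert a {b \<in> S. idx b < idx a}"
      using that inj by (auto simp: inj_on_def order_le_less)
    then show ?thesis
      using S by (simp add: off_def)
  qed
  have max: "\<exists>a\<in>T. \<forall>b\<in>T. idx b \<le> idx a" if "finite T" "T \<noteq> {}" for T
  proof -
    have "Max (idx ` T) \<in> idx ` T"
      using that by simp
    then obtain a where "a \<in> T" "Max (idx ` T) = idx a"
      by auto
    then show ?thesis
      using Max_ge[of "idx ` T"] that by (intro bexI[of _ a]) auto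
  qed
  have S_ne: "S \<noteq> {}"
    using x by auto
  define P where "P a \<longleftrightarrow> a \<in> S \<and> x < off a + len a" for a
  have "\<exists>a. P a"
  proof -
    obtain a where a: "a \<in> S" "\<forall>b\<in>S. idx b \<le> idx a"
      using max[OF S S_ne] by blast
    then have "{b \<in> S. idx b \<le> idx a} = S"
      by auto
    then show ?thesis
      using off_add[of a] a x by (auto simp: P_def)
  qed
  then obtain a where a: "P a" "\<And>b. P b \<Longrightarrow> idx a \<le> idx b"
    using ex_has_least_nat[of P _ idx] by blast
  have "off a \<le> x"
  proof (rule ccontr)
    assume "\<not> off a \<le> x"
    let ?T = "{b \<in> S. idx b < idx a}"
    have "?T \<noteq> {}"
      using \<open>\<not> off a \<le> x\<close> x unfolding off_def by (metis sum.empty)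
    moreover have "finite ?T"
      using S by simp
    ultimately obtain b where b: "b \<in> ?T" "\<forall>c\<in>?T. idx c \<le> idx b"
      using max[of ?T] by blast
    then have "?T = {c \<in> S. idx c \<le> idx b}"
      by fastforce
    then have "off a = off b + len b"
      using off_add[of b] b(1) unfolding off_def by simp
    then have "P b"
      using b(1) \<open>\<not> off a \<le> x\<close> by (simp add: P_def)
    then show False
      using a(2)[of b] b(1) by simp
  qed
  moreover have "a = b" if "b \<in> S" "off b \<le> x" "x < off b + len b" for b
  proof -
    have less: "off c + len c \<le> off d" if "c \<in> S" "d \<in> S" "idx c < idx d" for c d
      unfolding off_add[OF that(1)] unfolding off_def
      by (rule sum_mono2) (use S len that in auto)
    have "\<not> idx a < idx b" "\<not> idx b < idx a"
      using less[of a b] less[of b a] that a(1) \<open>off a \<le> x\<close> by (auto simp: P_def)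
    then show ?thesis
      using inj a(1) that by (auto simp: P_def inj_on_def)
  qed
  ultimately show ?thesis
    using a(1) by (intro ex1I[of _ a]) (auto simp: P_def)
qed

context potential
begin

context
  fixes h :: "'v \<Rightarrow> real"
  assumes h: "harmonic h"
begin

definition arc_length :: "'a \<Rightarrow> real" where
  "arc_length a = exp (- F a) * h (head G a)"

text \<open>
The arrows out of a vertex are ordered by a fixed enumeration of the countable set of all arrows.
\<close>

definition arc_offset :: "'a \<Rightarrow> real" where
  "arc_offset a = sum arc_length
     {b \<in> out_arcs G (tail G a). to_nat_on (arcs G) b < to_nat_on (arcs G) a}"

text \<open>
The arrow whose interval contains \<open>x\<close>; it is meaningful for \<open>x\<close> in \<open>[0, h v)\<close> only.
\<close>

definition arc_at :: "'v \<Rightarrow> real \<Rightarrow> 'a" where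
  "arc_at v x = (SOME a. a \<in> out_arcs G v \<and> arc_offset a \<le> x \<and> x < arc_offset a + arc_length a)"

text \<open>
The increasing affine map from the interval of \<open>a\<close> onto \<open>[0, h(r(a)))\<close>. Its slope \<open>e\<^bsup>F(a)\<^esup>\<close> is the
conformal factor.
\<close>

definition rescale :: "'a \<Rightarrow> real \<Rightarrow> real" where
  "rescale a x = (x - arc_offset a) * exp (F a)"

primrec coding :: "nat \<Rightarrow> 'v \<Rightarrow> real \<Rightarrow> 'a" where
  "coding 0 v x = arc_at v x"
| "coding (Suc n) v x = coding n (head G (arc_at v x)) (rescale (arc_at v x) x)"

definition coded_path :: "'v \<Rightarrow> real \<Rightarrow> nat \<Rightarrow> 'a" where
  "coded_path v x = (\<lambda>n. coding n v x)"

lemma h_nonneg: "v \<in> verts G \<Longrightarrow> 0 \<le> h v"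
  using h unfolding harmonic_def by blast

lemma h_eq: "v \<in> verts G \<Longrightarrow> h v = sum arc_length (out_arcs G v)"
  using h unfolding harmonic_def arc_length_def by blast

lemma arc_length_nonneg: "a \<in> arcs G \<Longrightarrow> 0 \<le> arc_length a"
  using h_nonneg by (simp add: arc_length_def)

lemma rescale_bounds:
  "0 \<le> rescale a x \<and> rescale a x < h (head G a) \<longleftrightarrow>
     arc_offset a \<le> x \<and> x < arc_offset a + arc_length a"
proof -
  have "rescale a x < h (head G a) \<longleftrightarrow> (x - arc_offset a) < arc_length a"
    by (simp add: rescale_def arc_length_def exp_minus field_simps)
  moreover have "0 \<le> rescale a x \<longleftrightarrow> 0 \<le> x - arc_offset a"
    by (simp add: rescale_def zero_le_mult_iff)
  ultimately show ?thesis
    by auto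
qed

lemma ex1_arc_at:
  assumes v: "v \<in> verts G" and x: "0 \<le> x" "x < h v"
  shows "\<exists>!a. a \<in> out_arcs G v \<and> arc_offset a \<le> x \<and> x < arc_offset a + arc_length a"
proof -
  have "inj_on (to_nat_on (arcs G)) (out_arcs G v)"
    using inj_on_to_nat_on[OF countable_arcs] by (rule inj_on_subset) auto
  from ex1_interval_of_partition[OF finite_out_arcs[OF v] this, of arc_length x]
  have "\<exists>!a. a \<in> out_arcs G v \<and>
      sum arc_length {b \<in> out_arcs G v. to_nat_on (arcs G) b < to_nat_on (arcs G) a} \<le> x \<and>
      x < sum arc_length {b \<in> out_arcs G v. to_nat_on (arcs G) b < to_nat_on (arcs G) a} + arc_length a"
    using x h_eq[OF v] arc_length_nonneg by auto
  moreover have "sum arc_length {b \<in> out_arcs G v. to_nat_on (arcs G) b < to_nat_on (arcs G) a}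
      = arc_offset a" if "a \<in> out_arcs G v" for a
    using that by (simp add: arc_offset_def)
  ultimately show ?thesis
    by (smt (verit))
qed

lemma arc_at:
  assumes "v \<in> verts G" "0 \<le> x" "x < h v"
  shows "arc_at v x \<in> out_arcs G v" "0 \<le> rescale (arc_at v x) x"
    "rescale (arc_at v x) x < h (head G (arc_at v x))"
  using someI_ex[OF ex1_implies_ex[OF ex1_arc_at[OF assms]]] rescale_bounds
  unfolding arc_at_def[symmetric] by auto

lemma arc_offset_bounds:
  assumes a: "a \<in> arcs G"
  shows "0 \<le> arc_offset a" "arc_offset a + arc_length a \<le> h (tail G a)"
proof -
  show "0 \<le> arc_offset a"
    unfolding arc_offset_def by (rule sum_nonneg) (auto intro: arc_length_nonneg)
  let ?T = "{b \<in> out_arcs G (tail G a). to_nat_on (arcs G) b < to_nat_on (arcs G) a}"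
  have fin: "finite (out_arcs G (tail G a))"
    using a by (simp add: finite_out_arcs)
  have "arc_offset a + arc_length a = sum arc_length (insert a ?T)"
    using sum.insert[OF finite_subset[OF _ fin], of ?T a arc_length] unfolding arc_offset_def
    by fastforce
  also have "\<dots> \<le> sum arc_length (out_arcs G (tail G a))"
    by (rule sum_mono2) (use fin a in \<open>auto intro: arc_length_nonneg\<close>)
  also have "\<dots> = h (tail G a)"
    using h_eq a by simp
  finally show "arc_offset a + arc_length a \<le> h (tail G a)" .
qed

lemma arc_at_unique:
  assumes a: "a \<in> arcs G" and x: "arc_offset a \<le> x" "x < arc_offset a + arc_length a"
  shows "0 \<le> x" "x < h (tail G a)" "arc_at (tail G a) x = a"
proof -
  show b: "0 \<le> x" "x < h (tail G a)"
    using arc_offset_bounds[OF a] x by auto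
  have v: "tail G a \<in> verts G"
    using a by simp
  show "arc_at (tail G a) x = a"
    using ex1_arc_at[OF v b] arc_at[OF v b] rescale_bounds a x by (metis in_out_arcs_conv)
qed

lemma coding_arc:
  assumes "v \<in> verts G" "0 \<le> x" "x < h v"
  shows "coding n v x \<in> arcs G \<and> head G (coding n v x) = tail G (coding (Suc n) v x)"
  using assms
proof (induction n arbitrary: v x)
  case 0
  have "arc_at v x \<in> out_arcs G v"
    using arc_at(1)[OF 0] .
  moreover have "arc_at (head G (arc_at v x)) (rescale (arc_at v x) x) \<in> out_arcs G (head G (arc_at v x))"
    using arc_at[OF 0] by (intro arc_at(1)) auto
  ultimately show ?case
    by simp
next
  case (Suc n)
  then show ?case
    using Suc.IH[OF _ arc_at(2,3)[OF Suc.prems]] arc_at(1)[OF Suc.prems] by simp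
qed

lemma coded_path:
  assumes "v \<in> verts G" "0 \<le> x" "x < h v"
  shows "coded_path v x \<in> inf_paths G" "coded_path v x 0 = arc_at v x"
    "coded_path v x = case_nat (arc_at v x) (coded_path (head G (arc_at v x)) (rescale (arc_at v x) x))"
  using coding_arc[OF assms] by (auto simp: coded_path_def inf_paths_def split: nat.split)

definition fibre :: "'v \<Rightarrow> (nat \<Rightarrow> 'a) set \<Rightarrow> real set" where
  "fibre v B = {x. 0 \<le> x \<and> x < h v \<and> coded_path v x \<in> B}"

text \<open>
Self-similarity of the coding: the coded path of \<open>x\<close> begins with \<open>a\<close> iff \<open>x\<close> lies in the interval of
\<open>a\<close>, and in this case the remaining path is the coded path of the rescaled point.
\<close>

lemma fibre_arc:
  assumes a: "a \<in> arcs G" and B: "B \<subseteq> cylinder G (tail G a) [a]"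
  shows "fibre (tail G a) B = rescale a -` fibre (head G a) (shift ` B)"
proof (intro equalityI subsetI)
  fix x assume x: "x \<in> fibre (tail G a) B"
  have v: "tail G a \<in> verts G"
    using a by simp
  have bounds: "0 \<le> x" "x < h (tail G a)" and "coded_path (tail G a) x \<in> B"
    using x by (auto simp: fibre_def)
  note path = coded_path[OF v bounds]
  have "arc_at (tail G a) x = a"
    using path(2) \<open>coded_path (tail G a) x \<in> B\<close> B by (force simp: cylinder_def)
  then have "coded_path (head G a) (rescale a x) \<in> shift ` B"
    using path(3) \<open>coded_path (tail G a) x \<in> B\<close> by (metis image_eqI shift_case_nat)
  then show "x \<in> rescale a -` fibre (head G a) (shift ` B)"
    using arc_at[OF v bounds] \<open>arc_at (tail G a) x = a\<close> by (simp add: fibre_def)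
next
  fix x assume "x \<in> rescale a -` fibre (head G a) (shift ` B)"
  then have res: "0 \<le> rescale a x" "rescale a x < h (head G a)"
    and "coded_path (head G a) (rescale a x) \<in> shift ` B"
    by (auto simp: fibre_def)
  then obtain y where y: "y \<in> B" "coded_path (head G a) (rescale a x) = shift y"
    by auto
  note x = arc_at_unique[OF a, of x]
  have bounds: "0 \<le> x" "x < h (tail G a)" "arc_at (tail G a) x = a"
    using x res rescale_bounds[of a x] by auto
  have "y 0 = a"
    using y(1) B by (auto simp: cylinder_def)
  have "coded_path (tail G a) x = case_nat a (shift y)"
    using coded_path(3)[of "tail G a" x] bounds a y(2) by simp
  also have "\<dots> = y"
    using case_nat_shift[of y] \<open>y 0 = a\<close> by simp
  finally show "x \<in> fibre (tail G a) B"
    using bounds y(1) by (simp add: fibre_def)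
qed

lemma measurable_rescale [measurable]: "rescale a \<in> borel \<rightarrow>\<^sub>M borel"
  unfolding rescale_def by measurable

text \<open>
By induction along the walk the set is an affine preimage of an interval.
\<close>

lemma fibre_cylinder: "awalk u p w \<Longrightarrow> v \<in> verts G \<Longrightarrow> fibre v (cylinder G u p) \<in> sets borel"
proof (induction p arbitrary: u v)
  case Nil
  show ?case
  proof (cases "u = v")
    case True
    have "coded_path v x \<in> cylinder G u []" if "0 \<le> x" "x < h v" for x
      using coded_path[OF Nil.prems(2) that] arc_at(1)[OF Nil.prems(2) that] True
      by (simp add: cylinder_def)
    then have "fibre v (cylinder G u []) = {0..<h v}"
      by (auto simp: fibre_def)
    then show ?thesis
      by simp
  next
    case False
    have "coded_path v x \<notin> cylinder G u []" if "0 \<le> x" "x < h v" for x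
      using coded_path[OF Nil.prems(2) that] arc_at(1)[OF Nil.prems(2) that] False
      by (simp add: cylinder_def)
    then have "fibre v (cylinder G u []) = {}"
      by (auto simp: fibre_def)
    then show ?thesis
      by simp
  qed
next
  case (Cons a p)
  then have a: "a \<in> arcs G" "u = tail G a" and p: "awalk (head G a) p w"
    by (auto simp: awalk_Cons_iff)
  show ?case
  proof (cases "v = tail G a")
    case True
    have "cylinder G u (a # p) = prepend (a # p) (cylinder G w [])"
      using cylinder_eq_prepend[OF Cons.prems(1)] .
    moreover have "cylinder G (head G a) p = prepend p (cylinder G w [])"
      using cylinder_eq_prepend[OF p] .
    ultimately have "fibre v (cylinder G u (a # p)) = rescale a -` fibre (head G a) (cylinder G (head G a) p)"
      using fibre_arc[OF a(1)] shift_image_prepend[OF a(1) p subset_refl] True by simp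
    moreover have "fibre (head G a) (cylinder G (head G a) p) \<in> sets borel"
      using Cons.IH[OF p] a by simp
    ultimately show ?thesis
      using measurable_sets[OF measurable_rescale[of a]] by simp
  next
    case False
    have "coded_path v x \<notin> cylinder G u (a # p)" if "0 \<le> x" "x < h v" for x
      using coded_path[OF Cons.prems(2) that] arc_at(1)[OF Cons.prems(2) that] False a
      by (auto simp: cylinder_def)
    then have "fibre v (cylinder G u (a # p)) = {}"
      by (auto simp: fibre_def)
    then show ?thesis
      by simp
  qed
qed

lemma sets_fibre:
  assumes v: "v \<in> verts G" and B: "B \<in> sets (path_borel G)"
  shows "fibre v B \<in> sets borel"
proof -
  let ?N = "restrict_space borel {0..<h v}"
  have "coded_path v \<in> ?N \<rightarrow>\<^sub>M path_borel G"
  proof (rule measurable_into_path_borel)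
    show "coded_path v x \<in> inf_paths G" if "x \<in> space ?N" for x
      using that coded_path(1)[OF v] by (simp add: space_restrict_space)
    show "{x \<in> space ?N. coded_path v x \<in> cylinder G u p} \<in> sets ?N" if "awalk u p w" for u p w
    proof -
      have "{x \<in> space ?N. coded_path v x \<in> cylinder G u p} = fibre v (cylinder G u p)"
        by (auto simp: space_restrict_space fibre_def)
      then show ?thesis
        using fibre_cylinder[OF that v]
        by (auto simp: sets_restrict_space_iff fibre_def)
    qed
  qed
  from measurable_sets[OF this B] have "coded_path v -` B \<inter> space ?N \<in> sets ?N" .
  moreover have "coded_path v -` B \<inter> space ?N = fibre v B"
    by (auto simp: space_restrict_space fibre_def)
  ultimately show ?thesis
    by (auto simp: sets_restrict_space_iff)
qed

text \<open>
The change of variables by \<open>rescale a\<close> in Lebesgue measure.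
\<close>

lemma emeasure_fibre_arc:
  assumes a: "a \<in> arcs G" and B: "B \<subseteq> cylinder G (tail G a) [a]"
    and sB: "shift ` B \<in> sets (path_borel G)"
  shows "emeasure lborel (fibre (head G a) (shift ` B)) =
    ennreal (exp (F a)) * emeasure lborel (fibre (tail G a) B)"
proof -
  let ?Y = "fibre (head G a) (shift ` B)"
  have [measurable]: "?Y \<in> sets borel"
    using sets_fibre sB a by simp
  have "emeasure lborel ?Y = (\<integral>\<^sup>+x. indicator ?Y x \<partial>lborel)"
    by simp
  also have "\<dots> = \<bar>exp (F a)\<bar> * (\<integral>\<^sup>+x. indicator ?Y (- arc_offset a * exp (F a) + exp (F a) * x) \<partial>lborel)"
    by (rule nn_integral_real_affine) auto
  also have "(\<lambda>x. indicator ?Y (- arc_offset a * exp (F a) + exp (F a) * x) :: ennreal) =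
      indicator (fibre (tail G a) B)"
  proof
    fix x
    have "- arc_offset a * exp (F a) + exp (F a) * x = rescale a x"
      by (simp add: rescale_def algebra_simps)
    then show "indicator ?Y (- arc_offset a * exp (F a) + exp (F a) * x) =
        (indicator (fibre (tail G a) B) x :: ennreal)"
      using fibre_arc[OF a B] by (simp add: indicator_def)
  qed
  also have "(\<integral>\<^sup>+x. indicator (fibre (tail G a) B) x \<partial>lborel) = emeasure lborel (fibre (tail G a) B)"
    using fibre_arc[OF a B] measurable_sets[OF measurable_rescale[of a], of ?Y] by simp
  finally show ?thesis
    by simp
qed

text \<open>
The sum, over all vertices \<open>v\<close>, of the images of Lebesgue measure on \<open>[0, h v)\<close> under the coding.
\<close>

definition harmonic_measure :: "(nat \<Rightarrow> 'a) measure" where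
  "harmonic_measure = measure_of (inf_paths G) (sets (path_borel G))
     (\<lambda>B. \<integral>\<^sup>+v. emeasure lborel (fibre v B) \<partial>count_space (verts G))"

lemma sets_harmonic_measure: "sets harmonic_measure = sets (path_borel G)"
  unfolding harmonic_measure_def using sets.sigma_sets_eq[of "path_borel G"]
  by (simp add: sets_measure_of sets.space_closed[of "path_borel G", simplified])

lemma emeasure_harmonic_measure:
  assumes "B \<in> sets (path_borel G)"
  shows "emeasure harmonic_measure B = (\<integral>\<^sup>+v. emeasure lborel (fibre v B) \<partial>count_space (verts G))"
proof (rule emeasure_measure_of[OF harmonic_measure_def])
  show "sets (path_borel G) \<subseteq> Pow (inf_paths G)"
    using sets.space_closed[of "path_borel G"] by simp
  show "B \<in> sets harmonic_measure"
    using assms by (simp add: sets_harmonic_measure)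
  show "positive (sets harmonic_measure) (\<lambda>B. \<integral>\<^sup>+v. emeasure lborel (fibre v B) \<partial>count_space (verts G))"
    by (simp add: positive_def fibre_def)
  show "countably_additive (sets harmonic_measure)
      (\<lambda>B. \<integral>\<^sup>+v. emeasure lborel (fibre v B) \<partial>count_space (verts G))"
    unfolding sets_harmonic_measure
  proof (rule countably_additiveI)
    fix A :: "nat \<Rightarrow> (nat \<Rightarrow> 'a) set"
    assume A: "range A \<subseteq> sets (path_borel G)" "disjoint_family A"
    have "(\<Sum>i. emeasure lborel (fibre v (A i))) = emeasure lborel (fibre v (\<Union> (range A)))"
      if v: "v \<in> verts G" for v
    proof -
      have "fibre v (\<Union> (range A)) = (\<Union>i. fibre v (A i))"
        by (auto simp: fibre_def)
      moreover have "disjoint_family (\<lambda>i. fibre v (A i))"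
        using A(2) by (auto simp: disjoint_family_on_def fibre_def)
      ultimately show ?thesis
        using A(1) sets_fibre[OF v] by (simp add: suminf_emeasure image_subset_iff)
    qed
    then show "(\<Sum>i. \<integral>\<^sup>+v. emeasure lborel (fibre v (A i)) \<partial>count_space (verts G)) =
        (\<integral>\<^sup>+v. emeasure lborel (fibre v (\<Union> (range A))) \<partial>count_space (verts G))"
      by (subst nn_integral_suminf[symmetric]) (auto intro!: nn_integral_cong)
  qed
qed

lemma emeasure_harmonic_measure_subset:
  assumes v: "v \<in> verts G" and B: "B \<in> sets (path_borel G)" "B \<subseteq> cylinder G v []"
  shows "emeasure harmonic_measure B = emeasure lborel (fibre v B)"
proof -
  have "fibre u B = {}" if u: "u \<in> verts G" "u \<noteq> v" for u
  proof -
    have "coded_path u x \<notin> B" if "0 \<le> x" "x < h u" for x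
      using coded_path[OF u(1) that] arc_at(1)[OF u(1) that] B(2) u(2) by (auto simp: cylinder_def)
    then show ?thesis
      by (auto simp: fibre_def)
  qed
  then have "(\<integral>\<^sup>+u. emeasure lborel (fibre u B) \<partial>count_space (verts G)) =
      (\<Sum>u\<in>{v}. emeasure lborel (fibre u B))"
    using v by (intro nn_integral_count_space') auto
  then show ?thesis
    using emeasure_harmonic_measure[OF B(1)] by simp
qed

lemma emeasure_harmonic_measure_cylinder:
  assumes v: "v \<in> verts G"
  shows "emeasure harmonic_measure (cylinder G v []) = ennreal (h v)"
proof -
  have "coded_path v x \<in> cylinder G v []" if "0 \<le> x" "x < h v" for x
    using coded_path[OF v that] arc_at(1)[OF v that] by (simp add: cylinder_def)
  then have "fibre v (cylinder G v []) = {0..<h v}"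
    by (auto simp: fibre_def)
  then show ?thesis
    using emeasure_harmonic_measure_subset[OF v sets_cylinder subset_refl] h_nonneg[OF v] by simp
qed

end

text \<open>
On \<open>Z(a)\<close> the shift has the measurable inverse \<open>y \<mapsto> ay\<close>, defined on the paths that start at the
range of \<open>a\<close>.
\<close>

lemma sets_shift_image:
  assumes a: "a \<in> arcs G" and B: "B \<in> sets (path_borel G)"
  shows "shift ` (B \<inter> cylinder G (tail G a) [a]) \<in> sets (path_borel G)"
proof -
  let ?Z = "cylinder G (head G a) []"
  let ?N = "restrict_space (path_borel G) ?Z"
  have space_N: "space ?N = ?Z"
    by (auto simp: space_restrict_space cylinder_def)
  have "?Z \<inter> space (path_borel G) \<in> sets (path_borel G)"
    by (intro sets.Int sets.top sets_cylinder)
  note sets_N = sets_restrict_space_iff[OF this]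
  have "case_nat a \<in> ?N \<rightarrow>\<^sub>M path_borel G"
  proof (rule measurable_into_path_borel)
    show inf: "case_nat a y \<in> inf_paths G" if "y \<in> space ?N" for y
      using that a unfolding space_N by (auto simp: inf_paths_case_nat cylinder_def)
    show "{y \<in> space ?N. case_nat a y \<in> cylinder G u p} \<in> sets ?N" for u p
    proof -
      have [measurable]: "?Z \<in> sets (path_borel G)"
        by (rule sets_cylinder)
      have nat_all: "(\<forall>i<n. P i) \<longleftrightarrow> (0 < n \<longrightarrow> P 0) \<and> (\<forall>i\<in>{..<n - 1}. P (Suc i))"
        for n and P :: "nat \<Rightarrow> bool"
        by (cases n) (auto simp: All_less_Suc2)
      have "{y \<in> space ?N. case_nat a y \<in> cylinder G u p} =
          {y \<in> space (path_borel G). y \<in> ?Z \<and> tail G a = u \<and> (0 < length p \<longrightarrow> a = p ! 0) \<and>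
             (\<forall>i\<in>{..<length p - 1}. y i = p ! Suc i)}"
        using inf unfolding space_N by (auto simp: cylinder_def nat_all)
      also have "\<dots> \<in> sets (path_borel G)"
        by measurable
      finally have sets: "{y \<in> space ?N. case_nat a y \<in> cylinder G u p} \<in> sets (path_borel G)" .
      with sets_N show ?thesis
        by (auto simp: space_N)
    qed
  qed
  from measurable_sets[OF this B] have "case_nat a -` B \<inter> ?Z \<in> sets (path_borel G)"
    unfolding space_N sets_N by blast
  moreover have "shift ` (B \<inter> cylinder G (tail G a) [a]) = case_nat a -` B \<inter> ?Z"
  proof (intro equalityI subsetI)
    fix y assume "y \<in> shift ` (B \<inter> cylinder G (tail G a) [a])"
    then obtain x where x: "x \<in> B" "x \<in> inf_paths G" "x 0 = a" "y = shift x"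
      by (auto simp: cylinder_def)
    then have "case_nat a y = x"
      using case_nat_shift by auto
    then show "y \<in> case_nat a -` B \<inter> ?Z"
      using x inf_paths_case_nat[of a y] by (auto simp: cylinder_def)
  next
    fix y assume y: "y \<in> case_nat a -` B \<inter> ?Z"
    then have "case_nat a y \<in> B \<inter> cylinder G (tail G a) [a]"
      using a by (auto simp: cylinder_def inf_paths_case_nat)
    then show "y \<in> shift ` (B \<inter> cylinder G (tail G a) [a])"
      by (metis image_eqI shift_case_nat)
  qed
  ultimately show ?thesis
    by simp
qed

text \<open>
A non-zero value of \<open>h\<close> is asked for because conformal measures are non-zero.
\<close>

lemma conformal_harmonic_measure:
  assumes h: "harmonic h" and v: "v \<in> verts G" "h v \<noteq> 0"
  shows "conformal_measure G F (harmonic_measure h)"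
  unfolding conformal_measure_def
proof (intro conjI ballI)
  show "sets (harmonic_measure h) = sets (path_borel G)"
    by (rule sets_harmonic_measure[OF h])
  show "emeasure (harmonic_measure h) (inf_paths G) \<noteq> 0"
  proof -
    have "emeasure (harmonic_measure h) (cylinder G v []) \<le> emeasure (harmonic_measure h) (inf_paths G)"
      using sets.top[of "path_borel G"]
      by (intro emeasure_mono) (auto simp: cylinder_def sets_harmonic_measure[OF h])
    moreover have "0 < h v"
      using v h_nonneg[OF h v(1)] by simp
    ultimately show ?thesis
      using emeasure_harmonic_measure_cylinder[OF h v(1)] by (auto simp: ennreal_eq_0_iff)
  qed
  show "emeasure (harmonic_measure h) (cylinder G u []) < \<infinity>" if "u \<in> verts G" for u
    using emeasure_harmonic_measure_cylinder[OF h that] by simp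
  fix a B assume a: "a \<in> arcs G" and B: "B \<in> sets (path_borel G)"
  let ?B = "B \<inter> cylinder G (tail G a) [a]"
  have B': "?B \<in> sets (path_borel G)" "?B \<subseteq> cylinder G (tail G a) [a]"
    using B sets_cylinder by auto
  have shift_sub: "shift ` ?B \<subseteq> cylinder G (head G a) []"
    by (force simp: cylinder_def inf_paths_def shift_def)
  have "emeasure (harmonic_measure h) (shift ` ?B) =
      emeasure lborel (fibre h (head G a) (shift ` ?B))"
    using a by (intro emeasure_harmonic_measure_subset[OF h _ sets_shift_image[OF a B] shift_sub]) simp
  also have "\<dots> = ennreal (exp (F a)) * emeasure lborel (fibre h (tail G a) ?B)"
    by (rule emeasure_fibre_arc[OF h a B'(2) sets_shift_image[OF a B]])
  also have "emeasure lborel (fibre h (tail G a) ?B) = emeasure (harmonic_measure h) ?B"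
    using a B' cylinder_subset
    by (intro emeasure_harmonic_measure_subset[OF h, symmetric]) fastforce+
  finally show "emeasure (harmonic_measure h) (shift ` ?B) =
      ennreal (exp (F a)) * emeasure (harmonic_measure h) ?B" .
qed

lemma measure_harmonic_measure:
  "harmonic h \<Longrightarrow> v \<in> verts G \<Longrightarrow> measure (harmonic_measure h) (cylinder G v []) = h v"
  by (simp add: measure_def emeasure_harmonic_measure_cylinder h_nonneg)

end

section \<open>Affine homeomorphisms\<close>

text \<open>
Closure under the formal convex combinations. It is what makes the inverse of an affine
homeomorphism affine.
\<close>

definition convex_system :: "'x topology \<Rightarrow> (real \<Rightarrow> 'x \<Rightarrow> 'x \<Rightarrow> 'x) \<Rightarrow> bool" where
  "convex_system X mix \<longleftrightarrow>
     (\<forall>x\<in>topspace X. \<forall>y\<in>topspace X. \<forall>t\<in>{0..1}. mix t x y \<in> topspace X)"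

lemma affinely_homeomorphicI:
  assumes "continuous_map X Y f" "continuous_map Y X g"
    and "\<And>x. x \<in> topspace X \<Longrightarrow> g (f x) = x" "\<And>y. y \<in> topspace Y \<Longrightarrow> f (g y) = y"
    and "\<And>x y t. x \<in> topspace X \<Longrightarrow> y \<in> topspace X \<Longrightarrow> 0 \<le> t \<Longrightarrow> t \<le> 1 \<Longrightarrow>
           f (mixX t x y) = mixY t (f x) (f y)"
  shows "affinely_homeomorphic X mixX Y mixY"
proof -
  have "homeomorphic_maps X Y f g"
    using assms(1-4) by (simp add: homeomorphic_maps_def)
  then have "homeomorphic_map X Y f"
    by (rule homeomorphic_maps_map[THEN iffD1, THEN conjunct1])
  then show ?thesis
    using assms(5) unfolding affinely_homeomorphic_def by auto
qed

lemma affinely_homeomorphic_sym: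
  assumes "affinely_homeomorphic X mixX Y mixY" and convex: "convex_system X mixX"
  shows "affinely_homeomorphic Y mixY X mixX"
proof -
  obtain f where f: "homeomorphic_map X Y f"
    and affine: "\<And>x y t. x \<in> topspace X \<Longrightarrow> y \<in> topspace X \<Longrightarrow> t \<in> {0..1} \<Longrightarrow>
      f (mixX t x y) = mixY t (f x) (f y)"
    using assms(1) unfolding affinely_homeomorphic_def by blast
  then obtain g where g: "homeomorphic_maps X Y f g"
    using homeomorphic_map_maps by blast
  then have gf: "g (f x) = x" if "x \<in> topspace X" for x
    using that by (simp add: homeomorphic_maps_def)
  have g_in: "g y \<in> topspace X" and fg: "f (g y) = y" if "y \<in> topspace Y" for y
    using that g continuous_map_image_subset_topspace by (fastforce simp: homeomorphic_maps_def)+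
  have "g (mixY t x y) = mixX t (g x) (g y)"
    if "x \<in> topspace Y" "y \<in> topspace Y" "t \<in> {0..1}" for x y t
  proof -
    have "f (mixX t (g x) (g y)) = mixY t x y"
      using affine[OF g_in g_in] fg that by simp
    moreover have "mixX t (g x) (g y) \<in> topspace X"
      using convex g_in that unfolding convex_system_def by blast
    ultimately show ?thesis
      using gf by metis
  qed
  moreover have "homeomorphic_map Y X g"
    using g homeomorphic_maps_map by blast
  ultimately show ?thesis
    unfolding affinely_homeomorphic_def by auto
qed

lemma affinely_homeomorphic_trans:
  assumes "affinely_homeomorphic X mixX Y mixY" "affinely_homeomorphic Y mixY Z mixZ"
  shows "affinely_homeomorphic X mixX Z mixZ"
proof -
  obtain f where f: "homeomorphic_map X Y f"
    and f_affine: "\<forall>x\<in>topspace X. \<forall>y\<in>topspace X. \<forall>t\<in>{0..1}. f (mixX t x y) = mixY t (f x) (f y)"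
    using assms(1) unfolding affinely_homeomorphic_def by blast
  obtain g where g: "homeomorphic_map Y Z g"
    and g_affine: "\<forall>x\<in>topspace Y. \<forall>y\<in>topspace Y. \<forall>t\<in>{0..1}. g (mixY t x y) = mixZ t (g x) (g y)"
    using assms(2) unfolding affinely_homeomorphic_def by blast
  have "homeomorphic_map X Z (g \<circ> f)"
    using homeomorphic_map_compose[OF f g] .
  moreover have "f x \<in> topspace Y" if "x \<in> topspace X" for x
    using that f homeomorphic_imp_surjective_map by blast
  ultimately show ?thesis
    using f_affine g_affine unfolding affinely_homeomorphic_def
    by (intro exI[of _ "g \<circ> f"]) auto
qed


section \<open>Conformal measures as harmonic functions\<close>

definition mix_function :: "real \<Rightarrow> ('v \<Rightarrow> real) \<Rightarrow> ('v \<Rightarrow> real) \<Rightarrow> 'v \<Rightarrow> real" where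
  "mix_function t h k = (\<lambda>v. t * h v + (1 - t) * k v)"

lemma topspace_cylinder_topology [simp]: "topspace (cylinder_topology G S) = S"
  by (auto simp: cylinder_topology_def)

lemma openin_cylinder_topology:
  assumes "pre_digraph.awalk G u p v" "open U"
  shows "openin (cylinder_topology G S) {m \<in> S. measure m (cylinder G u p) \<in> U}"
  unfolding cylinder_topology_def by (rule topology_generated_by_Basis) (use assms in auto)

context potential
begin

text \<open>
The condition \<open>v0 \<in> verts G\<close> matters for the Bratteli diagram, where \<open>(0, v0)\<close> could fail to be a
vertex. There would then be no normalized conformal measure, since \<open>Z(0, v0)\<close> would be empty.
\<close>

definition normalized_harmonic :: "'v \<Rightarrow> ('v \<Rightarrow> real) set" where
  "normalized_harmonic v0 =
     {h \<in> extensional (verts G). harmonic h \<and> v0 \<in> verts G \<and> h v0 = 1}"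

definition harmonic_topology :: "'v \<Rightarrow> ('v \<Rightarrow> real) topology" where
  "harmonic_topology v0 =
     subtopology (product_topology (\<lambda>_. euclideanreal) (verts G)) (normalized_harmonic v0)"

lemma topspace_harmonic_topology [simp]:
  "topspace (harmonic_topology v0) = normalized_harmonic v0"
  by (auto simp: harmonic_topology_def normalized_harmonic_def PiE_def)

lemma harmonic_cong: "(\<And>v. v \<in> verts G \<Longrightarrow> h v = k v) \<Longrightarrow> harmonic h \<longleftrightarrow> harmonic k"
  unfolding harmonic_def by (intro ball_cong refl) (auto intro!: sum.cong)

lemma continuous_map_evaluation:
  "v \<in> verts G \<Longrightarrow> continuous_map (harmonic_topology v0) euclideanreal (\<lambda>h. h v)"
  unfolding harmonic_topology_def
  by (intro continuous_map_from_subtopology continuous_map_product_projection)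

lemma continuous_map_into_harmonic_topology:
  assumes "\<And>v. v \<in> verts G \<Longrightarrow> continuous_map X euclideanreal (\<lambda>x. f x v)"
    and "\<And>x. x \<in> topspace X \<Longrightarrow> f x \<in> normalized_harmonic v0"
  shows "continuous_map X (harmonic_topology v0) f"
  unfolding harmonic_topology_def continuous_map_in_subtopology continuous_map_componentwise
  using assms by (auto simp: normalized_harmonic_def)

lemma normalized_conformalD:
  assumes "m \<in> normalized_conformal G F v0"
  shows "conformal_measure G F m" "v0 \<in> verts G" "measure m (cylinder G v0 []) = 1"
proof -
  show "conformal_measure G F m" "measure m (cylinder G v0 []) = 1"
    using assms by (auto simp: normalized_conformal_def measure_def)
  have "cylinder G v0 [] \<noteq> {}"
    using assms by (auto simp: normalized_conformal_def)
  then show "v0 \<in> verts G"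
    using inf_path_tail by (auto simp: cylinder_def)
qed

text \<open>
Conformality is an identity between values of the measure that is linear in the measure, so it
passes to convex combinations.
\<close>

lemma mix_measure_conformal:
  assumes m: "m \<in> normalized_conformal G F v0" "m' \<in> normalized_conformal G F v0"
    and t: "0 \<le> t" "t \<le> 1"
  shows "mix_measure t m m' \<in> normalized_conformal G F v0"
    and "v \<in> verts G \<Longrightarrow> measure (mix_measure t m m') (cylinder G v []) =
      t * measure m (cylinder G v []) + (1 - t) * measure m' (cylinder G v [])"
proof -
  note conf = normalized_conformalD(1)[OF m(1)] normalized_conformalD(1)[OF m(2)]
  note sets = sets_conformal[OF conf(1)] sets_conformal[OF conf(2)]
  note mix = emeasure_mix_measure[of m' m, unfolded sets, OF refl]
  have mix_cyl: "emeasure (mix_measure t m m') (cylinder G v []) =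
      ennreal (t * measure m (cylinder G v []) + (1 - t) * measure m' (cylinder G v []))"
    if "v \<in> verts G" for v
    using t by (simp add: mix[OF sets_cylinder] emeasure_cylinder_Nil[OF conf(1) that]
        emeasure_cylinder_Nil[OF conf(2) that] ennreal_mult ennreal_plus)
  then show "measure (mix_measure t m m') (cylinder G v []) =
      t * measure m (cylinder G v []) + (1 - t) * measure m' (cylinder G v [])" if "v \<in> verts G"
    using mix_cyl[OF that] t by (intro measure_eq_emeasure_eq_ennreal) auto
  have v0: "v0 \<in> verts G"
    using normalized_conformalD(2)[OF m(1)] .
  have norm: "emeasure (mix_measure t m m') (cylinder G v0 []) = 1"
    using mix_cyl[OF v0] normalized_conformalD(3)[OF m(1)] normalized_conformalD(3)[OF m(2)]
    by simp
  moreover have "conformal_measure G F (mix_measure t m m')"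
    unfolding conformal_measure_def
  proof (intro conjI ballI)
    show "sets (mix_measure t m m') = sets (path_borel G)"
      using sets by simp
    have "emeasure (mix_measure t m m') (cylinder G v0 []) \<le> emeasure (mix_measure t m m') (inf_paths G)"
      using sets sets.top[of "path_borel G"] by (intro emeasure_mono) (auto simp: cylinder_def)
    then show "emeasure (mix_measure t m m') (inf_paths G) \<noteq> 0"
      using norm by auto
    show "emeasure (mix_measure t m m') (cylinder G v []) < \<infinity>" if "v \<in> verts G" for v
      using mix_cyl[OF that] by simp
    fix a B assume a: "a \<in> arcs G" and B: "B \<in> sets (path_borel G)"
    let ?B = "B \<inter> cylinder G (tail G a) [a]"
    have "?B \<in> sets (path_borel G)"
      using B sets_cylinder by auto
    moreover have "emeasure m (shift ` ?B) = ennreal (exp (F a)) * emeasure m ?B"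
      "emeasure m' (shift ` ?B) = ennreal (exp (F a)) * emeasure m' ?B"
      using conf a B unfolding conformal_measure_def by blast+
    ultimately show "emeasure (mix_measure t m m') (shift ` ?B) =
        ennreal (exp (F a)) * emeasure (mix_measure t m m') ?B"
      by (simp only: mix sets_shift_image[OF a B] distrib_left mult.left_commute)
  qed
  ultimately show "mix_measure t m m' \<in> normalized_conformal G F v0"
    by (simp add: normalized_conformal_def)
qed

lemma convex_system_conformal:
  "convex_system (cylinder_topology G (normalized_conformal G F v0)) mix_measure"
  using mix_measure_conformal(1) by (auto simp: convex_system_def)

text \<open>
The inverse is continuous because \<open>m(Z(\<mu>))\<close> is a fixed multiple of the value of \<open>h\<close> at the end
of \<open>\<mu>\<close>.
\<close>

theorem conformal_homeomorphic_harmonic: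
  "affinely_homeomorphic (cylinder_topology G (normalized_conformal G F v0)) mix_measure
     (harmonic_topology v0) mix_function"
proof -
  let ?S = "normalized_conformal G F v0"
  let ?f = "\<lambda>m. restrict (\<lambda>v. measure m (cylinder G v [])) (verts G)"
  have f_in: "?f m \<in> normalized_harmonic v0" if "m \<in> ?S" for m
  proof -
    note m = normalized_conformalD[OF that]
    have "harmonic (?f m)"
      using harmonic_measure_cylinder[OF m(1)] by (subst harmonic_cong) auto
    then show ?thesis
      using m by (simp add: normalized_harmonic_def)
  qed
  have g_in: "harmonic_measure h \<in> ?S" if "h \<in> normalized_harmonic v0" for h
  proof -
    have h: "harmonic h" "v0 \<in> verts G" "h v0 = 1"
      using that by (auto simp: normalized_harmonic_def)
    then show ?thesis
      using conformal_harmonic_measure[OF h(1,2)] emeasure_harmonic_measure_cylinder[OF h(1,2)]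
      by (simp add: normalized_conformal_def)
  qed
  have fg: "?f (harmonic_measure h) = h" if "h \<in> normalized_harmonic v0" for h
    using that measure_harmonic_measure by (fastforce simp: normalized_harmonic_def extensional_def)
  show ?thesis
  proof (rule affinely_homeomorphicI[of _ _ ?f harmonic_measure])
    show "continuous_map (cylinder_topology G ?S) (harmonic_topology v0) ?f"
    proof (rule continuous_map_into_harmonic_topology)
      fix v assume v: "v \<in> verts G"
      show "continuous_map (cylinder_topology G ?S) euclideanreal (\<lambda>m. ?f m v)"
        unfolding continuous_map_alt
      proof (intro conjI allI impI)
        fix U :: "real set" assume "openin euclidean U"
        moreover have "(\<lambda>m. ?f m v) -` U \<inter> topspace (cylinder_topology G ?S) =
            {m \<in> ?S. measure m (cylinder G v []) \<in> U}"
          using v by auto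
        ultimately show "openin (cylinder_topology G ?S)
            ((\<lambda>m. ?f m v) -` U \<inter> topspace (cylinder_topology G ?S))"
          using openin_cylinder_topology[of G v "[]" v U ?S] v by (simp add: awalk_Nil_iff)
      qed auto
    qed (use f_in in simp)
    show "continuous_map (harmonic_topology v0) (cylinder_topology G ?S) harmonic_measure"
      unfolding cylinder_topology_def
    proof (rule continuous_on_generated_topo)
      fix V assume "V \<in> insert ?S {{m \<in> ?S. measure m (cylinder G u p) \<in> U} | u p U.
          (\<exists>v. awalk u p v) \<and> open U}"
      then consider "V = ?S" | u p v U where "V = {m \<in> ?S. measure m (cylinder G u p) \<in> U}"
          "awalk u p v" "open U"
        by blast
      then show "openin (harmonic_topology v0) (harmonic_measure -` V \<inter> topspace (harmonic_topology v0))"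
      proof cases
        case 1
        then have "harmonic_measure -` V \<inter> topspace (harmonic_topology v0) =
            topspace (harmonic_topology v0)"
          using g_in by auto
        then show ?thesis
          by (simp only: openin_topspace)
      next
        case 2
        have v: "v \<in> verts G"
          using 2(2) by blast
        have eq: "measure (harmonic_measure h) (cylinder G u p) = walk_weight p * h v"
          if "h \<in> normalized_harmonic v0" for h
        proof -
          have "conformal_measure G F (harmonic_measure h)"
            using g_in[OF that] normalized_conformalD(1) by blast
          from measure_cylinder[OF this 2(2)] show ?thesis
            using measure_harmonic_measure v that by (simp add: normalized_harmonic_def)
        qed
        have "continuous_map (harmonic_topology v0) euclideanreal (\<lambda>h. walk_weight p * h v)"
          by (intro continuous_map_real_mult_left continuous_map_evaluation v)
        from openin_continuous_map_preimage[OF this, of U] 2(3)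
        have "openin (harmonic_topology v0) {h \<in> normalized_harmonic v0. walk_weight p * h v \<in> U}"
          by simp
        moreover have "harmonic_measure -` V \<inter> topspace (harmonic_topology v0) =
            {h \<in> normalized_harmonic v0. walk_weight p * h v \<in> U}"
          using 2(1) eq g_in by auto
        ultimately show ?thesis
          by simp
      qed
    qed (use g_in in auto)
    show "harmonic_measure (?f m) = m" if "m \<in> topspace (cylinder_topology G ?S)" for m
    proof (rule conformal_measure_eqI)
      have m: "m \<in> ?S"
        using that by simp
      show "conformal_measure G F (harmonic_measure (?f m))" "conformal_measure G F m"
        using g_in[OF f_in[OF m]] m normalized_conformalD(1) by blast+
      show "measure (harmonic_measure (?f m)) (cylinder G v []) = measure m (cylinder G v [])"
        if "v \<in> verts G" for v
        using measure_harmonic_measure[of "?f m" v] f_in[OF m] that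
        by (simp add: normalized_harmonic_def)
    qed
    show "?f (harmonic_measure h) = h" if "h \<in> topspace (harmonic_topology v0)" for h
      using fg that by simp
    show "?f (mix_measure t m m') = mix_function t (?f m) (?f m')"
      if "m \<in> topspace (cylinder_topology G ?S)" "m' \<in> topspace (cylinder_topology G ?S)" "0 \<le> t" "t \<le> 1"
      for m m' t
      using mix_measure_conformal(2)[of m v0 m' t] that
      by (auto simp: mix_function_def restrict_def algebra_simps)
  qed
qed

end

section \<open>Weights of sets of walks\<close>

lemma nn_integral_count_space_Sigma:
  "(\<integral>\<^sup>+z. f z \<partial>count_space (Sigma A B)) =
     (\<integral>\<^sup>+x. (\<integral>\<^sup>+y. f (x, y) \<partial>count_space (B x)) \<partial>count_space A)"
proof -
  have "(\<integral>\<^sup>+z. f z \<partial>count_space (Sigma A B)) =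
      (\<integral>\<^sup>+z. f z * indicator (Sigma A B) z \<partial>count_space UNIV)"
    by (simp add: nn_integral_count_space_indicator)
  also have "\<dots> = (\<integral>\<^sup>+x. \<integral>\<^sup>+y. f (x, y) * indicator (Sigma A B) (x, y) \<partial>count_space UNIV \<partial>count_space UNIV)"
    by (rule nn_integral_fst_count_space[symmetric])
  also have "\<dots> = (\<integral>\<^sup>+x. (\<integral>\<^sup>+y. f (x, y) * indicator (B x) y \<partial>count_space UNIV) * indicator A x \<partial>count_space UNIV)"
    by (intro nn_integral_cong) (auto simp: indicator_def)
  also have "\<dots> = (\<integral>\<^sup>+x. (\<integral>\<^sup>+y. f (x, y) \<partial>count_space (B x)) \<partial>count_space A)"
    by (simp add: nn_integral_count_space_indicator)
  finally show ?thesis .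
qed

context potential
begin

text \<open>
Weights are summed in \<^typ>\<open>ennreal\<close>, so that sums may be rearranged before any of them is known
to be finite.
\<close>

definition total_weight :: "'a list set \<Rightarrow> ennreal" where
  "total_weight S = (\<integral>\<^sup>+p. ennreal (walk_weight p) \<partial>count_space S)"

lemma total_weight_indicator:
  "total_weight S = (\<integral>\<^sup>+p. ennreal (walk_weight p) * indicator S p \<partial>count_space UNIV)"
  by (simp add: total_weight_def nn_integral_count_space_indicator)

lemma total_weight_empty [simp]: "total_weight {} = 0"
  by (simp add: total_weight_indicator)

lemma total_weight_singleton [simp]: "total_weight {p} = ennreal (walk_weight p)"
  by (simp add: total_weight_def nn_integral_count_space_finite)

lemma total_weight_mono: "S \<subseteq> T \<Longrightarrow> total_weight S \<le> total_weight T"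
  unfolding total_weight_indicator
  by (intro nn_integral_mono) (auto simp: indicator_def)

lemma total_weight_Sigma:
  assumes "bij_betw g (Sigma I S) T"
  shows "total_weight T = (\<integral>\<^sup>+i. (\<integral>\<^sup>+p. ennreal (walk_weight (g (i, p))) \<partial>count_space (S i)) \<partial>count_space I)"
  unfolding total_weight_def nn_integral_bij_count_space[OF assms, symmetric]
    nn_integral_count_space_Sigma ..

lemma total_weight_Times:
  "(\<integral>\<^sup>+x. ennreal (walk_weight (fst x @ snd x)) \<partial>count_space (S \<times> R)) = total_weight S * total_weight R"
  unfolding total_weight_def nn_integral_count_space_Sigma
  by (simp add: walk_weight_append ennreal_mult' less_imp_le nn_integral_cmult nn_integral_multc)

text \<open>
The common form of all decompositions of walks below: each walk of \<open>T\<close> splits in exactly one way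
as \<open>p @ q\<close>, where \<open>p\<close> and \<open>q\<close> range over sets that depend on a finite parameter such as the vertex
at which the walk is cut.
\<close>

lemma total_weight_concat:
  assumes I: "finite I" and bij: "bij_betw (\<lambda>(i, p, q). p @ q) (SIGMA i:I. S i \<times> R i) T"
  shows "total_weight T = (\<Sum>i\<in>I. total_weight (S i) * total_weight (R i))"
proof -
  have "total_weight T = (\<integral>\<^sup>+i. (\<integral>\<^sup>+x. ennreal (walk_weight (fst x @ snd x)) \<partial>count_space (S i \<times> R i)) \<partial>count_space I)"
    using total_weight_Sigma[OF bij] by (simp add: case_prod_unfold)
  also have "\<dots> = (\<Sum>i\<in>I. total_weight (S i) * total_weight (R i))"
    using I by (simp add: total_weight_Times nn_integral_count_space_finite)
  finally show ?thesis .
qed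

lemma total_weight_Un_disjoint:
  assumes "S \<inter> T = {}"
  shows "total_weight (S \<union> T) = total_weight S + total_weight T"
proof -
  have "total_weight (S \<union> T) =
      (\<integral>\<^sup>+p. ennreal (walk_weight p) * indicator S p + ennreal (walk_weight p) * indicator T p \<partial>count_space UNIV)"
    unfolding total_weight_indicator
    using assms by (intro nn_integral_cong) (auto simp: indicator_def)
  also have "\<dots> = total_weight S + total_weight T"
    by (subst nn_integral_add) (auto simp: total_weight_indicator)
  finally show ?thesis .
qed

lemma total_weight_infsum:
  assumes "total_weight S < \<infinity>"
  shows "ennreal (infsum walk_weight S) = total_weight S"
proof -
  have int: "integrable (count_space S) walk_weight"
    using assms by (intro integrableI_nonneg) (auto simp: total_weight_def less_imp_le)
  then have "infsetsum walk_weight S = infsum walk_weight S"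
    by (intro infsetsum_infsum) (simp add: abs_summable_on_def)
  moreover have "total_weight S = ennreal (infsetsum walk_weight S)"
    unfolding total_weight_def infsetsum_def
    by (rule nn_integral_eq_integral[OF int]) (auto simp: less_imp_le)
  ultimately show ?thesis
    by simp
qed

lemma total_weight_pos: "p \<in> S \<Longrightarrow> 0 < total_weight S"
  using total_weight_mono[of "{p}" S] less_le_trans[of 0 "ennreal (walk_weight p)" "total_weight S"]
  by simp

subsection \<open>Walks of a given length and powers of the weight matrix\<close>

definition walks_of_length :: "nat \<Rightarrow> 'v \<Rightarrow> 'v \<Rightarrow> 'a list set" where
  "walks_of_length n v w = {p. awalk v p w \<and> length p = n}"

text \<open>
The Green kernel \<open>\<Sum>k. A(\<beta>)\<^sup>k\<^bsub>v,w\<^esub>\<close>.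
\<close>

definition green :: "'v \<Rightarrow> 'v \<Rightarrow> ennreal" where
  "green v w = total_weight {p. awalk v p w}"

lemma total_weight_walks_Suc:
  assumes v: "v \<in> verts G"
  shows "total_weight (walks_of_length (Suc n) v w) =
    (\<Sum>a\<in>out_arcs G v. ennreal (exp (- F a)) * total_weight (walks_of_length n (head G a) w))"
proof -
  have "bij_betw (\<lambda>(a, p, q). p @ q)
      (SIGMA a:out_arcs G v. {[a]} \<times> walks_of_length n (head G a) w) (walks_of_length (Suc n) v w)"
  proof (rule bij_betw_imageI)
    show "(\<lambda>(a, p, q). p @ q) ` (SIGMA a:out_arcs G v. {[a]} \<times> walks_of_length n (head G a) w) =
        walks_of_length (Suc n) v w"
      by (auto simp: walks_of_length_def length_Suc_conv awalk_Cons_iff image_iff)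
  qed (auto simp: inj_on_def)
  from total_weight_concat[OF finite_out_arcs[OF v] this] show ?thesis
    by (simp add: walk_weight_Cons)
qed

lemma total_weight_walks_0:
  "v \<in> verts G \<Longrightarrow> total_weight (walks_of_length 0 v w) = (if v = w then 1 else 0)"
proof -
  assume "v \<in> verts G"
  then have "walks_of_length 0 v w = (if v = w then {[]} else {})"
    by (auto simp: walks_of_length_def awalk_Nil_iff)
  then show ?thesis
    by simp
qed

lemma green_suminf: "green v w = (\<Sum>n. total_weight (walks_of_length n v w))"
proof -
  have "bij_betw snd (SIGMA n:UNIV. walks_of_length n v w) {p. awalk v p w}"
    by (auto simp: bij_betw_def inj_on_def walks_of_length_def image_iff)
  from total_weight_Sigma[OF this] show ?thesis
    by (simp add: green_def total_weight_def nn_integral_count_space_nat)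
qed

lemma weight_matrix_power_nonneg: "0 \<le> weight_matrix_power G F0 \<beta> n v w"
  by (induction n arbitrary: v) (auto intro!: infsum_nonneg sum_nonneg mult_nonneg_nonneg simp: weight_matrix_def)

text \<open>
The sum over all vertices is regrouped into a sum over the finitely many arrows out of \<open>v\<close>.
\<close>

lemma weight_matrix_power_Suc:
  assumes v: "v \<in> verts G"
  shows "weight_matrix_power G F0 \<beta> (Suc n) v w =
    (\<Sum>a\<in>out_arcs G v. exp (- \<beta> * F0 a) * weight_matrix_power G F0 \<beta> n (head G a) w)"
proof -
  let ?P = "\<lambda>u. weight_matrix_power G F0 \<beta> n u w"
  have "weight_matrix_power G F0 \<beta> (Suc n) v w =
      (\<Sum>\<^sub>\<infinity>u\<in>head G ` out_arcs G v. weight_matrix G F0 \<beta> v u * ?P u)"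
    unfolding weight_matrix_power.simps
  proof (rule infsum_cong_neutral)
    fix u assume "u \<in> verts G - head G ` out_arcs G v"
    then have "out_arcs G v \<inter> in_arcs G u = {}"
      by auto
    then show "weight_matrix G F0 \<beta> v u * ?P u = 0"
      by (simp add: weight_matrix_def)
  qed auto
  also have "\<dots> = (\<Sum>u\<in>head G ` out_arcs G v. weight_matrix G F0 \<beta> v u * ?P u)"
    using finite_out_arcs[OF v] by simp
  also have "\<dots> = (\<Sum>u\<in>head G ` out_arcs G v. \<Sum>a\<in>{a \<in> out_arcs G v. head G a = u}. exp (- \<beta> * F0 a) * ?P (head G a))"
  proof (rule sum.cong[OF refl])
    fix u
    have "out_arcs G v \<inter> in_arcs G u = {a \<in> out_arcs G v. head G a = u}"
      by auto
    then show "weight_matrix G F0 \<beta> v u * ?P u =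
        (\<Sum>a\<in>{a \<in> out_arcs G v. head G a = u}. exp (- \<beta> * F0 a) * ?P (head G a))"
      by (simp add: weight_matrix_def sum_distrib_right)
  qed
  also have "\<dots> = (\<Sum>a\<in>out_arcs G v. exp (- \<beta> * F0 a) * ?P (head G a))"
    using finite_out_arcs[OF v] by (intro sum.group) auto
  finally show ?thesis .
qed

lemma ennreal_weight_matrix_power:
  assumes "F = (\<lambda>a. \<beta> * F0 a)" "v \<in> verts G"
  shows "ennreal (weight_matrix_power G F0 \<beta> n v w) = total_weight (walks_of_length n v w)"
  using assms(2)
proof (induction n arbitrary: v)
  case 0
  then show ?case
    by (simp add: total_weight_walks_0)
next
  case (Suc n)
  have "ennreal (weight_matrix_power G F0 \<beta> (Suc n) v w) =
      (\<Sum>a\<in>out_arcs G v. ennreal (exp (- \<beta> * F0 a) * weight_matrix_power G F0 \<beta> n (head G a) w))"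
    unfolding weight_matrix_power_Suc[OF Suc.prems]
    by (intro sum_ennreal[symmetric] mult_nonneg_nonneg weight_matrix_power_nonneg) auto
  also have "\<dots> = total_weight (walks_of_length (Suc n) v w)"
    unfolding total_weight_walks_Suc[OF Suc.prems]
    using Suc.IH assms(1) by (intro sum.cong refl) (auto simp: ennreal_mult')
  finally show ?case .
qed

lemma green_eq_suminf_weight_matrix_power:
  assumes F: "F = (\<lambda>a. \<beta> * F0 a)" "v \<in> verts G"
    and summable: "summable (\<lambda>n. weight_matrix_power G F0 \<beta> n v w)"
  shows "green v w = ennreal (\<Sum>n. weight_matrix_power G F0 \<beta> n v w)"
  unfolding green_suminf ennreal_weight_matrix_power[OF F, symmetric]
  using summable weight_matrix_power_nonneg by (intro suminf_ennreal_eq) (auto intro: summable_sums)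

subsection \<open>Decompositions of the Green kernel\<close>

lemma awalk_last_head: "awalk u p v \<Longrightarrow> p \<noteq> [] \<Longrightarrow> head G (last p) = v"
  by (cases p rule: rev_cases) (auto simp: awalk_Cons_iff awalk_Nil_iff)

lemma awalk_split_at:
  "awalk u (p @ a # q) v \<longleftrightarrow> awalk u (p @ [a]) (head G a) \<and> awalk (head G a) q v"
  by (auto simp: awalk_Cons_iff awalk_Nil_iff)

lemma append_eq_appendE:
  assumes "p @ q = p' @ q'"
  obtains r where "p' = p @ r" "q = r @ q'" | r where "p = p' @ r" "q' = r @ q"
  using assms by (auto simp: append_eq_append_conv2)

lemma green_split_empty:
  assumes "v \<in> verts G"
  shows "green v w = (if v = w then 1 else 0) + total_weight {p. awalk v p w \<and> p \<noteq> []}"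
proof -
  have "{p. awalk v p w} = walks_of_length 0 v w \<union> {p. awalk v p w \<and> p \<noteq> []}"
    by (auto simp: walks_of_length_def)
  moreover have "walks_of_length 0 v w \<inter> {p. awalk v p w \<and> p \<noteq> []} = {}"
    by (auto simp: walks_of_length_def)
  ultimately show ?thesis
    using total_weight_walks_0[OF assms] total_weight_Un_disjoint by (simp add: green_def)
qed

lemma green_first_step:
  assumes v: "v \<in> verts G"
  shows "green v w = (if v = w then 1 else 0) + (\<Sum>a\<in>out_arcs G v. ennreal (exp (- F a)) * green (head G a) w)"
proof -
  have "bij_betw (\<lambda>(a, p, q). p @ q)
      (SIGMA a:out_arcs G v. {[a]} \<times> {p. awalk (head G a) p w}) {p. awalk v p w \<and> p \<noteq> []}"
  proof (rule bij_betw_imageI)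
    show "(\<lambda>(a, p, q). p @ q) ` (SIGMA a:out_arcs G v. {[a]} \<times> {p. awalk (head G a) p w}) =
        {p. awalk v p w \<and> p \<noteq> []}"
      by (auto simp: neq_Nil_conv awalk_Cons_iff image_iff)
  qed (auto simp: inj_on_def)
  from total_weight_concat[OF finite_out_arcs[OF v] this]
  have step: "total_weight {p. awalk v p w \<and> p \<noteq> []} =
      (\<Sum>a\<in>out_arcs G v. ennreal (exp (- F a)) * green (head G a) w)"
    by (simp add: walk_weight_Cons green_def)
  show ?thesis
    using step green_split_empty[OF v] by simp
qed

text \<open>
A walk from \<open>D\<close> to a vertex outside \<open>D\<close> is cut at its last visit to \<open>D\<close>. The cut is unique: if one
of two cuts came earlier, the part of the walk after it would enter \<open>D\<close> again.
\<close>

lemma bij_betw_last_exit: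
  assumes v: "v \<in> D" and w: "w \<notin> D"
  shows "bij_betw (\<lambda>(u, p, q). p @ q)
    (SIGMA u:D. {p. awalk v p u} \<times> leaving_walks G D u w) {p. awalk v p w}"
proof (rule bij_betw_imageI)
  have prefix: "r = []" if "awalk v (p @ r) u" "u \<in> D" "r @ q \<in> leaving_walks G D u' w" for p q r u u'
  proof (rule ccontr)
    assume r: "r \<noteq> []"
    then have "head G (last r) \<in> D"
      using awalk_last_head[OF that(1)] that(2) by simp
    moreover have "last r \<in> set (r @ q)"
      using r by simp
    ultimately show False
      using that(3) unfolding leaving_walks_def by blast
  qed
  have unique: "u = u' \<and> p = p' \<and> q = q'"
    if eq: "p @ q = p' @ q'" and u: "u \<in> D" "awalk v p u" "q \<in> leaving_walks G D u w"
      and u': "u' \<in> D" "awalk v p' u'" "q' \<in> leaving_walks G D u' w"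
    for u p q u' p' q'
  proof -
    from eq have "p = p' \<and> q = q'"
    proof (cases rule: append_eq_appendE)
      case (1 r)
      then have "r = []"
        using prefix[of p r u' q' u] u u' by blast
      with 1 show ?thesis by simp
    next
      case (2 r)
      then have "r = []"
        using prefix[of p' r u q u'] u u' by blast
      with 2 show ?thesis by simp
    qed
    moreover from this have "u = u'"
      using u u' awalk_ends_eqD by blast
    ultimately show ?thesis
      by simp
  qed
  show "inj_on (\<lambda>(u, p, q). p @ q) (SIGMA u:D. {p. awalk v p u} \<times> leaving_walks G D u w)"
    by (rule inj_onI, clarsimp, drule unique) auto
  show "(\<lambda>(u, p, q). p @ q) ` (SIGMA u:D. {p. awalk v p u} \<times> leaving_walks G D u w) = {p. awalk v p w}"
  proof (intro equalityI subsetI)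
    fix r assume "r \<in> {p. awalk v p w}"
    then have r: "awalk v r w"
      by simp
    show "r \<in> (\<lambda>(u, p, q). p @ q) ` (SIGMA u:D. {p. awalk v p u} \<times> leaving_walks G D u w)"
    proof (cases "\<exists>a\<in>set r. head G a \<in> D")
      case True
      then obtain p a q where eq: "r = p @ a # q" and a: "head G a \<in> D"
        and q: "\<forall>b\<in>set q. head G b \<notin> D"
        using split_list_last_prop[OF True] by blast
      then have "(head G a, p @ [a], q) \<in> (SIGMA u:D. {p. awalk v p u} \<times> leaving_walks G D u w)"
        using r awalk_split_at[of v p a q w] by (simp add: leaving_walks_def)
      then show ?thesis
        by (rule image_eqI[rotated]) (simp add: eq)
    next
      case False
      then have "(v, [], r) \<in> (SIGMA u:D. {p. awalk v p u} \<times> leaving_walks G D u w)"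
        using r v awalk_Nil_iff[of v v] awalk_hd_in_verts[OF r] by (simp add: leaving_walks_def)
      then show ?thesis
        by (rule image_eqI[rotated]) simp
    qed
  qed (auto simp: leaving_walks_def intro: awalk_appendI)
qed

lemma green_last_exit:
  assumes "finite D" "v \<in> D" "w \<notin> D"
  shows "green v w = (\<Sum>u\<in>D. green v u * total_weight (leaving_walks G D u w))"
  unfolding green_def by (rule total_weight_concat[OF assms(1) bij_betw_last_exit[OF assms(2,3)]])

text \<open>
Walks of positive length without a visit to \<open>D\<close> strictly between their ends.
\<close>

definition first_return_walks :: "'v set \<Rightarrow> 'v \<Rightarrow> 'v \<Rightarrow> 'a list set" where
  "first_return_walks D v w = {p. awalk v p w \<and> p \<noteq> [] \<and> (\<forall>a\<in>set (butlast p). head G a \<notin> D)}"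

lemma bij_betw_first_return:
  assumes w: "w \<in> D"
  shows "bij_betw (\<lambda>(u, p, q). p @ q)
    (SIGMA u:D. first_return_walks D v u \<times> {p. awalk u p w}) {p. awalk v p w \<and> p \<noteq> []}"
proof (rule bij_betw_imageI)
  have prefix: "r = []" if "p \<in> first_return_walks D v u" "u \<in> D" "p @ r \<in> first_return_walks D v u'"
    for p r u u'
  proof (rule ccontr)
    assume r: "r \<noteq> []"
    have p: "awalk v p u" "p \<noteq> []"
      using that(1) by (auto simp: first_return_walks_def)
    then have "head G (last p) \<in> D"
      using awalk_last_head[OF p] that(2) by simp
    moreover have "last p \<in> set (butlast (p @ r))"
      using p r by (simp add: butlast_append)
    ultimately show False
      using that(3) unfolding first_return_walks_def by blast
  qed
  have unique: "u = u' \<and> p = p' \<and> q = q'"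
    if eq: "p @ q = p' @ q'" and u: "u \<in> D" "p \<in> first_return_walks D v u"
      and u': "u' \<in> D" "p' \<in> first_return_walks D v u'"
    for u p q u' p' q'
  proof -
    from eq have "p = p' \<and> q = q'"
    proof (cases rule: append_eq_appendE)
      case (1 r)
      then have "r = []"
        using prefix[of p u r u'] u u' by blast
      with 1 show ?thesis by simp
    next
      case (2 r)
      then have "r = []"
        using prefix[of p' u' r u] u u' by blast
      with 2 show ?thesis by simp
    qed
    moreover from this have "u = u'"
      using u u' awalk_ends_eqD unfolding first_return_walks_def by blast
    ultimately show ?thesis
      by simp
  qed
  show "inj_on (\<lambda>(u, p, q). p @ q) (SIGMA u:D. first_return_walks D v u \<times> {p. awalk u p w})"
    by (rule inj_onI, clarsimp, drule unique) auto
  show "(\<lambda>(u, p, q). p @ q) ` (SIGMA u:D. first_return_walks D v u \<times> {p. awalk u p w}) =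
      {p. awalk v p w \<and> p \<noteq> []}"
  proof (intro equalityI subsetI)
    fix r assume "r \<in> {p. awalk v p w \<and> p \<noteq> []}"
    then have r: "awalk v r w" "r \<noteq> []"
      by auto
    then have "\<exists>a\<in>set r. head G a \<in> D"
      using awalk_last_head[OF r] w last_in_set by metis
    from split_list_first_prop[OF this] obtain p a q where eq: "r = p @ a # q" and a: "head G a \<in> D"
      and p: "\<forall>b\<in>set p. head G b \<notin> D"
      by blast
    then have "(head G a, p @ [a], q) \<in> (SIGMA u:D. first_return_walks D v u \<times> {p. awalk u p w})"
      using r awalk_split_at[of v p a q w] by (simp add: first_return_walks_def)
    then show "r \<in> (\<lambda>(u, p, q). p @ q) ` (SIGMA u:D. first_return_walks D v u \<times> {p. awalk u p w})"
      by (rule image_eqI[rotated]) (simp add: eq)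
  qed (auto simp: first_return_walks_def intro: awalk_appendI)
qed

lemma green_first_return:
  assumes D: "finite D" and v: "v \<in> verts G" and w: "w \<in> D"
  shows "green v w = (if v = w then 1 else 0) +
    (\<Sum>u\<in>D. total_weight (first_return_walks D v u) * green u w)"
proof -
  show ?thesis
    using total_weight_concat[OF D bij_betw_first_return[OF w]] green_split_empty[OF v]
    by (simp add: green_def)
qed

text \<open>
Prolonging walks from \<open>v\<close> by a fixed walk \<open>q\<close> from \<open>u\<close> to \<open>v\<close> embeds them into the walks from \<open>u\<close>,
at the price of the positive factor \<open>e\<^bsup>-F(q)\<^esup>\<close>.
\<close>

lemma green_reachable_less_top:
  assumes "green u w < \<infinity>" "awalk u q v"
  shows "green v w < \<infinity>"
proof -
  have "bij_betw (\<lambda>(i, p, q). p @ q) (SIGMA i:{()}. {q} \<times> {p. awalk v p w}) ((@) q ` {p. awalk v p w})"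
    by (auto simp: bij_betw_def inj_on_def image_iff)
  from total_weight_concat[OF _ this]
  have "ennreal (walk_weight q) * green v w = total_weight ((@) q ` {p. awalk v p w})"
    by (simp add: green_def)
  also have "\<dots> \<le> green u w"
    unfolding green_def using assms(2) by (intro total_weight_mono) (auto intro: awalk_appendI)
  finally have "ennreal (walk_weight q) * green v w < \<infinity>"
    using assms(1) by (rule le_less_trans)
  then show ?thesis
    using walk_weight_pos[of q] by (auto simp: ennreal_mult_less_top simp del: walk_weight_pos)
qed

end

section \<open>Transience and last visits\<close>

context potential
begin

text \<open>
Finite sets may be replaced by single vertices; this turns the definition into a countable
combination of conditions on coordinates.
\<close>

lemma wandering_iff:
  "x \<in> wandering G \<longleftrightarrow>
     x \<in> inf_paths G \<and> (\<forall>w\<in>verts G. \<exists>N. \<forall>i. N \<le> i \<longrightarrow> tail G (x i) \<noteq> w)"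
proof (intro iffI conjI ballI)
  assume x: "x \<in> wandering G"
  then show "x \<in> inf_paths G"
    by (simp add: wandering_def)
  fix w assume w: "w \<in> verts G"
  have "finite {w} \<and> {w} \<subseteq> verts G \<longrightarrow> (\<exists>N. \<forall>i\<ge>N. tail G (x i) \<notin> {w})"
    using x unfolding wandering_def by blast
  then show "\<exists>N. \<forall>i. N \<le> i \<longrightarrow> tail G (x i) \<noteq> w"
    using w by simp
next
  assume x: "x \<in> inf_paths G \<and> (\<forall>w\<in>verts G. \<exists>N. \<forall>i. N \<le> i \<longrightarrow> tail G (x i) \<noteq> w)"
  have "\<exists>N. \<forall>i\<ge>N. tail G (x i) \<notin> H" if H: "finite H" "H \<subseteq> verts G" for H
  proof -
    have "\<forall>\<^sub>F i in sequentially. \<forall>w\<in>H. tail G (x i) \<noteq> w"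
      using H x by (intro eventually_ball_finite) (auto simp: eventually_sequentially)
    then show ?thesis
      by (auto simp: eventually_sequentially)
  qed
  then show "x \<in> wandering G"
    using x by (simp add: wandering_def)
qed

lemma sets_wandering [measurable]: "wandering G \<in> sets (path_borel G)"
proof -
  have "wandering G = {x \<in> space (path_borel G). \<forall>w\<in>verts G. \<exists>N. \<forall>i. N \<le> i \<longrightarrow> tail G (x i) \<noteq> w}"
    using wandering_iff by auto
  also have "\<dots> \<in> sets (path_borel G)"
    by (intro sets.sets_Collect_countable_All' countable_verts) measurable
  finally show ?thesis .
qed

lemma sets_exit_paths: "exit_paths G D w \<in> sets (path_borel G)"
proof -
  have "exit_paths G D w = {x \<in> space (path_borel G).
      x \<in> wandering G \<and> tail G (x 0) = w \<and> (\<forall>i. 1 \<le> i \<longrightarrow> tail G (x i) \<notin> D)}"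
    by (auto simp: exit_paths_def wandering_def)
  also have "\<dots> \<in> sets (path_borel G)"
    by measurable
  finally show ?thesis .
qed

lemma exit_paths_subset: "exit_paths G D w \<subseteq> cylinder G w []"
  by (auto simp: exit_paths_def wandering_def cylinder_def)

lemma countable_walks: "countable {p. awalk v p w}"
proof (rule countable_subset)
  show "{p. awalk v p w} \<subseteq> lists (arcs G)"
    by auto
qed (use countable_arcs in simp)

lemma wandering_drop:
  assumes x: "x \<in> inf_paths G"
  shows "(\<lambda>i. x (n + i)) \<in> wandering G \<longleftrightarrow> x \<in> wandering G"
proof -
  have "(\<lambda>i. x (n + i)) \<in> inf_paths G"
    using x by (simp add: inf_paths_def)
  moreover have "(\<exists>N. \<forall>i. N \<le> i \<longrightarrow> tail G (x (n + i)) \<noteq> w) \<longleftrightarrow> (\<exists>N. \<forall>i. N \<le> i \<longrightarrow> tail G (x i) \<noteq> w)"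
    for w
    using eventually_sequentially_seg[of "\<lambda>i. tail G (x i) \<noteq> w" n]
    by (simp add: eventually_sequentially add.commute)
  ultimately show ?thesis
    using x by (simp add: wandering_iff)
qed

text \<open>
The possible pasts of a path from \<open>v\<close> up to its last visit to \<open>D\<close>, together with the vertex visited.
\<close>

definition last_visits :: "'v set \<Rightarrow> 'v \<Rightarrow> ('v \<times> 'a list) set" where
  "last_visits D v = (SIGMA w:D. {p. awalk v p w})"

text \<open>
A wandering path leaves the finite set \<open>D\<close> for good, so it has a last visit to \<open>D\<close>; what follows
is an exit path.
\<close>

lemma wandering_last_visit:
  assumes D: "finite D" "D \<subseteq> verts G" and v: "v \<in> D"
  shows "cylinder G v [] \<inter> wandering G = (\<Union>(w, p)\<in>last_visits D v. prepend p (exit_paths G D w))"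
proof (intro equalityI subsetI)
  fix x assume "x \<in> cylinder G v [] \<inter> wandering G"
  then have x: "x \<in> inf_paths G" "tail G (x 0) = v" "x \<in> wandering G"
    by (auto simp: cylinder_def)
  obtain N where N: "\<forall>i\<ge>N. tail G (x i) \<notin> D"
    using x(3) D unfolding wandering_def by blast
  let ?V = "{i. tail G (x i) \<in> D}"
  have "?V \<subseteq> {..<N}"
    using N by (auto simp: not_le[symmetric])
  then have fin: "finite ?V"
    by (rule finite_subset) simp
  have "0 \<in> ?V"
    using x v by simp
  define n where "n = Max ?V"
  have n: "tail G (x n) \<in> D"
    using Max_in[OF fin] \<open>0 \<in> ?V\<close> unfolding n_def by blast
  have later: "tail G (x i) \<notin> D" if "n < i" for i
    using Max_ge[OF fin, of i] that unfolding n_def by auto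
  have "(tail G (x n), map x [0..<n]) \<in> last_visits D v"
    using awalk_initial_segment[OF x(1), of n] x(2) n by (simp add: last_visits_def)
  moreover have "x \<in> prepend (map x [0..<n]) (exit_paths G D (tail G (x n)))"
    using x wandering_drop[OF x(1), of n] later by (simp add: prepend_def exit_paths_def)
  ultimately show "x \<in> (\<Union>(w, p)\<in>last_visits D v. prepend p (exit_paths G D w))"
    by blast
next
  fix x assume "x \<in> (\<Union>(w, p)\<in>last_visits D v. prepend p (exit_paths G D w))"
  then obtain w p where p: "awalk v p w" and x: "x \<in> prepend p (exit_paths G D w)"
    by (auto simp: last_visits_def)
  have "x \<in> prepend p (cylinder G w [])"
    using x exit_paths_subset by (auto simp: prepend_def)
  then have "x \<in> cylinder G v p"
    using cylinder_eq_prepend[OF p] by simp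
  moreover from this have "x \<in> inf_paths G"
    by (simp add: cylinder_def)
  ultimately show "x \<in> cylinder G v [] \<inter> wandering G"
    using x wandering_drop[of x "length p"] by (auto simp: prepend_def exit_paths_def cylinder_def)
qed

text \<open>
The length of the past is the time of the last visit, hence determined by the path.
\<close>

lemma disjoint_last_visits:
  "disjoint_family_on (\<lambda>(w, p). prepend p (exit_paths G D w)) (last_visits D v)"
proof -
  have disj: "prepend p (exit_paths G D w) \<inter> prepend p' (exit_paths G D w') = {}"
    if wp: "(w, p) \<in> last_visits D v" "(w', p') \<in> last_visits D v" "(w, p) \<noteq> (w', p')" for w p w' p'
  proof (rule ccontr)
    assume "prepend p (exit_paths G D w) \<inter> prepend p' (exit_paths G D w') \<noteq> {}"
    then obtain x where x: "x \<in> prepend p (exit_paths G D w)" "x \<in> prepend p' (exit_paths G D w')"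
      by blast
    have visit: "tail G (x (length q)) \<in> D" "\<And>i. length q < i \<Longrightarrow> tail G (x i) \<notin> D"
      if "x \<in> prepend q (exit_paths G D u)" "(u, q) \<in> last_visits D v" for u q
    proof -
      have exit: "(\<lambda>i. x (length q + i)) \<in> exit_paths G D u"
        using that(1) by (simp add: prepend_def)
      then show "tail G (x (length q)) \<in> D"
        using that(2) by (auto simp: exit_paths_def last_visits_def)
      have "\<forall>i\<ge>1. tail G (x (length q + i)) \<notin> D"
        using exit by (simp add: exit_paths_def)
      then show "tail G (x i) \<notin> D" if "length q < i" for i
        using that by (auto dest!: spec[of _ "i - length q"])
    qed
    have nth: "x i = q ! i" if "x \<in> prepend q B" "i < length q" for q B i
      using that by (simp add: prepend_def)
    have "length p = length p'"
      using visit[OF x(1) wp(1)] visit[OF x(2) wp(2)] by (metis linorder_neqE_nat)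
    moreover have "p ! i = p' ! i" if "i < length p" "i < length p'" for i
      using nth[OF x(1) that(1)] nth[OF x(2) that(2)] by simp
    ultimately have "p = p'"
      by (simp add: list_eq_iff_nth_eq)
    moreover have "w = w'"
      using wp(1,2) \<open>p = p'\<close> awalk_ends_eqD by (auto simp: last_visits_def)
    ultimately show False
      using wp(3) by simp
  qed
  show ?thesis
    unfolding disjoint_family_on_def
  proof (intro ballI impI)
    fix x y assume "x \<in> last_visits D v" "y \<in> last_visits D v" "x \<noteq> y"
    then show "(case x of (w, p) \<Rightarrow> prepend p (exit_paths G D w)) \<inter>
        (case y of (w, p) \<Rightarrow> prepend p (exit_paths G D w)) = {}"
      using disj[of "fst x" "snd x" "fst y" "snd y"] by (cases x; cases y) simp
  qed
qed

end

text \<open>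
The analytic form of transience.
\<close>

locale transient_potential = potential G F for G :: "('v, 'a) pre_digraph" and F :: "'a \<Rightarrow> real" +
  assumes green_less_top: "v \<in> verts G \<Longrightarrow> w \<in> verts G \<Longrightarrow> green v w < \<infinity>"
begin

definition green_real :: "'v \<Rightarrow> 'v \<Rightarrow> real" where
  "green_real v w = enn2real (green v w)"

definition leaving_weight :: "'v set \<Rightarrow> 'v \<Rightarrow> 'v \<Rightarrow> real" where
  "leaving_weight D v w = enn2real (total_weight (leaving_walks G D v w))"

definition first_return_weight :: "'v set \<Rightarrow> 'v \<Rightarrow> 'v \<Rightarrow> real" where
  "first_return_weight D v w = enn2real (total_weight (first_return_walks D v w))"

lemma ennreal_green_real: "v \<in> verts G \<Longrightarrow> w \<in> verts G \<Longrightarrow> ennreal (green_real v w) = green v w"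
  using green_less_top by (simp add: green_real_def)

lemma green_real_nonneg: "0 \<le> green_real v w"
  by (simp add: green_real_def)

lemma green_real_diagonal:
  assumes "v \<in> verts G"
  shows "0 < green_real v v"
proof -
  have "0 < green v v"
    unfolding green_def using assms by (intro total_weight_pos[of "[]"]) (simp add: awalk_Nil_iff)
  then show ?thesis
    using green_less_top[OF assms assms] by (simp add: green_real_def enn2real_positive_iff)
qed

lemma leaving_weight_nonneg: "0 \<le> leaving_weight D v w"
  by (simp add: leaving_weight_def)

lemma total_weight_less_top:
  assumes "S \<subseteq> {p. awalk v p w}" "v \<in> verts G" "w \<in> verts G"
  shows "total_weight S < \<infinity>"
  using total_weight_mono[OF assms(1)] green_less_top[OF assms(2,3)]
  unfolding green_def[symmetric] by (rule le_less_trans)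

lemma ennreal_leaving_weight:
  assumes "v \<in> verts G" "w \<in> verts G"
  shows "ennreal (leaving_weight D v w) = total_weight (leaving_walks G D v w)"
  using total_weight_less_top[of "leaving_walks G D v w" v w] assms
  by (simp add: leaving_weight_def leaving_walks_def subset_iff)

lemma leaving_weight_infsum:
  assumes "v \<in> verts G" "w \<in> verts G"
  shows "leaving_weight D v w = infsum walk_weight (leaving_walks G D v w)"
proof -
  have "total_weight (leaving_walks G D v w) < \<infinity>"
    using assms by (intro total_weight_less_top[of _ v w]) (auto simp: leaving_walks_def)
  from total_weight_infsum[OF this, symmetric] show ?thesis
    unfolding leaving_weight_def by (simp add: infsum_nonneg less_imp_le)
qed

lemma leaving_weight_pos:
  assumes "v \<in> verts G" "w \<in> verts G" "leaving_walks G D v w \<noteq> {}"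
  shows "0 < leaving_weight D v w"
proof -
  obtain p where "p \<in> leaving_walks G D v w"
    using assms(3) by blast
  then have "0 < ennreal (leaving_weight D v w)"
    unfolding ennreal_leaving_weight[OF assms(1,2)] by (rule total_weight_pos)
  then show ?thesis
    by simp
qed

lemma ennreal_first_return_weight:
  assumes "v \<in> verts G" "w \<in> verts G"
  shows "ennreal (first_return_weight D v w) = total_weight (first_return_walks D v w)"
  using total_weight_less_top[of "first_return_walks D v w" v w] assms
  by (simp add: first_return_weight_def first_return_walks_def subset_iff)

lemma first_return_weight_nonneg: "0 \<le> first_return_weight D v w"
  by (simp add: first_return_weight_def)

lemma green_real_first_step:
  assumes v: "v \<in> verts G" and w: "w \<in> verts G"
  shows "green_real v w = (if v = w then 1 else 0) + (\<Sum>a\<in>out_arcs G v. exp (- F a) * green_real (head G a) w)"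
proof -
  have "ennreal (green_real v w) =
      (if v = w then 1 else 0) + (\<Sum>a\<in>out_arcs G v. ennreal (exp (- F a)) * green (head G a) w)"
    using green_first_step[OF v] ennreal_green_real[OF v w] by simp
  also have "(\<Sum>a\<in>out_arcs G v. ennreal (exp (- F a)) * green (head G a) w) =
      (\<Sum>a\<in>out_arcs G v. ennreal (exp (- F a) * green_real (head G a) w))"
    by (intro sum.cong refl) (use w in \<open>auto simp: ennreal_mult' ennreal_green_real\<close>)
  also have "\<dots> = ennreal (\<Sum>a\<in>out_arcs G v. exp (- F a) * green_real (head G a) w)"
    by (intro sum_ennreal mult_nonneg_nonneg green_real_nonneg) auto
  also have "(if v = w then 1 else 0) + \<dots> =
      ennreal ((if v = w then 1 else 0) + (\<Sum>a\<in>out_arcs G v. exp (- F a) * green_real (head G a) w))"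
    by (subst ennreal_plus) (auto intro!: sum_nonneg mult_nonneg_nonneg green_real_nonneg)
  finally show ?thesis
    by (subst (asm) ennreal_inj) (auto intro!: sum_nonneg mult_nonneg_nonneg add_nonneg_nonneg green_real_nonneg)
qed

lemma green_real_last_exit:
  assumes D: "finite D" "D \<subseteq> verts G" and v: "v \<in> D" and w: "w \<in> verts G" "w \<notin> D"
  shows "green_real v w = (\<Sum>u\<in>D. green_real v u * leaving_weight D u w)"
proof -
  have "ennreal (green_real v w) = (\<Sum>u\<in>D. green v u * total_weight (leaving_walks G D u w))"
    using green_last_exit[OF D(1) v w(2)] ennreal_green_real w v D by auto
  also have "\<dots> = (\<Sum>u\<in>D. ennreal (green_real v u * leaving_weight D u w))"
    using D v w by (intro sum.cong refl)
      (auto simp: ennreal_mult' green_real_nonneg ennreal_green_real ennreal_leaving_weight subset_iff)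
  also have "\<dots> = ennreal (\<Sum>u\<in>D. green_real v u * leaving_weight D u w)"
    by (intro sum_ennreal mult_nonneg_nonneg green_real_nonneg leaving_weight_nonneg)
  finally show ?thesis
    by (subst (asm) ennreal_inj)
      (auto intro!: sum_nonneg mult_nonneg_nonneg green_real_nonneg leaving_weight_nonneg)
qed

text \<open>
The matrix \<open>1 - R\<close>, where \<open>R\<close> collects the weights of the first-return walks.
\<close>

definition no_return_matrix :: "'v set \<Rightarrow> 'v \<Rightarrow> 'v \<Rightarrow> real" where
  "no_return_matrix D v w = (if v = w then 1 else 0) - first_return_weight D v w"

text \<open>
Cutting walks between vertices of \<open>D\<close> at their first return to \<open>D\<close> gives \<open>g = 1 + R g\<close> on \<open>D\<close>, that
is \<open>(1 - R) g = 1\<close>.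
\<close>

lemma no_return_matrix_green:
  assumes D: "finite D" "D \<subseteq> verts G" and v: "v \<in> D" and w: "w \<in> D"
  shows "(\<Sum>u\<in>D. no_return_matrix D v u * green_real u w) = (if v = w then 1 else 0)"
proof -
  have verts: "v \<in> verts G" "w \<in> verts G"
    using D v w by auto
  have "ennreal (green_real v w) =
      (if v = w then 1 else 0) + (\<Sum>u\<in>D. total_weight (first_return_walks D v u) * green u w)"
    using green_first_return[OF D(1) verts(1) w] ennreal_green_real[OF verts] by simp
  also have "(\<Sum>u\<in>D. total_weight (first_return_walks D v u) * green u w) =
      (\<Sum>u\<in>D. ennreal (first_return_weight D v u * green_real u w))"
    using D verts by (intro sum.cong refl)
      (auto simp: ennreal_mult' first_return_weight_nonneg ennreal_green_real
        ennreal_first_return_weight subset_iff)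
  also have "\<dots> = ennreal (\<Sum>u\<in>D. first_return_weight D v u * green_real u w)"
    by (intro sum_ennreal mult_nonneg_nonneg green_real_nonneg first_return_weight_nonneg)
  also have "(if v = w then 1 else 0) + \<dots> =
      ennreal ((if v = w then 1 else 0) + (\<Sum>u\<in>D. first_return_weight D v u * green_real u w))"
    by (subst ennreal_plus)
      (auto intro!: sum_nonneg mult_nonneg_nonneg green_real_nonneg first_return_weight_nonneg)
  finally have "green_real v w =
      (if v = w then 1 else 0) + (\<Sum>u\<in>D. first_return_weight D v u * green_real u w)"
    by (subst (asm) ennreal_inj) (auto intro!: sum_nonneg mult_nonneg_nonneg add_nonneg_nonneg
        green_real_nonneg first_return_weight_nonneg)
  moreover have "(\<Sum>u\<in>D. (if v = u then 1 else 0) * green_real u w) = green_real v w"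
    using D(1) v by (simp add: if_distrib[of "\<lambda>c. c * _"] cong: if_cong)
  ultimately show ?thesis
    by (simp add: no_return_matrix_def left_diff_distrib sum_subtractf)
qed

lemma no_return_matrix_inverts_green:
  assumes D: "finite D" "D \<subseteq> verts G" and v: "v \<in> D"
  shows "(\<Sum>u\<in>D. no_return_matrix D v u * (\<Sum>w\<in>D. green_real u w * f w)) = f v"
proof -
  have "(\<Sum>u\<in>D. no_return_matrix D v u * (\<Sum>w\<in>D. green_real u w * f w)) =
      (\<Sum>u\<in>D. \<Sum>w\<in>D. no_return_matrix D v u * green_real u w * f w)"
    by (simp add: sum_distrib_left mult.assoc)
  also have "\<dots> = (\<Sum>w\<in>D. \<Sum>u\<in>D. no_return_matrix D v u * green_real u w * f w)"
    by (rule sum.swap)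
  also have "\<dots> = (\<Sum>w\<in>D. (\<Sum>u\<in>D. no_return_matrix D v u * green_real u w) * f w)"
    by (simp add: sum_distrib_right)
  also have "\<dots> = (\<Sum>w\<in>D. (if v = w then f w else 0))"
    using no_return_matrix_green[OF D v] by (intro sum.cong refl) auto
  also have "\<dots> = f v"
    using D(1) v by simp
  finally show ?thesis .
qed

context
  fixes m :: "(nat \<Rightarrow> 'a) measure"
  assumes conf: "conformal_measure G F m"
begin

text \<open>
Summed over \<open>n\<close>, this is the integral over \<open>Z(v)\<close> of the number of visits to \<open>w\<close>.
\<close>

lemma emeasure_visit:
  assumes v: "v \<in> verts G"
  shows "emeasure m {x \<in> cylinder G v []. tail G (x n) = w} =
    total_weight (walks_of_length n v w) * emeasure m (cylinder G w [])"
proof -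
  have "{x \<in> cylinder G v []. tail G (x n) = w} = (\<Union>p\<in>walks_of_length n v w. cylinder G v p)"
  proof (intro equalityI subsetI)
    fix x assume "x \<in> {x \<in> cylinder G v []. tail G (x n) = w}"
    then have x: "x \<in> inf_paths G" "tail G (x 0) = v" "tail G (x n) = w"
      by (auto simp: cylinder_def)
    then have "map x [0..<n] \<in> walks_of_length n v w" "x \<in> cylinder G v (map x [0..<n])"
      using awalk_initial_segment[OF x(1), of n] in_cylinder_initial_segment[OF x(1), of n]
      by (auto simp: walks_of_length_def)
    then show "x \<in> (\<Union>p\<in>walks_of_length n v w. cylinder G v p)"
      by blast
  next
    fix x assume "x \<in> (\<Union>p\<in>walks_of_length n v w. cylinder G v p)"
    then obtain p where "awalk v p w" "length p = n" "x \<in> cylinder G v p"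
      by (auto simp: walks_of_length_def)
    then show "x \<in> {x \<in> cylinder G v []. tail G (x n) = w}"
      using cylinder_end cylinder_subset by blast
  qed
  then have "emeasure m {x \<in> cylinder G v []. tail G (x n) = w} =
      emeasure m (\<Union>p\<in>walks_of_length n v w. cylinder G v p)"
    by simp
  also have "\<dots> = (\<integral>\<^sup>+p. emeasure m (cylinder G v p) \<partial>count_space (walks_of_length n v w))"
  proof (rule emeasure_UN_countable)
    show "cylinder G v p \<in> sets m" for p
      by (simp add: sets_conformal[OF conf] sets_cylinder)
    show "countable (walks_of_length n v w)"
      by (rule countable_subset[OF _ countable_walks]) (auto simp: walks_of_length_def)
    have "p = q" if "length p = length q" "x \<in> cylinder G v p" "x \<in> cylinder G v q" for p q x
      using that by (intro nth_equalityI) (auto simp: cylinder_def)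
    then show "disjoint_family_on (cylinder G v) (walks_of_length n v w)"
      unfolding disjoint_family_on_def walks_of_length_def by blast
  qed
  also have "\<dots> = (\<integral>\<^sup>+p. ennreal (walk_weight p) * emeasure m (cylinder G w []) \<partial>count_space (walks_of_length n v w))"
    by (intro nn_integral_cong) (auto simp: walks_of_length_def emeasure_cylinder[OF conf])
  also have "\<dots> = total_weight (walks_of_length n v w) * emeasure m (cylinder G w [])"
    by (simp add: total_weight_def nn_integral_multc)
  finally show ?thesis .
qed

text \<open>
The integral of the number of visits to \<open>w\<close> is \<open>g(v,w) m(Z(w))\<close>, which is finite; by Borel-Cantelli
almost every path visits \<open>w\<close> only finitely often.
\<close>

lemma AE_wandering:
  assumes v: "v \<in> verts G"
  shows "AE x in m. x \<in> cylinder G v [] \<longrightarrow> x \<in> wandering G"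
proof -
  have "AE x in m. \<forall>\<^sub>F n in sequentially. x \<in> space m - {x \<in> cylinder G v []. tail G (x n) = w}"
    if w: "w \<in> verts G" for w
  proof (rule borel_cantelli_AE1)
    let ?A = "\<lambda>n. {x \<in> cylinder G v []. tail G (x n) = w}"
    have A: "?A n \<in> sets (path_borel G)" for n
    proof -
      have "?A n = cylinder G v [] \<inter> {x \<in> space (path_borel G). tail G (x n) = w}"
        by (auto simp: cylinder_def)
      also have "\<dots> \<in> sets (path_borel G)"
        by measurable
      finally show ?thesis .
    qed
    then show "?A n \<in> sets m" for n
      by (simp add: sets_conformal[OF conf])
    have fin: "emeasure m (?A n) < \<infinity>" for n
    proof -
      have "emeasure m (?A n) \<le> emeasure m (cylinder G v [])"
        by (rule emeasure_mono) (auto simp: sets_conformal[OF conf] sets_cylinder)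
      also have "\<dots> < \<infinity>"
        using emeasure_cylinder_Nil[OF conf v] by simp
      finally show ?thesis .
    qed
    then show "emeasure m (?A n) < \<infinity>" for n .
    have "(\<Sum>n. ennreal (measure m (?A n))) = (\<Sum>n. total_weight (walks_of_length n v w) * emeasure m (cylinder G w []))"
      using fin by (intro suminf_cong) (simp add: emeasure_visit[OF v, symmetric] emeasure_eq_ennreal_measure less_top)
    also have "\<dots> = green v w * emeasure m (cylinder G w [])"
      by (simp add: green_suminf)
    also have "\<dots> < \<infinity>"
      using green_less_top[OF v w] emeasure_cylinder_Nil[OF conf w] by (simp add: ennreal_mult_less_top)
    finally show "summable (\<lambda>n. measure m (?A n))"
      by (intro summable_suminf_not_top) auto
  qed
  then have "AE x in m. \<forall>w\<in>verts G. \<forall>\<^sub>F n in sequentially.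
      x \<in> space m - {x \<in> cylinder G v []. tail G (x n) = w}"
    by (subst AE_ball_countable[OF countable_verts]) blast
  then show ?thesis
  proof (rule AE_mp, intro AE_I2 impI)
    fix x assume x: "x \<in> cylinder G v []"
      and ev: "\<forall>w\<in>verts G. \<forall>\<^sub>F n in sequentially. x \<in> space m - {x \<in> cylinder G v []. tail G (x n) = w}"
    have "\<exists>N. \<forall>i. N \<le> i \<longrightarrow> tail G (x i) \<noteq> w" if "w \<in> verts G" for w
      using bspec[OF ev that] x by (auto simp: eventually_sequentially)
    then show "x \<in> wandering G"
      using x by (auto simp: wandering_iff cylinder_def)
  qed
qed

lemma emeasure_exit_paths:
  assumes "w \<in> verts G"
  shows "emeasure m (exit_paths G D w) = ennreal (measure m (exit_paths G D w))"
proof (rule emeasure_eq_ennreal_measure)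
  have "emeasure m (exit_paths G D w) \<le> emeasure m (cylinder G w [])"
    by (rule emeasure_mono[OF exit_paths_subset]) (simp add: sets_conformal[OF conf] sets_cylinder)
  then show "emeasure m (exit_paths G D w) \<noteq> top"
    using emeasure_cylinder_Nil[OF conf assms] by (auto simp: top_unique)
qed

text \<open>
Almost every path from \<open>v\<close> is wandering and is cut at its last visit to \<open>D\<close>. This represents the
harmonic function \<open>m(Z(v))\<close> on \<open>D\<close> as the potential of a charge on \<open>D\<close>.
\<close>

lemma measure_cylinder_last_visit:
  assumes D: "finite D" "D \<subseteq> verts G" and v: "v \<in> D"
  shows "measure m (cylinder G v []) = (\<Sum>w\<in>D. green_real v w * measure m (exit_paths G D w))"
proof -
  have v': "v \<in> verts G"
    using D v by auto
  have "emeasure m (cylinder G v []) = emeasure m (cylinder G v [] \<inter> wandering G)"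
  proof (rule emeasure_eq_AE)
    show "AE x in m. x \<in> cylinder G v [] \<longleftrightarrow> x \<in> cylinder G v [] \<inter> wandering G"
      using AE_wandering[OF v'] by (rule AE_mp) auto
  qed (use sets_cylinder sets_wandering in \<open>auto simp: sets_conformal[OF conf]\<close>)
  also have "\<dots> = emeasure m (\<Union>(w, p)\<in>last_visits D v. prepend p (exit_paths G D w))"
    by (simp only: wandering_last_visit[OF D v])
  also have "\<dots> = (\<integral>\<^sup>+z. emeasure m ((\<lambda>(w, p). prepend p (exit_paths G D w)) z) \<partial>count_space (last_visits D v))"
  proof (rule emeasure_UN_countable)
    show "(\<lambda>(w, p). prepend p (exit_paths G D w)) z \<in> sets m" for z
      using sets_prepend[OF sets_exit_paths] by (cases z) (simp add: sets_conformal[OF conf])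
    show "countable (last_visits D v)"
      unfolding last_visits_def using D(1) countable_walks by (intro countable_SIGMA) (auto simp: countable_finite)
  qed (rule disjoint_last_visits)
  also have "\<dots> = (\<integral>\<^sup>+z. ennreal (walk_weight (snd z)) * emeasure m (exit_paths G D (fst z)) \<partial>count_space (last_visits D v))"
    by (intro nn_integral_cong)
      (auto simp: last_visits_def intro!: emeasure_prepend[OF conf] sets_exit_paths
        dest: set_mp[OF exit_paths_subset])
  also have "\<dots> = (\<Sum>w\<in>D. green v w * emeasure m (exit_paths G D w))"
    unfolding last_visits_def nn_integral_count_space_Sigma
    using D(1) by (simp add: nn_integral_multc nn_integral_count_space_finite green_def total_weight_def)
  also have "\<dots> = (\<Sum>w\<in>D. ennreal (green_real v w * measure m (exit_paths G D w)))"
    using D v' by (intro sum.cong refl)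
      (auto simp: ennreal_mult' green_real_nonneg ennreal_green_real emeasure_exit_paths subset_iff)
  also have "\<dots> = ennreal (\<Sum>w\<in>D. green_real v w * measure m (exit_paths G D w))"
    by (intro sum_ennreal mult_nonneg_nonneg green_real_nonneg) auto
  finally show ?thesis
    by (intro measure_eq_emeasure_eq_ennreal) (auto intro!: sum_nonneg mult_nonneg_nonneg green_real_nonneg)
qed

end

end

section \<open>Exhaustions and boundary sequences\<close>

text \<open>
The setting of the theorem, with transience in the form of finiteness of the Green kernel.
Summability at \<open>v0\<close> identifies the real series that normalizes \<open>\<Delta>\<^bsub>\<beta>F\<^esub>\<close> with \<open>g(v0,v0)\<close>.
\<close>

locale exhausted_graph = transient_potential G "\<lambda>a. \<beta> * F a"
  for G :: "('v, 'a) pre_digraph" and F :: "'a \<Rightarrow> real" and \<beta> :: real +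
  fixes v0 :: 'v and D :: "nat \<Rightarrow> 'v set"
  assumes v0: "v0 \<in> verts G" and exhaustion: "exhaustion G v0 D"
    and summable_v0: "summable (\<lambda>n. weight_matrix_power G F \<beta> n v0 v0)"
begin

abbreviation bd :: "nat \<Rightarrow> 'v set" where
  "bd n \<equiv> vertex_boundary G (D n)"

abbreviation M :: "nat \<Rightarrow> 'v \<Rightarrow> 'v \<Rightarrow> real" where
  "M \<equiv> transfer_matrix G F \<beta> D"

lemma D_0: "D 0 = {v0}"
  and finite_D: "finite (D n)"
  and D_subset_verts: "D n \<subseteq> verts G"
  and D_interior: "D n \<subseteq> vertex_interior G (D (Suc n))"
  using exhaustion by (auto simp: exhaustion_def)

lemma D_Suc: "D n \<subseteq> D (Suc n)"
  using D_interior by (auto simp: vertex_interior_def)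

lemma D_mono: "n \<le> k \<Longrightarrow> D n \<subseteq> D k"
  using D_Suc by (rule lift_Suc_mono_le)

lemma head_D: "v \<in> D n \<Longrightarrow> a \<in> out_arcs G v \<Longrightarrow> head G a \<in> D (Suc n)"
  using D_interior[of n] unfolding vertex_interior_def by blast

lemma bd_subset: "bd n \<subseteq> D n"
  by (auto simp: vertex_boundary_def)

lemma finite_bd: "finite (bd n)"
  using bd_subset finite_D by (rule finite_subset)

lemma bd_verts: "w \<in> bd n \<Longrightarrow> w \<in> verts G"
  using bd_subset D_subset_verts by blast

lemma D_verts: "w \<in> D n \<Longrightarrow> w \<in> verts G"
  using D_subset_verts by blast

text \<open>
Successors of vertices of \<open>D\<^sub>n\<close> lie in \<open>D\<^bsub>n+1\<^esub>\<close>, so no path leaves \<open>D\<^bsub>n+1\<^esub>\<close> directly from \<open>D\<^sub>n\<close>.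
\<close>

lemma bd_Suc_disjoint:
  assumes "w \<in> bd (Suc n)"
  shows "w \<notin> D n"
proof
  assume w: "w \<in> D n"
  obtain y where y: "y \<in> exit_paths G (D (Suc n)) w"
    using assms by (auto simp: vertex_boundary_def)
  then have inf: "y \<in> inf_paths G" and "tail G (y 0) = w" and "tail G (y 1) \<notin> D (Suc n)"
    by (auto simp: exit_paths_def wandering_def)
  moreover have "y 0 \<in> out_arcs G w"
    using inf_path_arc[OF inf] \<open>tail G (y 0) = w\<close> by simp
  then have "head G (y 0) \<in> D (Suc n)"
    by (rule head_D[OF w])
  ultimately show False
    using inf_path_head[OF inf, of 0] by simp
qed

lemma transfer_matrix_eq:
  assumes "v \<in> verts G" "w \<in> verts G"
  shows "M n v w = leaving_weight (D n) v w"
proof -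
  have "exp (- \<beta> * sum_list (map F \<mu>)) = walk_weight \<mu>" for \<mu>
    by (simp add: walk_weight_def sum_list_const_mult)
  then show ?thesis
    using leaving_weight_infsum[OF assms] by (simp add: transfer_matrix_def)
qed

lemma prepend_nonempty:
  "awalk u p v \<Longrightarrow> B \<subseteq> cylinder G v [] \<Longrightarrow> B \<noteq> {} \<Longrightarrow> prepend p B \<noteq> {}"
proof (induction p arbitrary: u)
  case Nil
  then show ?case
    by (auto simp: prepend_def cylinder_def)
next
  case (Cons a p)
  then have a: "a \<in> arcs G" and p: "awalk (head G a) p v"
    by (auto simp: awalk_Cons_iff)
  from Cons.IH[OF p Cons.prems(2,3)] show ?case
    using shift_image_prepend(1)[OF a p Cons.prems(2)] by auto
qed

text \<open>
Following a leaving walk by an exit path from its end produces an exit path.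
\<close>

lemma leaving_walk_to_boundary:
  assumes v: "v \<in> D n" and w: "w \<in> bd (Suc n)" and L: "leaving_walks G (D n) v w \<noteq> {}"
  shows "v \<in> bd n"
proof -
  obtain p where p: "awalk v p w" and out: "\<forall>a\<in>set p. head G a \<notin> D n"
    using L by (auto simp: leaving_walks_def)
  have "exit_paths G (D (Suc n)) w \<noteq> {}"
    using w by (simp add: vertex_boundary_def)
  from prepend_nonempty[OF p exit_paths_subset this]
  obtain x where x: "x \<in> prepend p (exit_paths G (D (Suc n)) w)"
    by auto
  then have inf: "x \<in> inf_paths G" and nth: "\<And>i. i < length p \<Longrightarrow> x i = p ! i"
    and exit: "(\<lambda>i. x (length p + i)) \<in> exit_paths G (D (Suc n)) w"
    by (auto simp: prepend_def)
  have "x \<in> prepend p (cylinder G w [])"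
    using x exit_paths_subset by (auto simp: prepend_def)
  then have "x \<in> cylinder G v p"
    using cylinder_eq_prepend[OF p] by simp
  then have "tail G (x 0) = v"
    by (simp add: cylinder_def)
  moreover have "x \<in> wandering G"
    using exit wandering_drop[OF inf] by (simp add: exit_paths_def)
  moreover have "tail G (x i) \<notin> D n" if i: "1 \<le> i" for i
  proof (cases "i \<le> length p")
    case True
    then have "tail G (x i) = head G (p ! (i - 1))"
      using i inf_path_head[OF inf, of "i - 1"] nth[of "i - 1"] by simp
    then show ?thesis
      using out True i by simp
  next
    case False
    have "\<forall>j\<ge>1. tail G (x (length p + j)) \<notin> D (Suc n)"
      using exit by (simp add: exit_paths_def)
    from this[rule_format, of "i - length p"] False have "tail G (x i) \<notin> D (Suc n)"
      by simp
    then show ?thesis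
      using D_Suc by blast
  qed
  ultimately have "x \<in> exit_paths G (D n) v"
    by (simp add: exit_paths_def)
  then show ?thesis
    using v by (auto simp: vertex_boundary_def)
qed

text \<open>
Sums over \<open>\<partial>D\<^sub>n\<close> may therefore be extended to all of \<open>D\<^sub>n\<close>, where the Green kernel is invertible.
\<close>

lemma transfer_matrix_eq_0:
  assumes "v \<in> D n" "v \<notin> bd n" "w \<in> bd (Suc n)"
  shows "M n v w = 0"
proof -
  have "leaving_walks G (D n) v w = {}"
    using leaving_walk_to_boundary assms by blast
  then show ?thesis
    by (simp add: transfer_matrix_def)
qed

text \<open>
The function \<open>\<Sum>w. g(v,w) f(w)\<close>, with \<open>f\<close> regarded as a charge on \<open>\<partial>D\<^sub>n\<close>.
\<close>

definition boundary_potential :: "nat \<Rightarrow> ('v \<Rightarrow> real) \<Rightarrow> 'v \<Rightarrow> real" where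
  "boundary_potential n f v = (\<Sum>w\<in>bd n. green_real v w * f w)"

text \<open>
On \<open>D\<^sub>n\<close>, the potential of a charge \<open>f\<close> on \<open>\<partial>D\<^bsub>n+1\<^esub>\<close> equals the potential of the charge \<open>M(n) f\<close>, by
cutting walks at their last visit to \<open>D\<^sub>n\<close>.
\<close>

lemma boundary_potential_Suc:
  assumes v: "v \<in> D n"
  shows "boundary_potential (Suc n) f v =
    (\<Sum>u\<in>D n. green_real v u * (\<Sum>w\<in>bd (Suc n). M n u w * f w))"
proof -
  have "boundary_potential (Suc n) f v =
      (\<Sum>w\<in>bd (Suc n). (\<Sum>u\<in>D n. green_real v u * M n u w) * f w)"
    unfolding boundary_potential_def
  proof (rule sum.cong[OF refl])
    fix w assume w: "w \<in> bd (Suc n)"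
    have "green_real v w = (\<Sum>u\<in>D n. green_real v u * leaving_weight (D n) u w)"
      using green_real_last_exit[OF finite_D D_subset_verts v bd_verts[OF w] bd_Suc_disjoint[OF w]] .
    also have "\<dots> = (\<Sum>u\<in>D n. green_real v u * M n u w)"
      using transfer_matrix_eq[OF D_verts bd_verts[OF w]] by (intro sum.cong refl) simp
    finally show "green_real v w * f w = (\<Sum>u\<in>D n. green_real v u * M n u w) * f w"
      by simp
  qed
  also have "\<dots> = (\<Sum>w\<in>bd (Suc n). \<Sum>u\<in>D n. green_real v u * (M n u w * f w))"
    by (simp add: sum_distrib_right mult.assoc)
  also have "\<dots> = (\<Sum>u\<in>D n. \<Sum>w\<in>bd (Suc n). green_real v u * (M n u w * f w))"
    by (rule sum.swap)
  finally show ?thesis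
    by (simp add: sum_distrib_left)
qed

lemma sum_D_eq_sum_bd: "(\<And>w. w \<in> D n \<Longrightarrow> w \<notin> bd n \<Longrightarrow> f w = 0) \<Longrightarrow> sum f (D n) = sum f (bd n)"
  using finite_D bd_subset by (intro sum.mono_neutral_right) auto

lemma no_return_matrix_boundary_potential:
  assumes "v \<in> D n"
  shows "(\<Sum>u\<in>D n. no_return_matrix (D n) v u * boundary_potential n f u) =
    (if v \<in> bd n then f v else 0)"
proof -
  let ?f = "\<lambda>w. if w \<in> bd n then f w else 0"
  have "boundary_potential n f u = (\<Sum>w\<in>D n. green_real u w * ?f w)" for u
    unfolding boundary_potential_def by (subst sum_D_eq_sum_bd) auto
  then show ?thesis
    using no_return_matrix_inverts_green[OF finite_D D_subset_verts assms, of ?f] by simp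
qed

subsection \<open>From boundary sequences to harmonic functions\<close>

abbreviation Del :: "(nat \<Rightarrow> 'v \<Rightarrow> real) set" where
  "Del \<equiv> Delta G F \<beta> v0 D"

abbreviation Del_topology :: "(nat \<Rightarrow> 'v \<Rightarrow> real) topology" where
  "Del_topology \<equiv> subtopology (boundary_sequence_topology G D) Del"

lemma green_real_v0: "(\<Sum>n. weight_matrix_power G F \<beta> n v0 v0) = green_real v0 v0"
  using green_eq_suminf_weight_matrix_power[OF refl v0 summable_v0] summable_v0 weight_matrix_power_nonneg
  by (simp add: green_real_def suminf_nonneg)

lemma topspace_boundary_sequence:
  "topspace (boundary_sequence_topology G D) = (\<Pi>\<^sub>E k\<in>{1..}. \<Pi>\<^sub>E w\<in>bd k. {0..})"
  by (simp add: boundary_sequence_topology_def)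

lemma topspace_Del [simp]: "topspace Del_topology = Del"
  by (auto simp: Delta_def)

lemma Del_iff:
  "\<psi> \<in> Del \<longleftrightarrow> \<psi> \<in> (\<Pi>\<^sub>E k\<in>{1..}. \<Pi>\<^sub>E w\<in>bd k. {0..}) \<and>
     (\<Sum>w\<in>bd 1. M 0 v0 w * \<psi> 1 w) = inverse (green_real v0 v0) \<and>
     (\<forall>n\<ge>1. \<forall>v\<in>bd n. (\<Sum>w\<in>bd (Suc n). M n v w * \<psi> (Suc n) w) = \<psi> n v)"
  unfolding Delta_def mem_Collect_eq topspace_boundary_sequence green_real_v0 ..

lemma green_v0_pos: "0 < green_real v0 v0"
  using green_real_diagonal[OF v0] .

text \<open>
The equations \<open>M(n) \<psi>\<^bsup>n+1\<^esup> = \<psi>\<^bsup>n\<^esup>\<close> make the potentials of successive levels agree on the smaller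
of the two sets.
\<close>

lemma boundary_potential_Del:
  assumes \<psi>: "\<psi> \<in> Del" and n: "1 \<le> n" "v \<in> D n" "n \<le> k"
  shows "boundary_potential k (\<psi> k) v = boundary_potential n (\<psi> n) v"
  using n(3)
proof (induction k rule: dec_induct)
  case base
  show ?case ..
next
  case (step k)
  have v: "v \<in> D k"
    using n(2) D_mono[OF step(1)] by blast
  have "boundary_potential (Suc k) (\<psi> (Suc k)) v =
      (\<Sum>u\<in>D k. green_real v u * (\<Sum>w\<in>bd (Suc k). M k u w * \<psi> (Suc k) w))"
    by (rule boundary_potential_Suc[OF v])
  also have "\<dots> = (\<Sum>u\<in>bd k. green_real v u * (\<Sum>w\<in>bd (Suc k). M k u w * \<psi> (Suc k) w))"
    by (rule sum_D_eq_sum_bd) (simp add: transfer_matrix_eq_0)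
  also have "\<dots> = boundary_potential k (\<psi> k) v"
    unfolding boundary_potential_def
    using \<psi> n(1) step(1) by (intro sum.cong refl) (simp add: Del_iff)
  finally show ?case
    using step.IH by simp
qed

text \<open>
Levels start at \<open>1\<close> because the sequences in \<open>\<Delta>\<^bsub>\<beta>F\<^esub>\<close> do.
\<close>

definition level :: "'v \<Rightarrow> nat" where
  "level v = (LEAST n. 1 \<le> n \<and> v \<in> D n)"

definition harmonic_extension :: "(nat \<Rightarrow> 'v \<Rightarrow> real) \<Rightarrow> 'v \<Rightarrow> real" where
  "harmonic_extension \<psi> = restrict (\<lambda>v. boundary_potential (level v) (\<psi> (level v)) v) (verts G)"

lemma level:
  assumes "v \<in> verts G"
  shows "1 \<le> level v" "v \<in> D (level v)"
proof -
  have "(\<Union>n. D n) = verts G"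
    using exhaustion by (simp add: exhaustion_def)
  then obtain n where "v \<in> D n"
    using assms by blast
  then have "1 \<le> Suc n \<and> v \<in> D (Suc n)"
    using subsetD[OF D_Suc] by simp
  then have "1 \<le> level v \<and> v \<in> D (level v)"
    unfolding level_def by (rule LeastI)
  then show "1 \<le> level v" "v \<in> D (level v)"
    by auto
qed

lemma harmonic_extension_eq:
  assumes \<psi>: "\<psi> \<in> Del" and n: "1 \<le> n" "v \<in> D n"
  shows "harmonic_extension \<psi> v = boundary_potential n (\<psi> n) v"
proof -
  have v: "v \<in> verts G"
    using n D_verts by blast
  have "level v \<le> n"
    unfolding level_def using n by (intro Least_le) simp
  then show ?thesis
    using boundary_potential_Del[OF \<psi> level[OF v] \<open>level v \<le> n\<close>] v by (simp add: harmonic_extension_def)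
qed

lemma Del_nonneg: "\<psi> \<in> Del \<Longrightarrow> 1 \<le> n \<Longrightarrow> w \<in> bd n \<Longrightarrow> 0 \<le> \<psi> n w"
  by (auto simp: Del_iff PiE_iff)

text \<open>
To see harmonicity at \<open>v \<in> D\<^sub>n\<close>, pass to level \<open>n + 1\<close>: the charge then lies on \<open>\<partial>D\<^bsub>n+1\<^esub>\<close>, which
misses \<open>v\<close>, and \<open>g(\<cdot>,w)\<close> is harmonic off \<open>w\<close>. The normalization is the equation for \<open>M(0)\<close>.
\<close>

lemma harmonic_extension_in:
  assumes \<psi>: "\<psi> \<in> Del"
  shows "harmonic_extension \<psi> \<in> normalized_harmonic v0"
proof -
  have "harmonic (harmonic_extension \<psi>)"
    unfolding harmonic_def
  proof (intro ballI conjI)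
    fix v assume v: "v \<in> verts G"
    define n where "n = level v"
    have n: "1 \<le> n" "v \<in> D n"
      using level[OF v] by (auto simp: n_def)
    show "0 \<le> harmonic_extension \<psi> v"
      unfolding harmonic_extension_eq[OF \<psi> n] boundary_potential_def
      by (intro sum_nonneg mult_nonneg_nonneg green_real_nonneg Del_nonneg[OF \<psi> n(1)])
    have Suc_n: "1 \<le> Suc n" "v \<in> D (Suc n)"
      using n subsetD[OF D_Suc] by simp_all
    have "harmonic_extension \<psi> v = (\<Sum>w\<in>bd (Suc n). green_real v w * \<psi> (Suc n) w)"
      unfolding harmonic_extension_eq[OF \<psi> Suc_n] boundary_potential_def ..
    also have "\<dots> = (\<Sum>w\<in>bd (Suc n). \<Sum>a\<in>out_arcs G v.
        exp (- (\<beta> * F a)) * (green_real (head G a) w * \<psi> (Suc n) w))"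
    proof (rule sum.cong[OF refl])
      fix w assume w: "w \<in> bd (Suc n)"
      have "v \<noteq> w"
        using bd_Suc_disjoint[OF w] n by auto
      then show "green_real v w * \<psi> (Suc n) w =
          (\<Sum>a\<in>out_arcs G v. exp (- (\<beta> * F a)) * (green_real (head G a) w * \<psi> (Suc n) w))"
        using green_real_first_step[OF v bd_verts[OF w]] by (simp add: sum_distrib_right mult.assoc)
    qed
    also have "\<dots> = (\<Sum>a\<in>out_arcs G v. exp (- (\<beta> * F a)) * boundary_potential (Suc n) (\<psi> (Suc n)) (head G a))"
      unfolding boundary_potential_def sum_distrib_left by (rule sum.swap)
    also have "\<dots> = (\<Sum>a\<in>out_arcs G v. exp (- (\<beta> * F a)) * harmonic_extension \<psi> (head G a))"
      using harmonic_extension_eq[OF \<psi> Suc_n(1) head_D[OF n(2)]] by (intro sum.cong refl) simp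
    finally show "harmonic_extension \<psi> v =
        (\<Sum>a\<in>out_arcs G v. exp (- (\<beta> * F a)) * harmonic_extension \<psi> (head G a))" .
  qed
  moreover have "harmonic_extension \<psi> v0 = 1"
  proof -
    have "v0 \<in> D 0" "v0 \<in> D 1"
      using D_Suc[of 0] D_0 by auto
    then have "harmonic_extension \<psi> v0 = (\<Sum>u\<in>D 0. green_real v0 u * (\<Sum>w\<in>bd 1. M 0 u w * \<psi> 1 w))"
      using harmonic_extension_eq[OF \<psi>, of 1 v0] boundary_potential_Suc[of v0 0 "\<psi> 1"] by simp
    also have "\<dots> = green_real v0 v0 * inverse (green_real v0 v0)"
      using \<psi> by (simp add: D_0 Del_iff)
    also have "\<dots> = 1"
      using green_v0_pos by simp
    finally show ?thesis .
  qed
  ultimately show ?thesis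
    using v0 by (simp add: normalized_harmonic_def harmonic_extension_def)
qed

subsection \<open>From harmonic functions to boundary sequences\<close>

text \<open>
The charge on \<open>\<partial>D\<^sub>n\<close> whose potential is \<open>h\<close> on \<open>D\<^sub>n\<close>, obtained by applying the inverse of the Green
kernel. In this form it visibly depends continuously on \<open>h\<close>.
\<close>

definition boundary_charge :: "('v \<Rightarrow> real) \<Rightarrow> nat \<Rightarrow> 'v \<Rightarrow> real" where
  "boundary_charge h = restrict (\<lambda>n. restrict (\<lambda>w. \<Sum>u\<in>D n. no_return_matrix (D n) w u * h u) (bd n)) {1..}"

lemma boundary_charge_apply:
  "1 \<le> n \<Longrightarrow> w \<in> bd n \<Longrightarrow> boundary_charge h n w = (\<Sum>u\<in>D n. no_return_matrix (D n) w u * h u)"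
  by (simp add: boundary_charge_def)

context
  fixes h :: "'v \<Rightarrow> real"
  assumes h: "h \<in> normalized_harmonic v0"
begin

text \<open>
The same charge in probabilistic form, which shows that it is non-negative and supported on \<open>\<partial>D\<^sub>n\<close>.
\<close>

definition exit_measure :: "nat \<Rightarrow> 'v \<Rightarrow> real" where
  "exit_measure n w = measure (harmonic_measure h) (exit_paths G (D n) w)"

lemma boundary_potential_exit_measure:
  assumes v: "v \<in> D n"
  shows "boundary_potential n (exit_measure n) v = h v"
proof -
  have harm: "harmonic h" "h v0 \<noteq> 0"
    using h by (auto simp: normalized_harmonic_def)
  have "h v = measure (harmonic_measure h) (cylinder G v [])"
    using measure_harmonic_measure[OF harm(1)] D_verts[OF v] by simp
  also have "\<dots> = (\<Sum>w\<in>D n. green_real v w * exit_measure n w)"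
    unfolding exit_measure_def
    by (rule measure_cylinder_last_visit[OF conformal_harmonic_measure[OF harm(1) v0 harm(2)]
          finite_D D_subset_verts v])
  also have "\<dots> = boundary_potential n (exit_measure n) v"
    unfolding boundary_potential_def
    by (rule sum_D_eq_sum_bd) (auto simp: vertex_boundary_def exit_measure_def)
  finally show ?thesis ..
qed

lemma exit_measure_eq_no_return:
  assumes w: "w \<in> bd n"
  shows "exit_measure n w = (\<Sum>u\<in>D n. no_return_matrix (D n) w u * h u)"
proof -
  have "w \<in> D n"
    using w bd_subset by blast
  from no_return_matrix_boundary_potential[OF this, of "exit_measure n"] w
  show ?thesis
    by (simp add: boundary_potential_exit_measure)
qed

text \<open>
The charges of levels \<open>n\<close> and \<open>n + 1\<close> both have potential \<open>h\<close> on \<open>D\<^sub>n\<close>, and the potential of the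
latter is that of its image under \<open>M(n)\<close>; the Green kernel being invertible on \<open>D\<^sub>n\<close>, they coincide.
\<close>

lemma exit_measure_transfer:
  assumes u: "u \<in> bd n"
  shows "(\<Sum>w\<in>bd (Suc n). M n u w * exit_measure (Suc n) w) = exit_measure n u"
proof -
  let ?f = "\<lambda>u. \<Sum>w\<in>bd (Suc n). M n u w * exit_measure (Suc n) w"
  have u': "u \<in> D n"
    using u bd_subset by blast
  have "exit_measure n u = (\<Sum>x\<in>D n. no_return_matrix (D n) u x * boundary_potential (Suc n) (exit_measure (Suc n)) x)"
    unfolding exit_measure_eq_no_return[OF u]
    by (intro sum.cong refl) (simp add: boundary_potential_exit_measure subsetD[OF D_Suc])
  also have "\<dots> = (\<Sum>x\<in>D n. no_return_matrix (D n) u x * (\<Sum>y\<in>D n. green_real x y * ?f y))"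
    by (intro sum.cong refl) (simp add: boundary_potential_Suc)
  also have "\<dots> = ?f u"
    by (rule no_return_matrix_inverts_green[OF finite_D D_subset_verts u'])
  finally show ?thesis ..
qed

lemma boundary_charge_eq_exit_measure:
  "1 \<le> n \<Longrightarrow> w \<in> bd n \<Longrightarrow> boundary_charge h n w = exit_measure n w"
  by (simp add: boundary_charge_apply exit_measure_eq_no_return)

text \<open>
Since \<open>D\<^sub>0 = {v0}\<close>, the representation of \<open>h v0 = 1\<close> at level \<open>0\<close> has at most one term, so it
determines the charge and shows that the boundary is not empty.
\<close>

lemma v0_boundary: "v0 \<in> bd 0"
  and exit_measure_v0: "exit_measure 0 v0 = inverse (green_real v0 v0)"
proof -
  have "boundary_potential 0 (exit_measure 0) v0 = 1"
    using boundary_potential_exit_measure[of v0 0] h D_0 by (simp add: normalized_harmonic_def)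
  then have eq: "(\<Sum>w\<in>bd 0. green_real v0 w * exit_measure 0 w) = 1"
    by (simp add: boundary_potential_def)
  then have "bd 0 \<noteq> {}"
    by auto
  then have bd_0: "bd 0 = {v0}"
    using subset_singletonD[of "bd 0" v0] bd_subset[of 0] by (simp add: D_0)
  then show "v0 \<in> bd 0"
    by simp
  show "exit_measure 0 v0 = inverse (green_real v0 v0)"
    using eq bd_0 by (simp add: inverse_unique mult.commute)
qed

lemma boundary_charge_in: "boundary_charge h \<in> Del"
  unfolding Del_iff
proof (intro conjI allI impI ballI)
  have "0 \<le> boundary_charge h n w" if "1 \<le> n" "w \<in> bd n" for n w
    using boundary_charge_eq_exit_measure[OF that] by (simp add: exit_measure_def)
  then show "boundary_charge h \<in> (\<Pi>\<^sub>E k\<in>{1..}. \<Pi>\<^sub>E w\<in>bd k. {0..})"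
    by (auto simp: PiE_iff boundary_charge_def extensional_def)
  show "(\<Sum>w\<in>bd 1. M 0 v0 w * boundary_charge h 1 w) = inverse (green_real v0 v0)"
    using exit_measure_transfer[OF v0_boundary] exit_measure_v0
    by (simp add: boundary_charge_eq_exit_measure)
  show "(\<Sum>w\<in>bd (Suc n). M n v w * boundary_charge h (Suc n) w) = boundary_charge h n v"
    if "1 \<le> n" "v \<in> bd n" for n v
    using exit_measure_transfer[OF that(2)] that by (simp add: boundary_charge_eq_exit_measure)
qed

lemma harmonic_extension_boundary_charge: "harmonic_extension (boundary_charge h) = h"
proof
  fix v
  show "harmonic_extension (boundary_charge h) v = h v"
  proof (cases "v \<in> verts G")
    case True
    note n = level[OF True]
    have "harmonic_extension (boundary_charge h) v = boundary_potential (level v) (boundary_charge h (level v)) v"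
      using harmonic_extension_eq[OF boundary_charge_in n] .
    also have "\<dots> = boundary_potential (level v) (exit_measure (level v)) v"
      unfolding boundary_potential_def using boundary_charge_eq_exit_measure[OF n(1)]
      by (intro sum.cong refl) simp
    also have "\<dots> = h v"
      using boundary_potential_exit_measure[OF n(2)] .
    finally show ?thesis .
  next
    case False
    then show ?thesis
      using h by (simp add: harmonic_extension_def normalized_harmonic_def extensional_def)
  qed
qed

end

lemma boundary_charge_harmonic_extension:
  assumes \<psi>: "\<psi> \<in> Del"
  shows "boundary_charge (harmonic_extension \<psi>) = \<psi>"
proof (intro ext)
  fix n w
  have ext: "\<psi> \<in> extensional {1..}" "1 \<le> n \<Longrightarrow> \<psi> n \<in> extensional (bd n)"
    using \<psi> by (auto simp: Del_iff PiE_iff)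
  consider "n \<notin> {1..}" | "1 \<le> n" "w \<notin> bd n" | "1 \<le> n" "w \<in> bd n"
    by auto
  then show "boundary_charge (harmonic_extension \<psi>) n w = \<psi> n w"
  proof cases
    case 1
    then show ?thesis
      using ext(1) by (simp add: boundary_charge_def extensional_def)
  next
    case 2
    then show ?thesis
      using ext(2) by (simp add: boundary_charge_def extensional_def)
  next
    case 3
    then have "w \<in> D n"
      using bd_subset by blast
    then show ?thesis
      using no_return_matrix_boundary_potential[of w n "\<psi> n"] 3
      by (simp add: boundary_charge_apply harmonic_extension_eq[OF \<psi> 3(1)])
  qed
qed

subsection \<open>Topology of boundary sequences\<close>

lemma continuous_map_boundary_entry:
  assumes "1 \<le> k" "w \<in> bd k"
  shows "continuous_map Del_topology euclideanreal (\<lambda>\<psi>. \<psi> k w)"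
proof -
  have "continuous_map (boundary_sequence_topology G D)
      (product_topology (\<lambda>_. top_of_set {0..}) (bd k)) (\<lambda>\<psi>. \<psi> k)"
    unfolding boundary_sequence_topology_def
    using assms by (intro continuous_map_product_projection) simp
  moreover have "continuous_map (product_topology (\<lambda>_. top_of_set {0..}) (bd k)) euclideanreal (\<lambda>f. f w)"
    using continuous_map_product_projection[OF assms(2), of "\<lambda>_. top_of_set {0..}"]
    by (rule continuous_map_into_fulltopology)
  ultimately show ?thesis
    using continuous_map_compose[of _ _ "\<lambda>\<psi>. \<psi> k" _ "\<lambda>f. f w"]
    by (intro continuous_map_from_subtopology) (simp add: o_def)
qed

text \<open>
Extensionality and non-negativity of the entries are part of membership in \<open>\<Delta>\<^bsub>\<beta>F\<^esub>\<close>, so only the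
real-valued entries have to be checked.
\<close>

lemma continuous_map_into_Del:
  assumes "\<And>x. x \<in> topspace X \<Longrightarrow> f x \<in> Del"
    and "\<And>k w. 1 \<le> k \<Longrightarrow> w \<in> bd k \<Longrightarrow> continuous_map X euclideanreal (\<lambda>x. f x k w)"
  shows "continuous_map X Del_topology f"
proof -
  have ext: "f x \<in> extensional {1..}" "1 \<le> k \<Longrightarrow> f x k \<in> extensional (bd k)"
    "1 \<le> k \<Longrightarrow> w \<in> bd k \<Longrightarrow> 0 \<le> f x k w"
    if "x \<in> topspace X" for x k w
    using assms(1)[OF that] Del_nonneg by (auto simp: Del_iff PiE_iff)
  have "continuous_map X (product_topology (\<lambda>_. top_of_set {0..}) (bd k)) (\<lambda>x. f x k)" if "1 \<le> k" for k
    using assms(2)[OF that] ext(2,3)[OF _ that]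
    by (auto simp: continuous_map_componentwise continuous_map_in_subtopology)
  then have "continuous_map X (boundary_sequence_topology G D) f"
    unfolding boundary_sequence_topology_def using ext(1)
    by (auto simp: continuous_map_componentwise)
  then show ?thesis
    using assms(1) by (auto simp: continuous_map_in_subtopology)
qed

lemma boundary_potential_mix:
  "boundary_potential n (\<lambda>w. t * f w + (1 - t) * g w) v =
     t * boundary_potential n f v + (1 - t) * boundary_potential n g v"
  by (simp add: boundary_potential_def sum_distrib_left sum.distrib algebra_simps flip: sum.distrib)

lemma mix_sequence_in:
  assumes \<psi>: "\<psi> \<in> Del" and \<phi>: "\<phi> \<in> Del" and t: "0 \<le> t" "t \<le> 1"
  shows "mix_sequence t \<psi> \<phi> \<in> Del"
  unfolding Del_iff
proof (intro conjI allI impI ballI)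
  \<comment> \<open>Off the index sets both sequences have the same default value, which mixing preserves.\<close>
  have undef: "t * c + (1 - t) * c = c" for c :: real
    by (simp add: algebra_simps)
  show "mix_sequence t \<psi> \<phi> \<in> (\<Pi>\<^sub>E k\<in>{1..}. \<Pi>\<^sub>E w\<in>bd k. {0..})"
    using \<psi> \<phi> t by (auto simp: Del_iff PiE_iff extensional_def mix_sequence_def undef fun_eq_iff)
  have lin: "(\<Sum>w\<in>bd k. c w * mix_sequence t \<psi> \<phi> k w) =
      t * (\<Sum>w\<in>bd k. c w * \<psi> k w) + (1 - t) * (\<Sum>w\<in>bd k. c w * \<phi> k w)" for k c
    by (simp add: mix_sequence_def sum_distrib_left algebra_simps flip: sum.distrib)
  show "(\<Sum>w\<in>bd 1. M 0 v0 w * mix_sequence t \<psi> \<phi> 1 w) = inverse (green_real v0 v0)"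
    unfolding lin using \<psi> \<phi> by (simp add: Del_iff undef)
  show "(\<Sum>w\<in>bd (Suc n). M n v w * mix_sequence t \<psi> \<phi> (Suc n) w) = mix_sequence t \<psi> \<phi> n v"
    if "1 \<le> n" "v \<in> bd n" for n v
    unfolding lin using \<psi> \<phi> that by (simp add: Del_iff mix_sequence_def)
qed

lemma convex_system_Del: "convex_system Del_topology mix_sequence"
  unfolding convex_system_def topspace_Del using mix_sequence_in by auto

theorem Del_homeomorphic_harmonic:
  "affinely_homeomorphic Del_topology mix_sequence (harmonic_topology v0) mix_function"
proof (rule affinely_homeomorphicI[of _ _ harmonic_extension boundary_charge])
  show "continuous_map Del_topology (harmonic_topology v0) harmonic_extension"
  proof (rule continuous_map_into_harmonic_topology)
    show "continuous_map Del_topology euclideanreal (\<lambda>\<psi>. harmonic_extension \<psi> v)" if "v \<in> verts G" for v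
      using that level(1)[OF that] unfolding harmonic_extension_def boundary_potential_def
      by (simp, intro continuous_map_sum continuous_map_real_mult_left continuous_map_boundary_entry finite_bd)
  qed (simp add: harmonic_extension_in)
  show "continuous_map (harmonic_topology v0) Del_topology boundary_charge"
  proof (rule continuous_map_into_Del)
    show "continuous_map (harmonic_topology v0) euclideanreal (\<lambda>h. boundary_charge h k w)"
      if "1 \<le> k" "w \<in> bd k" for k w
      unfolding boundary_charge_apply[OF that]
      by (intro continuous_map_sum continuous_map_real_mult_left continuous_map_evaluation D_verts finite_D)
  qed (simp add: boundary_charge_in)
  show "boundary_charge (harmonic_extension \<psi>) = \<psi>" if "\<psi> \<in> topspace Del_topology" for \<psi>
    using boundary_charge_harmonic_extension that by simp
  show "harmonic_extension (boundary_charge h) = h" if "h \<in> topspace (harmonic_topology v0)" for h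
    using harmonic_extension_boundary_charge that by simp
  show "harmonic_extension (mix_sequence t \<psi> \<phi>) = mix_function t (harmonic_extension \<psi>) (harmonic_extension \<phi>)"
    for \<psi> \<phi> t
  proof
    fix v
    show "harmonic_extension (mix_sequence t \<psi> \<phi>) v =
        mix_function t (harmonic_extension \<psi>) (harmonic_extension \<phi>) v"
    proof (cases "v \<in> verts G")
      case True
      then show ?thesis
        by (simp add: harmonic_extension_def mix_function_def mix_sequence_def boundary_potential_mix)
    next
      case False
      then show ?thesis
        by (simp add: harmonic_extension_def mix_function_def algebra_simps)
    qed
  qed
qed

end

section \<open>The Bratteli diagram\<close>

context exhausted_graph
begin

abbreviation Br :: "(nat \<times> 'v, nat \<times> 'v \<times> 'v) pre_digraph" where
  "Br \<equiv> bratteli G D"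

abbreviation Br_potential :: "nat \<times> 'v \<times> 'v \<Rightarrow> real" where
  "Br_potential \<equiv> bratteli_potential G F \<beta> D"

lemma verts_Br: "(n, v) \<in> verts Br \<longleftrightarrow> v \<in> bd n"
  by (simp add: bratteli_def)

lemma out_arcs_Br:
  "v \<in> bd n \<Longrightarrow>
     out_arcs Br (n, v) = (\<lambda>w. (n, v, w)) ` {w \<in> bd (Suc n). leaving_walks G (D n) v w \<noteq> {}}"
  by (auto simp: bratteli_def out_arcs_def)

lemma path_space_Br: "path_space Br"
proof
  show "tail Br e \<in> verts Br" "head Br e \<in> verts Br" if "e \<in> arcs Br" for e
    using that by (auto simp: bratteli_def)
  have "verts Br = (SIGMA n:UNIV. bd n)"
    by (simp add: bratteli_def)
  then show "countable (verts Br)"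
    using finite_bd by (auto intro: countable_finite)
  have "arcs Br \<subseteq> (SIGMA n:UNIV. bd n \<times> bd (Suc n))"
    by (auto simp: bratteli_def)
  then show "countable (arcs Br)"
    by (rule countable_subset) (use finite_bd in \<open>auto intro: countable_finite\<close>)
  show "row_finite Br"
    unfolding row_finite_def
  proof
    fix x assume "x \<in> verts Br"
    then show "finite (out_arcs Br x)"
      using finite_bd by (cases x) (simp add: verts_Br out_arcs_Br)
  qed
qed

lemma exp_Br_potential:
  assumes "v \<in> bd n" "w \<in> bd (Suc n)" "leaving_walks G (D n) v w \<noteq> {}"
  shows "exp (- Br_potential (n, v, w)) = M n v w"
  using leaving_weight_pos[OF bd_verts[OF assms(1)] bd_verts[OF assms(2)] assms(3)]
    transfer_matrix_eq[OF bd_verts[OF assms(1)] bd_verts[OF assms(2)]]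
  by (simp add: bratteli_potential_def)

interpretation Br: potential Br Br_potential
  using path_space_Br by (simp add: potential_def)

text \<open>
An entry \<open>M(n)\<^bsub>v,w\<^esub>\<close> vanishes exactly when there is no arrow from \<open>(n, v)\<close> to \<open>(n + 1, w)\<close>.
\<close>

lemma sum_out_arcs_Br:
  assumes v: "v \<in> bd n"
  shows "(\<Sum>a\<in>out_arcs Br (n, v). exp (- Br_potential a) * h (head Br a)) =
    (\<Sum>w\<in>bd (Suc n). M n v w * h (Suc n, w))"
proof -
  let ?W = "{w \<in> bd (Suc n). leaving_walks G (D n) v w \<noteq> {}}"
  have "(\<Sum>a\<in>out_arcs Br (n, v). exp (- Br_potential a) * h (head Br a)) =
      (\<Sum>w\<in>?W. exp (- Br_potential (n, v, w)) * h (head Br (n, v, w)))"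
    unfolding out_arcs_Br[OF v] by (subst sum.reindex) (auto simp: inj_on_def)
  also have "\<dots> = (\<Sum>w\<in>?W. M n v w * h (Suc n, w))"
    using exp_Br_potential[OF v] by (intro sum.cong refl) (simp add: bratteli_def)
  also have "\<dots> = (\<Sum>w\<in>bd (Suc n). M n v w * h (Suc n, w))"
    using finite_bd by (intro sum.mono_neutral_left) (auto simp: transfer_matrix_def)
  finally show ?thesis .
qed

lemma harmonic_Br_iff:
  "Br.harmonic h \<longleftrightarrow> (\<forall>n. \<forall>v\<in>bd n. 0 \<le> h (n, v) \<and>
     h (n, v) = (\<Sum>w\<in>bd (Suc n). M n v w * h (Suc n, w)))"
proof -
  have "(\<forall>x\<in>verts Br. P x) \<longleftrightarrow> (\<forall>n. \<forall>v\<in>bd n. P (n, v))" for P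
    using verts_Br by fastforce
  then show ?thesis
    unfolding Br.harmonic_def by (simp add: sum_out_arcs_Br)
qed

text \<open>
The factor adapts the normalization: at the top vertex a normalized harmonic function is \<open>1\<close>,
while \<open>M(0) \<psi>\<^sup>1\<close> is \<open>1 / g(v0,v0)\<close>. Level \<open>0\<close>, which \<open>\<psi>\<close> does not contain, is filled in with \<open>1\<close>.
\<close>

definition Br_function :: "(nat \<Rightarrow> 'v \<Rightarrow> real) \<Rightarrow> nat \<times> 'v \<Rightarrow> real" where
  "Br_function \<psi> =
     restrict (\<lambda>(n, v). if n = 0 then 1 else green_real v0 v0 * \<psi> n v) (verts Br)"

definition Br_sequence :: "(nat \<times> 'v \<Rightarrow> real) \<Rightarrow> nat \<Rightarrow> 'v \<Rightarrow> real" where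
  "Br_sequence h = restrict (\<lambda>n. restrict (\<lambda>w. inverse (green_real v0 v0) * h (n, w)) (bd n)) {1..}"

lemma bd_0: "v \<in> bd 0 \<Longrightarrow> v = v0"
  using bd_subset[of 0] D_0 by auto

lemma Br_function_apply:
  "v \<in> bd n \<Longrightarrow> Br_function \<psi> (n, v) = (if n = 0 then 1 else green_real v0 v0 * \<psi> n v)"
  by (simp add: Br_function_def verts_Br)

lemma Br_sequence_apply:
  "1 \<le> n \<Longrightarrow> w \<in> bd n \<Longrightarrow> Br_sequence h n w = inverse (green_real v0 v0) * h (n, w)"
  by (simp add: Br_sequence_def)

text \<open>
That \<open>v0\<close> lies in \<open>\<partial>D\<^sub>0\<close> is obtained from the harmonic function on \<open>G\<close> that belongs to \<open>\<psi>\<close>.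
\<close>

lemma Br_function_in:
  assumes \<psi>: "\<psi> \<in> Del"
  shows "Br_function \<psi> \<in> Br.normalized_harmonic (0, v0)"
proof -
  have v0_bd: "v0 \<in> bd 0"
    using v0_boundary[OF harmonic_extension_in[OF \<psi>]] .
  have "Br.harmonic (Br_function \<psi>)"
    unfolding harmonic_Br_iff
  proof (intro allI ballI conjI)
    fix n v assume v: "v \<in> bd n"
    show "0 \<le> Br_function \<psi> (n, v)"
      using v green_v0_pos Del_nonneg[OF \<psi>, of n v] by (simp add: Br_function_apply)
    have "(\<Sum>w\<in>bd (Suc n). M n v w * Br_function \<psi> (Suc n, w)) =
        green_real v0 v0 * (\<Sum>w\<in>bd (Suc n). M n v w * \<psi> (Suc n) w)"
      by (simp add: Br_function_apply sum_distrib_left mult.left_commute)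
    also have "\<dots> = Br_function \<psi> (n, v)"
    proof (cases "n = 0")
      case True
      then have "v = v0"
        using v bd_0 by simp
      then show ?thesis
        using \<psi> True v green_v0_pos by (simp add: Del_iff Br_function_apply)
    next
      case False
      then show ?thesis
        using \<psi> v by (simp add: Del_iff Br_function_apply)
    qed
    finally show "Br_function \<psi> (n, v) = (\<Sum>w\<in>bd (Suc n). M n v w * Br_function \<psi> (Suc n, w))" ..
  qed
  then show ?thesis
    using v0_bd by (simp add: Br.normalized_harmonic_def verts_Br Br_function_apply)
      (simp add: Br_function_def)
qed

lemma Br_sequence_in:
  assumes h: "h \<in> Br.normalized_harmonic (0, v0)"
  shows "Br_sequence h \<in> Del"
  unfolding Del_iff
proof (intro conjI allI impI ballI)
  have v0_bd: "v0 \<in> bd 0" and one: "h (0, v0) = 1" and harm: "Br.harmonic h"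
    using h by (auto simp: Br.normalized_harmonic_def verts_Br)
  have nonneg: "0 \<le> h (n, v)" and step: "(\<Sum>w\<in>bd (Suc n). M n v w * h (Suc n, w)) = h (n, v)"
    if "v \<in> bd n" for n v
    using harm that unfolding harmonic_Br_iff by metis+
  have "0 \<le> Br_sequence h n w" if "1 \<le> n" "w \<in> bd n" for n w
    using nonneg that green_v0_pos by (simp add: Br_sequence_apply)
  then show "Br_sequence h \<in> (\<Pi>\<^sub>E k\<in>{1..}. \<Pi>\<^sub>E w\<in>bd k. {0..})"
    by (auto simp: PiE_iff Br_sequence_def extensional_def)
  have sum: "(\<Sum>w\<in>bd (Suc n). M n v w * Br_sequence h (Suc n) w) = inverse (green_real v0 v0) * h (n, v)"
    if v: "v \<in> bd n" for n v
    unfolding step[OF v, symmetric]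
    by (simp add: Br_sequence_apply sum_distrib_left mult.left_commute)
  show "(\<Sum>w\<in>bd 1. M 0 v0 w * Br_sequence h 1 w) = inverse (green_real v0 v0)"
    using sum[OF v0_bd] one by simp
  show "(\<Sum>w\<in>bd (Suc n). M n v w * Br_sequence h (Suc n) w) = Br_sequence h n v"
    if "1 \<le> n" "v \<in> bd n" for n v
    using sum[OF that(2)] that by (simp add: Br_sequence_apply)
qed

lemma Br_sequence_Br_function:
  assumes \<psi>: "\<psi> \<in> Del"
  shows "Br_sequence (Br_function \<psi>) = \<psi>"
proof (intro ext)
  fix n w
  have ext: "\<psi> \<in> extensional {1..}" "1 \<le> n \<Longrightarrow> \<psi> n \<in> extensional (bd n)"
    using \<psi> by (auto simp: Del_iff PiE_iff)
  show "Br_sequence (Br_function \<psi>) n w = \<psi> n w"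
    using ext green_v0_pos by (auto simp: Br_sequence_def Br_function_apply extensional_def restrict_def)
qed

lemma Br_function_Br_sequence:
  assumes h: "h \<in> Br.normalized_harmonic (0, v0)"
  shows "Br_function (Br_sequence h) = h"
proof
  fix x :: "nat \<times> 'v"
  obtain n v where x: "x = (n, v)"
    by (cases x)
  show "Br_function (Br_sequence h) x = h x"
  proof (cases "v \<in> bd n")
    case True
    then show ?thesis
      using h bd_0 green_v0_pos
      by (auto simp: x Br_function_apply Br_sequence_apply Br.normalized_harmonic_def)
  next
    case False
    then show ?thesis
      using h by (auto simp: x Br_function_def verts_Br Br.normalized_harmonic_def extensional_def)
  qed
qed

lemma Del_homeomorphic_harmonic_Br:
  "affinely_homeomorphic Del_topology mix_sequence (Br.harmonic_topology (0, v0)) mix_function"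
proof (rule affinely_homeomorphicI[of _ _ Br_function Br_sequence])
  show "continuous_map Del_topology (Br.harmonic_topology (0, v0)) Br_function"
  proof (rule Br.continuous_map_into_harmonic_topology)
    fix x assume "x \<in> verts Br"
    then obtain n v where x: "x = (n, v)" "v \<in> bd n"
      by (cases x) (simp add: verts_Br)
    show "continuous_map Del_topology euclideanreal (\<lambda>\<psi>. Br_function \<psi> x)"
      unfolding x(1) Br_function_apply[OF x(2)]
      using x(2) by (cases "n = 0") (auto intro!: continuous_map_real_mult_left continuous_map_boundary_entry)
  qed (simp add: Br_function_in)
  show "continuous_map (Br.harmonic_topology (0, v0)) Del_topology Br_sequence"
  proof (rule continuous_map_into_Del)
    show "continuous_map (Br.harmonic_topology (0, v0)) euclideanreal (\<lambda>h. Br_sequence h k w)"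
      if "1 \<le> k" "w \<in> bd k" for k w
      unfolding Br_sequence_apply[OF that]
      using that by (intro continuous_map_real_mult_left Br.continuous_map_evaluation) (simp add: verts_Br)
  qed (simp add: Br_sequence_in)
  show "Br_sequence (Br_function \<psi>) = \<psi>" if "\<psi> \<in> topspace Del_topology" for \<psi>
    using Br_sequence_Br_function that by simp
  show "Br_function (Br_sequence h) = h" if "h \<in> topspace (Br.harmonic_topology (0, v0))" for h
    using Br_function_Br_sequence that by simp
  show "Br_function (mix_sequence t \<psi> \<phi>) = mix_function t (Br_function \<psi>) (Br_function \<phi>)" for t \<psi> \<phi>
    by (rule ext) (auto simp: Br_function_def mix_function_def mix_sequence_def restrict_def algebra_simps)
qed

theorem boundary_homeomorphisms:
  defines "Conf \<equiv> cylinder_topology G (normalized_conformal G (\<lambda>a. \<beta> * F a) v0)"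
    and "BrConf \<equiv> cylinder_topology Br (normalized_conformal Br Br_potential (0, v0))"
  shows "affinely_homeomorphic Conf mix_measure Del_topology mix_sequence"
    and "affinely_homeomorphic Del_topology mix_sequence BrConf mix_measure"
proof -
  show "affinely_homeomorphic Conf mix_measure Del_topology mix_sequence"
    unfolding Conf_def
    by (rule affinely_homeomorphic_trans[OF conformal_homeomorphic_harmonic
          affinely_homeomorphic_sym[OF Del_homeomorphic_harmonic convex_system_Del]])
  show "affinely_homeomorphic Del_topology mix_sequence BrConf mix_measure"
    unfolding BrConf_def
    by (rule affinely_homeomorphic_trans[OF Del_homeomorphic_harmonic_Br
          affinely_homeomorphic_sym[OF Br.conformal_homeomorphic_harmonic Br.convex_system_conformal]])
qed

end

theorem theorem8p22:
  fixes G :: "('v, 'a) pre_digraph" and F :: "'a \<Rightarrow> real" and \<beta> :: real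
    and v0 :: 'v and D :: "nat \<Rightarrow> 'v set"
  assumes "wf_digraph G"
    and "countable (verts G)" and "countable (arcs G)"
    and "infinite (verts G)"
    and "row_finite G"
    and "v0 \<in> verts G"
    and "\<And>v. v \<in> verts G \<Longrightarrow>
           summable (\<lambda>n. weight_matrix_power G F \<beta> n v0 v) \<and>
           0 < (\<Sum>n. weight_matrix_power G F \<beta> n v0 v)"
    and "exhaustion G v0 D"
  defines "Conf \<equiv> cylinder_topology G (normalized_conformal G (\<lambda>a. \<beta> * F a) v0)"
    and "Del \<equiv> subtopology (boundary_sequence_topology G D) (Delta G F \<beta> v0 D)"
    and "BrConf \<equiv> cylinder_topology (bratteli G D)
           (normalized_conformal (bratteli G D) (bratteli_potential G F \<beta> D) (0, v0))"
  shows "affinely_homeomorphic Conf mix_measure Del mix_sequence \<and>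
         affinely_homeomorphic Del mix_sequence BrConf mix_measure \<and>
         affinely_homeomorphic Conf mix_measure BrConf mix_measure"
proof -
  interpret potential G "\<lambda>a. \<beta> * F a"
    using assms(1-5) by (simp add: potential_def path_space_def path_space_axioms_def)
  have green_v0: "green v0 v = ennreal (\<Sum>n. weight_matrix_power G F \<beta> n v0 v)" if "v \<in> verts G" for v
    using green_eq_suminf_weight_matrix_power[OF refl assms(6)] assms(7)[OF that] by blast
  \<comment> \<open>A walk from \<open>v0\<close> to \<open>v\<close> exists because \<open>g(v0,v)\<close> is positive; it carries finiteness of \<open>g(v0,w)\<close>
    over to \<open>g(v,w)\<close>.\<close>
  have green_less_top: "green v w < \<infinity>" if "v \<in> verts G" "w \<in> verts G" for v w
  proof -
    have "green v0 v \<noteq> 0"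
      using green_v0[OF that(1)] assms(7)[OF that(1)] by simp
    then have "{q. awalk v0 q v} \<noteq> {}"
      unfolding green_def by (metis total_weight_empty)
    then obtain q where "awalk v0 q v"
      by blast
    show ?thesis
      using green_reachable_less_top[OF _ \<open>awalk v0 q v\<close>, of w] green_v0[OF that(2)] by simp
  qed
  interpret exhausted_graph G F \<beta> v0 D
    using green_less_top assms(6-8) by unfold_locales auto
  show ?thesis
    unfolding Conf_def Del_def BrConf_def
    using boundary_homeomorphisms affinely_homeomorphic_trans[OF boundary_homeomorphisms] by blast
qed

end
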